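(* Let $K$ be a field of characteristic zero, let $X=(x_{i,j})$ be an $r\times s$ matrix of distinct indeterminates, and let $R=K[X]$, equipped with the lexicographic monomial order $<$ induced by $x_{1,1}>x_{1,2}>\dots>x_{1,s}>x_{2,1}>x_{2,2}>\dots>x_{r,s-1}>x_{r,s}$. For every integer $t$ with $1\le t\le\min\{r,s\}$ and every integer $n\ge0$, $$\mathrm{in}_<\big(I_t(X)^{(n)}\big)=\mathrm{in}_<\big(I_t(X)\big)^{(n)}.$$
   Context: $I_t(X)$ is the ideal of $R$ generated by the $t\times t$ minors of $X$. $\mathrm{in}_<(I)$ denotes the initial ideal of $I$ with respect to $<$. For an ideal $I$ of $R$ and $n\ge0$, $I^{(n)}=I^nR_S\cap R$, where $S$ is the complement of the union of the minimal primes of $I$. *)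

theory Defs
  imports
    "HOL-Library.Poly_Mapping"
    "HOL-Library.Product_Lexorder"
    "HOL-Computational_Algebra.Fraction_Field"
    "HOL-Algebra.Ideal_Product"
    "Jordan_Normal_Form.Determinant"
    "Jordan_Normal_Form.DL_Submatrix"
begin

section \<open>Subrings of a type-class ring as ring records\<close>

definition ring_on :: "'a::comm_ring_1 set \<Rightarrow> 'a ring" where
  "ring_on A = \<lparr>carrier = A, monoid.mult = (*), one = 1, zero = 0, add = (+)\<rparr>"

lemma ring_on_simps [simp]:
  "carrier (ring_on A) = A"
  "x \<otimes>\<^bsub>ring_on A\<^esub> y = x * y"
  "\<one>\<^bsub>ring_on A\<^esub> = 1"
  "\<zero>\<^bsub>ring_on A\<^esub> = 0"
  "x \<oplus>\<^bsub>ring_on A\<^esub> y = x + y"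
  by (simp_all add: ring_on_def)

lemma cring_ring_on:
  assumes "1 \<in> A" and "\<And>x. x \<in> A \<Longrightarrow> - x \<in> A"
    and "\<And>x y. x \<in> A \<Longrightarrow> y \<in> A \<Longrightarrow> x + y \<in> A" and "\<And>x y. x \<in> A \<Longrightarrow> y \<in> A \<Longrightarrow> x * y \<in> A"
  shows "cring (ring_on A)"
proof (rule cringI)
  have "0 \<in> A"
    using assms(3)[OF assms(1) assms(2)[OF assms(1)]] by simp
  then show "abelian_group (ring_on A)"
    using assms(2,3) by (intro abelian_groupI) (auto simp: algebra_simps intro: bexI[of _ "- _"])
  show "comm_monoid (ring_on A)"
    using assms by (intro comm_monoidI) (auto simp: algebra_simps)
qed (auto simp: algebra_simps)

section \<open>Symbolic powers\<close>

definition minimal_primes :: "('a, 'b) ring_scheme \<Rightarrow> 'a set \<Rightarrow> 'a set set" where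
  "minimal_primes R I =
     {P. primeideal P R \<and> I \<subseteq> P \<and> (\<forall>Q. primeideal Q R \<longrightarrow> I \<subseteq> Q \<longrightarrow> Q \<subseteq> P \<longrightarrow> Q = P)}"

text \<open>
  The localization of the domain \<open>A\<close> at a multiplicative set \<open>S\<close> not containing 0,
  realized inside the fraction field.
\<close>

definition localization :: "'a::idom set \<Rightarrow> 'a set \<Rightarrow> 'a fract ring" where
  "localization A S = ring_on {Fract a b |a b. a \<in> A \<and> b \<in> S}"

text \<open>
  \<open>symbolic_power A I n\<close> is $I^n A_S \cap A$, where the subring \<open>A\<close> is identified with its image
  in \<open>A\<^sub>S\<close>. The power \<open>I\<^sup>n\<close> is taken in the monoid of ideals, whose unit is \<open>A\<close>; thus \<open>I\<^sup>0 = A\<close>.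
\<close>

definition symbolic_power :: "'a::idom set \<Rightarrow> 'a set \<Rightarrow> nat \<Rightarrow> 'a set" where
  "symbolic_power A I n =
     (let S = A - \<Union> (minimal_primes (ring_on A) I);
          J = I [^]\<^bsub>ideals_set (ring_on A)\<^esub> n
      in {f \<in> A. Fract f 1 \<in> Idl\<^bsub>localization A S\<^esub> ((\<lambda>a. Fract a 1) ` J)})"

lemma cring_localization:
  fixes A S :: "'a::idom set"
  assumes A: "cring (ring_on A)" and S: "S \<subseteq> A" "1 \<in> S" "0 \<notin> S"
    and mult: "\<And>x y. x \<in> S \<Longrightarrow> y \<in> S \<Longrightarrow> x * y \<in> S"
  shows "cring (localization A S)"
proof -
  interpret cring "ring_on A" by fact
  have add: "x + y \<in> A" if "x \<in> A" "y \<in> A" for x y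
    using add.m_closed[of x y] that by simp
  have mul: "x * y \<in> A" if "x \<in> A" "y \<in> A" for x y
    using m_closed[of x y] that by simp
  have neg: "- x \<in> A" if "x \<in> A" for x
  proof -
    have "x + \<ominus>\<^bsub>ring_on A\<^esub> x = 0" "\<ominus>\<^bsub>ring_on A\<^esub> x \<in> A"
      using r_neg[of x] a_inv_closed[of x] that by auto
    then show ?thesis
      by (simp add: add_eq_0_iff)
  qed
  have S0: "b \<noteq> 0" if "b \<in> S" for b
    using that S by auto
  show ?thesis
    unfolding localization_def
  proof (rule cring_ring_on, safe)
    show "\<exists>a b. 1 = Fract a b \<and> a \<in> A \<and> b \<in> S"
      using S by (intro exI[of _ 1]) (auto simp: One_fract_def)
  next
    fix a b assume "a \<in> A" "b \<in> S"
    then show "\<exists>a' b'. - Fract a b = Fract a' b' \<and> a' \<in> A \<and> b' \<in> S"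
      using neg by (intro exI[of _ "- a"] exI[of _ b]) auto
  next
    fix a b c d assume "a \<in> A" "b \<in> S" "c \<in> A" "d \<in> S"
    then show "\<exists>a' b'. Fract a b + Fract c d = Fract a' b' \<and> a' \<in> A \<and> b' \<in> S"
      using S(1) by (intro exI[of _ "a * d + c * b"] exI[of _ "b * d"] conjI add mul mult)
        (simp_all add: S0 subset_iff)
  next
    fix a b c d assume "a \<in> A" "b \<in> S" "c \<in> A" "d \<in> S"
    then show "\<exists>a' b'. Fract a b * Fract c d = Fract a' b' \<and> a' \<in> A \<and> b' \<in> S"
      by (intro exI[of _ "a * c"] exI[of _ "b * d"] conjI mul mult) simp_all
  qed
qed

section \<open>The polynomial ring of an $r \times s$ matrix of indeterminates\<close>

text \<open>
  Rows and columns are numbered from 0, so the variables are indexed by the pairs \<open>(i, j)\<close> with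
  \<open>i < r\<close> and \<open>j < s\<close>. Polynomials map exponent vectors to coefficients.
\<close>

type_synonym monomial = "nat \<times> nat \<Rightarrow>\<^sub>0 nat"
type_synonym 'k mpoly = "monomial \<Rightarrow>\<^sub>0 'k"

definition poly_carrier :: "nat \<Rightarrow> nat \<Rightarrow> 'k::field mpoly set" where
  "poly_carrier r s = {f. \<forall>m \<in> Poly_Mapping.keys f. Poly_Mapping.keys m \<subseteq> {..<r} \<times> {..<s}}"

definition var :: "nat \<times> nat \<Rightarrow> 'k::field mpoly" where
  "var v = Poly_Mapping.single (Poly_Mapping.single v 1) 1"

definition generic_matrix :: "nat \<Rightarrow> nat \<Rightarrow> 'k::field mpoly mat" where
  "generic_matrix r s = mat r s var"

definition minors :: "nat \<Rightarrow> 'a::comm_ring_1 mat \<Rightarrow> 'a set" where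
  "minors t M = {det (submatrix M I J) |I J.
     I \<subseteq> {..<dim_row M} \<and> card I = t \<and> J \<subseteq> {..<dim_col M} \<and> card J = t}"

definition determinantal_ideal :: "nat \<Rightarrow> nat \<Rightarrow> nat \<Rightarrow> 'k::field mpoly set" where
  "determinantal_ideal r s t =
     Idl\<^bsub>ring_on (poly_carrier r s)\<^esub> (minors t (generic_matrix r s))"

text \<open>
  The type class order on \<^typ>\<open>monomial\<close> is the lexicographic order in which the smallest index,
  in the lexicographic order on pairs, is the largest variable: see the next two lemmas.
\<close>

lemma monomial_less_iff:
  fixes m m' :: monomial
  shows "m < m' \<longleftrightarrow> (\<exists>v. Poly_Mapping.lookup m v < Poly_Mapping.lookup m' v \<and>
    (\<forall>w < v. Poly_Mapping.lookup m w = Poly_Mapping.lookup m' w))"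
  by transfer (auto simp: less_fun_def)

lemma var_less_iff:
  "(Poly_Mapping.single (i, j) 1 :: monomial) < Poly_Mapping.single (k, l) 1 \<longleftrightarrow>
     k < i \<or> k = i \<and> l < j"
proof -
  let ?e = "\<lambda>v. Poly_Mapping.single v 1 :: monomial"
  have "?e v < ?e w \<longleftrightarrow> w < v" for v w
  proof
    assume "?e v < ?e w"
    then obtain u where u: "Poly_Mapping.lookup (?e v) u < Poly_Mapping.lookup (?e w) u"
      and less: "\<And>x. x < u \<Longrightarrow> Poly_Mapping.lookup (?e v) x = Poly_Mapping.lookup (?e w) x"
      using iffD1[OF monomial_less_iff] by meson
    from u have "u = w" "u \<noteq> v"
      by (auto simp: lookup_single when_def split: if_splits)
    moreover from this less[of v] have "\<not> v < u"
      by (auto simp: lookup_single simp del: less_prod_simp)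
    ultimately show "w < v"
      by (metis linorder_neqE)
  next
    assume "w < v"
    then show "?e v < ?e w"
      unfolding monomial_less_iff
      by (intro exI[of _ w]) (auto simp: lookup_single when_def simp del: less_prod_simp)
  qed
  then show ?thesis
    by auto
qed

definition initial_monomial :: "'k::field mpoly \<Rightarrow> 'k mpoly" where
  "initial_monomial f = Poly_Mapping.single (Max (Poly_Mapping.keys f)) 1"

definition initial_ideal :: "nat \<Rightarrow> nat \<Rightarrow> 'k::field mpoly set \<Rightarrow> 'k mpoly set" where
  "initial_ideal r s I =
     Idl\<^bsub>ring_on (poly_carrier r s)\<^esub> {initial_monomial f |f. f \<in> I \<and> f \<noteq> 0}"

lemma cring_poly_carrier: "cring (ring_on (poly_carrier r s :: 'k::field mpoly set))"
proof (rule cring_ring_on)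
  show "1 \<in> poly_carrier r s"
    by (simp add: poly_carrier_def)
  show "- f \<in> poly_carrier r s" if "f \<in> poly_carrier r s" for f :: "'k mpoly"
    using that by (simp add: poly_carrier_def)
  show "f + g \<in> poly_carrier r s"
    if "f \<in> poly_carrier r s" "g \<in> poly_carrier r s" for f g :: "'k mpoly"
    using that Poly_Mapping.keys_add[of f g] unfolding poly_carrier_def by blast
  show "f * g \<in> poly_carrier r s"
    if "f \<in> poly_carrier r s" "g \<in> poly_carrier r s" for f g :: "'k mpoly"
  proof -
    have "Poly_Mapping.keys m \<subseteq> {..<r} \<times> {..<s}" if "m \<in> Poly_Mapping.keys (f * g)" for m
    proof -
      from that obtain a b where "m = a + b" "a \<in> Poly_Mapping.keys f" "b \<in> Poly_Mapping.keys g"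
        using keys_mult[of f g] by blast
      with \<open>f \<in> _\<close> \<open>g \<in> _\<close> show ?thesis
        using Poly_Mapping.keys_add[of a b] unfolding poly_carrier_def by blast
    qed
    then show ?thesis
      by (simp add: poly_carrier_def)
  qed
qed

end

theory Submission
  imports Defs
begin

text \<open>
  Let \<open>I = I\<^sub>t(X)\<close>. Substituting \<open>X = YZ\<close> with \<open>Y\<close> of size \<open>r \<times> (t - 1)\<close> and \<open>Z\<close> of size \<open>(t - 1) \<times> s\<close> kills the
  \<open>t\<close>-minors. Conversely, if the support of the leading monomial of \<open>f\<close> contains no strictly increasing
  chain of length \<open>t\<close>, it splits into \<open>t - 1\<close> antichains, and each antichain is the smallest monomial with
  its row and column degrees; hence the leading term survives in \<open>f(YZ)\<close>. So \<open>I\<close> is the kernel of the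
  substitution, it is prime, and \<open>in(I)\<close> is generated by the \<open>t\<close>-chains. A monomial lies in \<open>in(I)\<^bsup>(n)\<^esup>\<close> iff
  its degree on every set \<open>F\<close> meeting all \<open>t\<close>-chains is at least \<open>n\<close>.

  A partial derivative maps \<open>I\<^bsup>(n+1)\<^esup>\<close> to \<open>I\<^bsup>(n)\<^esup>\<close> and, in characteristic 0, lowers the leading monomial by a
  prescribed variable; this gives one inclusion. For the other, the Greene--Kleitman theorem extracts
  from a monomial in \<open>in(I)\<^bsup>(n)\<^esup>\<close> disjoint chains \<open>C\<close> with \<open>\<Sum> max(|C| - t + 1, 0) \<ge> n\<close>, and an \<open>m\<close>-minor lies
  in \<open>I\<^bsup>(m-t+1)\<^esup>\<close> by Sylvester's identity for bordered minors.
\<close>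

\<comment> \<open>No Groebner basis of a symbolic power is computed. An initial ideal is determined
  by its set of leading monomials, so it is enough to exhibit, for each monomial passing the degree
  test, one element of the symbolic power that leads with it. Greene--Kleitman fits because it is a
  min-max statement, used with the constant \<open>k = t - 1\<close>: a set whose chains have at
  most t - 1 elements has a set meeting all t-chains as its complement, and a chain with m elements
  earns m - (t - 1), which is the exponent of the symbolic power that contains the m-minor with this
  diagonal. Degree at least n on all such complements is therefore enough to yield chains with total
  gain at least n. Characteristic 0 enters a second time in the substitution: a product of entries
  of YZ expands with natural coefficients, which cannot cancel. The row-major order matters twice as
  well: main diagonals lead in minors, and beyond the first position where two monomials differ, an
  exchange can only go right and down.\<close>
alias keys = Poly_Mapping.keys
alias lookup = Poly_Mapping.lookup
alias single = Poly_Mapping.single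

section \<open>The Greene--Kleitman theorem\<close>

text \<open>Halmos--Vaughan induction. If some nonempty proper \<open>Y\<close> has exactly
  \<open>card Y\<close> neighbours, match \<open>Y\<close> and then \<open>X - Y\<close> without
  those neighbours; Hall's condition for \<open>Z\<close> in the rest follows from that for
  \<open>Z \<union> Y\<close>. Otherwise every nonempty proper subset has a neighbour to spare, so
  any edge may be chosen and its endpoint removed.\<close>

lemma hall_marriage:
  fixes N :: "'a \<Rightarrow> 'b set"
  assumes "finite X" and "\<And>x. x \<in> X \<Longrightarrow> finite (N x)"
    and "\<And>Y. Y \<subseteq> X \<Longrightarrow> card Y \<le> card (\<Union> (N ` Y))"
  shows "\<exists>f. inj_on f X \<and> (\<forall>x\<in>X. f x \<in> N x)"
  using assms
proof (induction "card X" arbitrary: X N rule: less_induct)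
  case less
  note fin = less.prems(1,2) and hall = less.prems(3)
  show ?case
  proof (cases "\<exists>Y. Y \<subset> X \<and> Y \<noteq> {} \<and> card Y = card (\<Union> (N ` Y))")
    case True
    then obtain Y where Y: "Y \<subset> X" "Y \<noteq> {}" "card Y = card (\<Union> (N ` Y))"
      by blast
    then have finY: "finite Y" and sub: "Y \<subseteq> X"
      using fin(1) finite_subset by blast+
    have "\<exists>f. inj_on f Y \<and> (\<forall>x\<in>Y. f x \<in> N x)"
      using Y fin hall psubset_card_mono[OF fin(1) Y(1)] sub finY
      by (intro less.hyps) auto
    then obtain f where f: "inj_on f Y" "\<And>x. x \<in> Y \<Longrightarrow> f x \<in> N x"
      by blast
    define N' where "N' x = N x - \<Union> (N ` Y)" for x
    have "\<exists>g. inj_on g (X - Y) \<and> (\<forall>x\<in>X - Y. g x \<in> N' x)"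
    proof (rule less.hyps)
      show "card (X - Y) < card X"
        using Y fin(1) by (intro psubset_card_mono) auto
      fix Z assume Z: "Z \<subseteq> X - Y"
      then have finZ: "finite Z"
        using fin(1) by (meson finite_Diff finite_subset)
      have "card Z + card Y = card (Z \<union> Y)"
        using Z finZ finY by (subst card_Un_disjoint) auto
      also have "\<dots> \<le> card (\<Union> (N ` (Z \<union> Y)))"
        using Z sub by (intro hall) auto
      also have "\<Union> (N ` (Z \<union> Y)) = \<Union> (N' ` Z) \<union> \<Union> (N ` Y)"
        by (auto simp: N'_def)
      also have "card \<dots> \<le> card (\<Union> (N' ` Z)) + card (\<Union> (N ` Y))"
        by (rule card_Un_le)
      finally show "card Z \<le> card (\<Union> (N' ` Z))"
        using Y(3) by simp
    qed (use fin in \<open>auto simp: N'_def\<close>)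
    then obtain g where g: "inj_on g (X - Y)" "\<And>x. x \<in> X - Y \<Longrightarrow> g x \<in> N' x"
      by blast
    show ?thesis
    proof (intro exI[of _ "\<lambda>x. if x \<in> Y then f x else g x"] conjI ballI)
      have "f x \<noteq> g y" if "x \<in> Y" "y \<in> X - Y" for x y
        using f(2)[OF that(1)] g(2)[OF that(2)] that by (auto simp: N'_def)
      then show "inj_on (\<lambda>x. if x \<in> Y then f x else g x) X"
        using f(1) g(1) unfolding inj_on_def by (metis DiffI)
      show "(if x \<in> Y then f x else g x) \<in> N x" if "x \<in> X" for x
        using f(2) g(2)[of x] that by (auto simp: N'_def)
    qed
  next
    case False
    show ?thesis
    proof (cases "X = {}")
      case True
      then show ?thesis by simp
    next
      case ne: False
      then obtain x where x: "x \<in> X"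
        by blast
      with hall[of "{x}"] have "N x \<noteq> {}"
        by auto
      then obtain y where y: "y \<in> N x"
        by blast
      define N' where "N' z = N z - {y}" for z
      have "\<exists>g. inj_on g (X - {x}) \<and> (\<forall>z\<in>X - {x}. g z \<in> N' z)"
      proof (rule less.hyps)
        show "card (X - {x}) < card X"
          using fin(1) x by (meson card_Diff1_less)
        fix Z assume Z: "Z \<subseteq> X - {x}"
        have eq: "\<Union> (N' ` Z) = \<Union> (N ` Z) - {y}"
          by (auto simp: N'_def)
        show "card Z \<le> card (\<Union> (N' ` Z))"
        proof (cases "Z = {}")
          case ne: False
          have "card Z \<le> card (\<Union> (N ` Z))"
            using Z by (intro hall) auto
          moreover have "card Z \<noteq> card (\<Union> (N ` Z))"
            using False Z x ne by blast
          ultimately have "card Z < card (\<Union> (N ` Z))"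
            by simp
          then show ?thesis
            unfolding eq by (auto simp: card_Diff_singleton_if)
        qed auto
      qed (use fin in \<open>auto simp: N'_def\<close>)
      then obtain g where g: "inj_on g (X - {x})" "\<And>z. z \<in> X - {x} \<Longrightarrow> g z \<in> N' z"
        by blast
      show ?thesis
      proof (intro exI[of _ "g(x := y)"] conjI ballI)
        show "inj_on (g(x := y)) X"
          using g unfolding inj_on_def N'_def by (metis Diff_iff fun_upd_apply singletonD singletonI)
        show "(g(x := y)) z \<in> N z" if "z \<in> X" for z
          using g(2)[of z] that y by (auto simp: N'_def)
      qed
    qed
  qed
qed

text \<open>Egervary's theorem: an integral dual solution of minimal total weight satisfies Hall's condition
  on its tight edges, since otherwise it could be lowered on a violating set.\<close>

lemma assignment_duality:
  fixes w :: "'a \<Rightarrow> 'a \<Rightarrow> int"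
  assumes fin: "finite E"
  obtains \<sigma> u v where "bij_betw \<sigma> E E" "\<And>p q. p \<in> E \<Longrightarrow> q \<in> E \<Longrightarrow> w p q \<le> u p + v q"
    "\<And>p. p \<in> E \<Longrightarrow> u p + v (\<sigma> p) = w p (\<sigma> p)"
proof -
  define feas where "feas z \<longleftrightarrow> (\<forall>p\<in>E. \<forall>q\<in>E. w p q \<le> fst z p + snd z q)" for z :: "('a \<Rightarrow> int) \<times> ('a \<Rightarrow> int)"
  define val where "val z = (\<Sum>p\<in>E. fst z p + snd z p)" for z :: "('a \<Rightarrow> int) \<times> ('a \<Rightarrow> int)"
  have lower: "(\<Sum>p\<in>E. w p p) \<le> val z" if "feas z" for z
    using that unfolding feas_def val_def by (intro sum_mono) auto
  have "feas (\<lambda>p. \<Sum>q\<in>E. \<bar>w p q\<bar>, \<lambda>q. 0)"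
    unfolding feas_def
  proof (intro ballI)
    fix p q assume "p \<in> E" "q \<in> E"
    then have "\<bar>w p q\<bar> \<le> (\<Sum>q\<in>E. \<bar>w p q\<bar>)"
      using fin by (intro member_le_sum) auto
    then show "w p q \<le> fst (\<lambda>p. \<Sum>q\<in>E. \<bar>w p q\<bar>, \<lambda>q. 0) p + snd (\<lambda>p. \<Sum>q\<in>E. \<bar>w p q\<bar>, \<lambda>q. 0) q"
      by simp
  qed
  \<comment> \<open>\<open>lower\<close> bounds every feasible total by the weight of the identity,
    so the excess over it is a natural number and attains a minimum.\<close>
  then obtain z where z: "feas z"
    and min: "\<And>y. feas y \<Longrightarrow> nat (val z - (\<Sum>p\<in>E. w p p)) \<le> nat (val y - (\<Sum>p\<in>E. w p p))"
    using ex_has_least_nat[of feas _ "\<lambda>z. nat (val z - (\<Sum>p\<in>E. w p p))"] by blast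
  define u v where "u = fst z" and "v = snd z"
  have uv: "w p q \<le> u p + v q" if "p \<in> E" "q \<in> E" for p q
    using z that unfolding feas_def u_def v_def by auto
  define N where "N p = {q\<in>E. u p + v q = w p q}" for p
  have "\<exists>f. inj_on f E \<and> (\<forall>x\<in>E. f x \<in> N x)"
  proof (rule hall_marriage)
    fix Y assume Y: "Y \<subseteq> E"
    define T where "T = \<Union> (N ` Y)"
    have T: "T \<subseteq> E"
      by (auto simp: T_def N_def)
    \<comment> \<open>If \<open>card T < card Y\<close>, this would be a feasible solution of
      smaller total. Integrality matters: an edge from \<open>Y\<close> that leaves \<open>T\<close>
      is not tight, so it has slack at least 1.\<close>
    define y where "y = (\<lambda>p. u p - (if p \<in> Y then 1 else 0), \<lambda>q. v q + (if q \<in> T then 1 else 0))"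
    have "feas y"
      unfolding feas_def
    proof (intro ballI)
      fix p q assume pq: "p \<in> E" "q \<in> E"
      have "w p q < u p + v q" if "p \<in> Y" "q \<notin> T"
        using uv[OF pq] that pq by (force simp: T_def N_def)
      then show "w p q \<le> fst y p + snd y q"
        using uv[OF pq] by (auto simp: y_def)
    qed
    have "val y = val z - (\<Sum>p\<in>E. if p \<in> Y then 1 else 0) + (\<Sum>p\<in>E. if p \<in> T then 1 else 0)"
      by (simp add: val_def y_def u_def v_def sum.distrib sum_subtractf algebra_simps)
    also have "\<dots> = val z - int (card Y) + int (card T)"
      using fin Y T by (simp add: sum.If_cases Int_absorb1)
    finally show "card Y \<le> card (\<Union> (N ` Y))"
      using min[OF \<open>feas y\<close>] lower[OF z] lower[OF \<open>feas y\<close>] unfolding T_def by linarith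
  qed (use fin in \<open>auto simp: N_def\<close>)
  then obtain f where f: "inj_on f E" "\<And>p. p \<in> E \<Longrightarrow> f p \<in> N p"
    by blast
  then have "bij_betw f E E"
    using endo_inj_surj[OF fin _ f(1)] by (auto simp: bij_betw_def N_def)
  from that[OF this uv] f(2) show ?thesis
    by (simp add: N_def)
qed

text \<open>Assign weight 1 to a link \<open>p \<prec> q\<close> and weight \<open>1 - k\<close> to a link
  closing a chain; permutations then encode families of disjoint chains, and the elements on which
  the dual solution vanishes contain no chain longer than \<open>k\<close>.\<close>

theorem greene_kleitman:
  fixes R :: "'a \<Rightarrow> 'a \<Rightarrow> bool" and k :: nat
  assumes fin: "finite E" and irr: "\<And>x. \<not> R x x" and tr: "\<And>x y z. R x y \<Longrightarrow> R y z \<Longrightarrow> R x z"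
  obtains \<C> G where "finite \<C>" "\<And>C. C \<in> \<C> \<Longrightarrow> C \<subseteq> E"
    "\<And>C D. C \<in> \<C> \<Longrightarrow> D \<in> \<C> \<Longrightarrow> C \<noteq> D \<Longrightarrow> C \<inter> D = {}"
    "\<And>C x y. C \<in> \<C> \<Longrightarrow> x \<in> C \<Longrightarrow> y \<in> C \<Longrightarrow> x \<noteq> y \<Longrightarrow> R x y \<or> R y x"
    "G \<subseteq> E" "\<And>C. C \<subseteq> G \<Longrightarrow> (\<And>x y. x \<in> C \<Longrightarrow> y \<in> C \<Longrightarrow> x \<noteq> y \<Longrightarrow> R x y \<or> R y x) \<Longrightarrow> card C \<le> k"
    "card (E - G) \<le> (\<Sum>C\<in>\<C>. card C - k)"
proof -
  \<comment> \<open>A maximal run of links with \<open>c\<close> elements earns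
    \<open>(c - 1) + (1 - k) = c - k\<close>. For \<open>k > 0\<close> a fixed point has weight 0
    and stands for an element left out; for \<open>k = 0\<close> all weights are 1, and a fixed
    point counts as a chain of its own.\<close>
  define w :: "'a \<Rightarrow> 'a \<Rightarrow> int" where
    "w p q = (if R p q then 1 else if p = q \<and> k > 0 then 0 else 1 - int k)" for p q
  obtain \<sigma> u v where \<sigma>: "bij_betw \<sigma> E E"
    and uv: "\<And>p q. p \<in> E \<Longrightarrow> q \<in> E \<Longrightarrow> w p q \<le> u p + v q"
    and tight: "\<And>p. p \<in> E \<Longrightarrow> u p + v (\<sigma> p) = w p (\<sigma> p)"
    using assignment_duality[OF fin, of w] by blast
  have \<sigma>E: "\<sigma> p \<in> E" if "p \<in> E" for p
    using \<sigma> that by (auto simp: bij_betw_def)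
  have \<sigma>inj: "p = q" if "\<sigma> p = \<sigma> q" "p \<in> E" "q \<in> E" for p q
    using \<sigma> that by (auto simp: bij_betw_def inj_on_def)
  define G where "G = {p\<in>E. u p + v p = 0}"
  have diag: "0 \<le> u p + v p" if "p \<in> E" for p
    using uv[OF that that] irr[of p] by (auto simp: w_def split: if_splits)

  have Gk: "card C \<le> k" if CG: "C \<subseteq> G" and chain: "\<And>x y. x \<in> C \<Longrightarrow> y \<in> C \<Longrightarrow> x \<noteq> y \<Longrightarrow> R x y \<or> R y x" for C
  proof (cases "C = {}")
    case False
    have finC: "finite C"
      using CG fin unfolding G_def by (auto intro: finite_subset)
    have CE: "x \<in> E" "v x = - u x" if "x \<in> C" for x
      using that CG by (auto simp: G_def)
    have dec: "u y < u x" if "x \<in> C" "y \<in> C" "R x y" for x y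
      using uv[of x y] CE that by (auto simp: w_def)
    have inj: "inj_on u C"
      using dec chain by (metis inj_onI less_irrefl)
    have "Min (u ` C) \<in> u ` C" "Max (u ` C) \<in> u ` C"
      using False finC by (auto intro: Min_in Max_in)
    then obtain x y where xy: "x \<in> C" "u x = Min (u ` C)" "y \<in> C" "u y = Max (u ` C)"
      by (metis imageE)
    \<comment> \<open>On the chain \<open>u\<close> takes distinct integer values, so
      \<open>card C\<close> is at most their range plus 1. The dual inequality for the pair from the
      top of the chain (least \<open>u\<close>) to its bottom (greatest \<open>u\<close>), of weight
      \<open>1 - k\<close> unless the two coincide, bounds the range by
      \<open>k - 1\<close>.\<close>
    have "u ` C \<subseteq> {u x..u y}"
      using finC by (auto simp: xy)
    then have "card C \<le> card {u x..u y}"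
      by (metis card_image inj card_mono finite_atLeastAtMost_int)
    moreover have le: "u x \<le> u y"
      using finC xy(1,3,4) Max_ge[of "u ` C" "u x"] by simp
    ultimately have *: "int (card C) \<le> u y - u x + 1"
      by simp
    have "\<not> R x y"
      using dec[of x y] xy(1,3) le by linarith
    moreover have "w x y \<le> u x - u y"
      using uv[of x y] CE xy by simp
    ultimately show ?thesis
      using * by (auto simp: w_def split: if_splits)
  qed auto

  \<comment> \<open>\<open>U\<close> holds the elements in use, \<open>M\<close> the links made by
    \<open>\<sigma>\<close>, \<open>B\<close> the last elements of the chains, and
    \<open>C e\<close> is the chain ending in \<open>e\<close>. The chains are disjoint because
    \<open>M\<close> is a partial injection.\<close>
  define U where "U = {p\<in>E. \<sigma> p \<noteq> p \<or> k = 0}"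
  define M where "M = {(p, \<sigma> p) |p. p \<in> E \<and> R p (\<sigma> p)}"
  define B where "B = {e\<in>U. \<not> R e (\<sigma> e)}"
  define C where "C e = {p\<in>U. (p, e) \<in> M\<^sup>*}" for e
  have finU: "finite U" "finite B"
    using fin by (auto simp: U_def B_def)
  have svM: "single_valued M" and svM': "single_valued (M\<inverse>)"
    using \<sigma>inj by (auto simp: M_def single_valued_def)
  have MR: "p = q \<or> R p q" if "(p, q) \<in> M\<^sup>*" for p q
    using that by induction (auto simp: M_def intro: tr)
  have Bend: "e = x" if "(e, x) \<in> M\<^sup>*" "e \<in> B" for e x
    using that by (auto simp: M_def B_def elim: converse_rtranclE)
  have cover: "\<exists>e\<in>B. p \<in> C e" if "p \<in> U" for p
    using that
  proof (induction "card {q\<in>E. R p q}" arbitrary: p rule: less_induct)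
    case less
    show ?case
    proof (cases "R p (\<sigma> p)")
      case True
      have pE: "p \<in> E" "\<sigma> p \<in> E"
        using less.prems \<sigma>E by (auto simp: U_def)
      have "\<sigma> p \<in> U"
        using less.prems pE \<sigma>inj[of "\<sigma> p" p] by (auto simp: U_def)
      moreover have "{q\<in>E. R (\<sigma> p) q} \<subset> {q\<in>E. R p q}"
        using True pE irr by (auto intro: tr)
      then have "card {q\<in>E. R (\<sigma> p) q} < card {q\<in>E. R p q}"
        using fin by (intro psubset_card_mono) auto
      ultimately obtain e where "e \<in> B" "\<sigma> p \<in> C e"
        using less.hyps by blast
      moreover have "(p, \<sigma> p) \<in> M"
        using True pE by (auto simp: M_def)
      ultimately show ?thesis
        using less.prems unfolding C_def by (blast intro: converse_rtrancl_into_rtrancl)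
    next
      case False
      then show ?thesis
        using less.prems by (auto simp: B_def C_def)
    qed
  qed
  have disj: "e = f" if "p \<in> C e" "p \<in> C f" "e \<in> B" "f \<in> B" for p e f
    using single_valued_confluent[OF svM, of p e f] that Bend by (auto simp: C_def)
  have inC: "e \<in> C e" if "e \<in> B" for e
    using that by (auto simp: C_def B_def)
  have comp: "R x y \<or> R y x" if "x \<in> C e" "y \<in> C e" "x \<noteq> y" for x y e
    using single_valued_confluent[OF svM', of e x y] that MR unfolding C_def rtrancl_converse by auto
  have injC: "inj_on C B"
    using disj inC by (metis inj_onI)
  have UC: "U = \<Union> (C ` B)"
    using cover by (auto simp: C_def)
  have cardU: "card U = (\<Sum>e\<in>B. card (C e))"
    unfolding UC by (rule card_UN_disjoint) (use finU disj in \<open>auto simp: C_def\<close>)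

  \<comment> \<open>Integrality makes \<open>u p + v p\<close> at least 1 off \<open>G\<close>. As
    \<open>\<sigma>\<close> permutes \<open>E\<close>, the dual total is the weight of
    \<open>\<sigma>\<close>, which is then counted chain by chain; truncated subtraction can only
    enlarge the last sum.\<close>
  have "int (card (E - G)) = (\<Sum>p\<in>E - G. 1)"
    by simp
  also have "\<dots> \<le> (\<Sum>p\<in>E - G. u p + v p)"
    using diag by (intro sum_mono) (force simp: G_def)
  also have "\<dots> \<le> (\<Sum>p\<in>E. u p + v p)"
    using diag fin by (intro sum_mono2) auto
  also have "\<dots> = (\<Sum>p\<in>E. u p + v (\<sigma> p))"
    using sum.reindex_bij_betw[OF \<sigma>, of v] by (simp add: sum.distrib)
  also have "\<dots> = (\<Sum>p\<in>E. w p (\<sigma> p))"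
    using tight by (intro sum.cong) auto
  also have "\<dots> = (\<Sum>p\<in>U. w p (\<sigma> p))"
    using fin irr by (intro sum.mono_neutral_right) (auto simp: U_def w_def)
  also have "\<dots> = (\<Sum>p\<in>U. 1 - (if p \<in> B then int k else 0))"
    by (intro sum.cong) (auto simp: U_def B_def w_def)
  also have "\<dots> = int (card U) - int k * int (card B)"
  proof -
    have "U \<inter> {p. p \<in> B} = B"
      by (auto simp: B_def)
    then show ?thesis
      using finU by (simp add: sum_subtractf sum.If_cases)
  qed
  also have "\<dots> = (\<Sum>e\<in>B. int (card (C e)) - int k)"
    by (simp add: cardU sum_subtractf)
  also have "\<dots> \<le> (\<Sum>e\<in>B. int (card (C e) - k))"
    by (intro sum_mono) auto
  also have "\<dots> = int (\<Sum>D\<in>C ` B. card D - k)"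
    using injC by (simp add: sum.reindex)
  finally have bound: "card (E - G) \<le> (\<Sum>D\<in>C ` B. card D - k)"
    by (simp only: of_nat_le_iff)
  show ?thesis
  proof (rule that[of "C ` B" G])
    show "D \<inter> D' = {}" if "D \<in> C ` B" "D' \<in> C ` B" "D \<noteq> D'" for D D'
      using that disj by blast
  qed (use finU bound Gk comp in \<open>auto simp: G_def C_def U_def\<close>)
qed

section \<open>Multiplication of polynomials\<close>

lemma poly_mapping_sum_single: "f = (\<Sum>a\<in>keys f. single a (lookup f a))"
  by (rule poly_mapping_eqI) (simp add: lookup_sum lookup_single when_def in_keys_iff)

lemma poly_mapping_sum_single_superset:
  assumes "finite S" "keys f \<subseteq> S"
  shows "f = (\<Sum>a\<in>S. single a (lookup f a))"
  by (subst poly_mapping_sum_single, rule sum.mono_neutral_left) (use assms in \<open>auto simp: in_keys_iff\<close>)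

lemma mult_sum_single:
  fixes f g :: "'a::comm_monoid_add \<Rightarrow>\<^sub>0 'b::comm_semiring_0"
  shows "f * g = (\<Sum>a\<in>keys f. \<Sum>b\<in>keys g. single (a + b) (lookup f a * lookup g b))"
proof -
  have "f * g = (\<Sum>a\<in>keys f. single a (lookup f a)) * (\<Sum>b\<in>keys g. single b (lookup g b))"
    by (simp flip: poly_mapping_sum_single)
  then show ?thesis
    by (simp add: sum_product mult_single)
qed

lemma lookup_mult_sum:
  fixes f g :: "'a::comm_monoid_add \<Rightarrow>\<^sub>0 'b::comm_semiring_0"
  shows "lookup (f * g) m = (\<Sum>a\<in>keys f. \<Sum>b\<in>keys g. if a + b = m then lookup f a * lookup g b else 0)"
  by (subst mult_sum_single) (simp add: lookup_sum lookup_single when_def)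

text \<open>Products of extremal monomials survive because they decompose in one way only. Leading
  monomials and parts of least weight are both treated through this.\<close>

lemma lookup_mult_unique:
  fixes f g :: "'a::comm_monoid_add \<Rightarrow>\<^sub>0 'b::comm_semiring_0"
  assumes "\<And>a b. a \<in> keys f \<Longrightarrow> b \<in> keys g \<Longrightarrow> a + b = p + q \<Longrightarrow> a = p \<and> b = q"
  shows "lookup (f * g) (p + q) = lookup f p * lookup g q"
proof -
  have "lookup (f * g) (p + q) = (\<Sum>a\<in>keys f. \<Sum>b\<in>keys g. if a = p then (if b = q then lookup f a * lookup g b else 0) else 0)"
    unfolding lookup_mult_sum using assms by (intro sum.cong) auto
  also have "\<dots> = (\<Sum>a\<in>keys f. if a = p then (\<Sum>b\<in>keys g. if b = q then lookup f a * lookup g b else 0) else 0)"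
    by (intro sum.cong) auto
  also have "\<dots> = lookup f p * lookup g q"
    by (auto simp: in_keys_iff)
  finally show ?thesis .
qed

lemma lookup_single_mult:
  fixes f :: "'a::cancel_comm_monoid_add \<Rightarrow>\<^sub>0 'b::comm_semiring_0"
  shows "lookup (single a c * f) (a + b) = c * lookup f b"
  by (subst lookup_mult_unique) (auto split: if_splits)

section \<open>Leading monomials\<close>

definition lead :: "('a::linorder \<Rightarrow>\<^sub>0 'b::zero) \<Rightarrow> 'a" where
  "lead f = Max (keys f)"

lemma lead_in_keys: "f \<noteq> 0 \<Longrightarrow> lead f \<in> keys f"
  unfolding lead_def by (intro Max_in) auto

lemma lead_ge: "m \<in> keys f \<Longrightarrow> m \<le> lead f"
  unfolding lead_def by auto

lemma lead_eqI: "m \<in> keys f \<Longrightarrow> (\<And>a. a \<in> keys f \<Longrightarrow> a \<le> m) \<Longrightarrow> lead f = m"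
  unfolding lead_def by (intro Max_eqI) auto

lemma initial_monomial_lead: "initial_monomial f = single (lead f) 1"
  by (simp add: initial_monomial_def lead_def)

lemma add_le_add_eq:
  fixes a b p q :: "'a::linordered_cancel_ab_semigroup_add"
  assumes "a \<le> p" "b \<le> q" "a + b = p + q"
  shows "a = p \<and> b = q"
proof -
  have "\<not> a < p"
  proof
    assume "a < p"
    from add_less_le_mono[OF this assms(2)] show False
      by (simp add: assms(3))
  qed
  then have "a = p"
    using assms(1) by (meson antisym not_le_imp_less)
  then show ?thesis
    using assms(3) by simp
qed

lemma lookup_mult_lead:
  fixes f g :: "monomial \<Rightarrow>\<^sub>0 'b::comm_semiring_0"
  shows "lookup (f * g) (lead f + lead g) = lookup f (lead f) * lookup g (lead g)"
  by (rule lookup_mult_unique) (rule add_le_add_eq[OF lead_ge lead_ge])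

lemma lead_mult:
  fixes f g :: "'k::field mpoly"
  assumes "f \<noteq> 0" "g \<noteq> 0"
  shows "lead (f * g) = lead f + lead g"
proof (rule lead_eqI)
  show "lead f + lead g \<in> keys (f * g)"
    using assms lead_in_keys[of f] lead_in_keys[of g] by (simp add: in_keys_iff lookup_mult_lead)
  show "a \<le> lead f + lead g" if "a \<in> keys (f * g)" for a
    using that keys_mult[of f g] by (auto intro!: add_mono lead_ge)
qed

lemma lead_one: "lead (1 :: 'k::field mpoly) = 0"
  by (rule lead_eqI) auto

lemma lead_prod:
  fixes f :: "'a \<Rightarrow> 'k::field mpoly"
  assumes "\<And>x. x \<in> S \<Longrightarrow> f x \<noteq> 0"
  shows "lead (\<Prod>x\<in>S. f x) = (\<Sum>x\<in>S. lead (f x))"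
proof (cases "finite S")
  case True
  then show ?thesis
    using assms by (induction S) (auto simp: lead_one lead_mult)
qed (simp add: lead_one)

section \<open>Leading monomials of minors\<close>

definition incr :: "nat \<Rightarrow> (nat \<Rightarrow> nat) \<Rightarrow> bool" where
  "incr m \<rho> \<longleftrightarrow> (\<forall>i j. i < j \<longrightarrow> j < m \<longrightarrow> \<rho> i < \<rho> j)"

text \<open>Index functions in place of the index sets of \<open>minors\<close>: bordered minors are
  then formed by changing the functions, and the entries stay explicit.\<close>

definition gminor :: "nat \<Rightarrow> (nat \<Rightarrow> nat) \<Rightarrow> (nat \<Rightarrow> nat) \<Rightarrow> 'k::field mpoly" where
  "gminor m \<rho> \<gamma> = det (mat m m (\<lambda>(i, j). var (\<rho> i, \<gamma> j)))"

lemma incr_less_iff: "incr m \<rho> \<Longrightarrow> i < m \<Longrightarrow> j < m \<Longrightarrow> \<rho> i < \<rho> j \<longleftrightarrow> i < j"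
  unfolding incr_def by (metis linorder_less_linear order_less_asym)

lemma incr_eq_iff: "incr m \<rho> \<Longrightarrow> i < m \<Longrightarrow> j < m \<Longrightarrow> \<rho> i = \<rho> j \<longleftrightarrow> i = j"
  using incr_less_iff[of m \<rho> i j] incr_less_iff[of m \<rho> j i] by auto

lemma incr_inj_on: "incr m \<rho> \<Longrightarrow> inj_on \<rho> {..<m}"
  by (auto simp: inj_on_def incr_eq_iff)

lemma pick_incr:
  assumes "incr m \<rho>" "i < m"
  shows "pick (\<rho> ` {..<m}) i = \<rho> i"
proof -
  have "{a \<in> \<rho> ` {..<m}. a < \<rho> i} = \<rho> ` {..<i}"
    using assms by (auto simp: incr_less_iff)
  then have "card {a \<in> \<rho> ` {..<m}. a < \<rho> i} = i"
    using assms incr_inj_on[OF assms(1)] by (simp add: card_image inj_on_subset)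
  then show ?thesis
    using pick_card_in_set[of "\<rho> i" "\<rho> ` {..<m}"] assms(2) by auto
qed

lemma gminor_in_minors:
  assumes "incr m \<rho>" "incr m \<gamma>" "\<And>i. i < m \<Longrightarrow> \<rho> i < r" "\<And>i. i < m \<Longrightarrow> \<gamma> i < s"
  shows "gminor m \<rho> \<gamma> \<in> minors m (generic_matrix r s)"
proof -
  have card: "card (\<rho> ` {..<m}) = m" "card (\<gamma> ` {..<m}) = m"
    using assms incr_inj_on by (auto simp: card_image)
  have "{i. i < r \<and> i \<in> \<rho> ` {..<m}} = \<rho> ` {..<m}" "{i. i < s \<and> i \<in> \<gamma> ` {..<m}} = \<gamma> ` {..<m}"
    using assms by auto
  then have "submatrix (generic_matrix r s) (\<rho> ` {..<m}) (\<gamma> ` {..<m}) = (mat m m (\<lambda>(i, j). var (\<rho> i, \<gamma> j)) :: 'a mpoly mat)"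
    using assms card by (auto simp: submatrix_def generic_matrix_def pick_incr)
  then have "gminor m \<rho> \<gamma> = det (submatrix (generic_matrix r s :: 'a mpoly mat) (\<rho> ` {..<m}) (\<gamma> ` {..<m}))"
    by (simp add: gminor_def)
  moreover have "\<rho> ` {..<m} \<subseteq> {..<dim_row (generic_matrix r s :: 'a mpoly mat)}"
    "\<gamma> ` {..<m} \<subseteq> {..<dim_col (generic_matrix r s :: 'a mpoly mat)}"
    using assms by (auto simp: generic_matrix_def)
  ultimately show ?thesis
    unfolding minors_def mem_Collect_eq by (intro exI[of _ "\<rho> ` {..<m}"] exI[of _ "\<gamma> ` {..<m}"] conjI) (use card in auto)
qed

lemma minors_eq_gminor:
  assumes "f \<in> minors m (generic_matrix r s)"
  obtains \<rho> \<gamma> where "f = gminor m \<rho> \<gamma>" "incr m \<rho>" "incr m \<gamma>"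
    "\<And>i. i < m \<Longrightarrow> \<rho> i < r" "\<And>i. i < m \<Longrightarrow> \<gamma> i < s"
proof -
  from assms obtain I J where f: "f = det (submatrix (generic_matrix r s) I J)"
    and I: "I \<subseteq> {..<r}" "card I = m" and J: "J \<subseteq> {..<s}" "card J = m"
    unfolding minors_def generic_matrix_def by auto
  have [simp]: "{i. i < r \<and> i \<in> I} = I" "{i. i < s \<and> i \<in> J} = J"
    using I J by auto
  have in_IJ: "pick I i \<in> I" "pick J i \<in> J" if "i < m" for i
    using that I(2) J(2) by (auto intro: pick_in_set_le)
  then have less: "pick I i < r" "pick J i < s" if "i < m" for i
    using that I(1) J(1) by blast+
  have "submatrix (generic_matrix r s) I J = (mat m m (\<lambda>(i, j). var (pick I i, pick J j)) :: 'a mpoly mat)"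
    using I J less by (auto simp: submatrix_def generic_matrix_def)
  moreover have "incr m (pick I)" "incr m (pick J)"
    using I J by (auto simp: incr_def intro: pick_mono_le)
  ultimately show ?thesis
    using that[of "pick I" "pick J"] less f by (simp add: gminor_def)
qed

definition dmono :: "nat \<Rightarrow> (nat \<Rightarrow> nat) \<Rightarrow> (nat \<Rightarrow> nat) \<Rightarrow> monomial" where
  "dmono m \<rho> \<gamma> = (\<Sum>i<m. single (\<rho> i, \<gamma> i) 1)"

lemma prod_single_one:
  "(\<Prod>x\<in>S. single (g x) (1::'b::comm_semiring_1)) = single (\<Sum>x\<in>S. g x) 1"
  by (induction S rule: infinite_finite_induct) (auto simp: mult_single)

lemma gminor_expand:
  "gminor m \<rho> \<gamma> = (\<Sum>p | p permutes {0..<m}. single (dmono m \<rho> (\<gamma> \<circ> p)) (of_int (sign p)))"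
proof -
  have s: "(signof p :: 'a mpoly) = single 0 (of_int (sign p))" for p :: "nat \<Rightarrow> nat"
    by (simp add: sign_def single_uminus)
  have prod: "(\<Prod>i = 0..<m. mat m m (\<lambda>(i, j). var (\<rho> i, \<gamma> j)) $$ (i, p i)) = (single (dmono m \<rho> (\<gamma> \<circ> p)) 1 :: 'a mpoly)"
    if "p permutes {0..<m}" for p
  proof -
    have "(\<Prod>i = 0..<m. mat m m (\<lambda>(i, j). var (\<rho> i, \<gamma> j)) $$ (i, p i)) = (\<Prod>i = 0..<m. (var (\<rho> i, \<gamma> (p i)) :: 'a mpoly))"
      using permutes_in_image[OF that] by (intro prod.cong) auto
    then show ?thesis
      by (simp add: var_def prod_single_one dmono_def atLeast0LessThan)
  qed
  have "gminor m \<rho> \<gamma> = (\<Sum>p | p permutes {0..<m}. signof p *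
      (\<Prod>i = 0..<m. (mat m m (\<lambda>(i, j). var (\<rho> i, \<gamma> j)) :: 'a mpoly mat) $$ (i, p i)))"
    unfolding gminor_def by (rule det_def') simp
  also have "\<dots> = (\<Sum>p | p permutes {0..<m}. single (dmono m \<rho> (\<gamma> \<circ> p)) (of_int (sign p)))"
    by (intro sum.cong refl) (simp only: mem_Collect_eq prod s mult_single add_0 mult_1_right)
  finally show ?thesis .
qed

lemma lookup_dmono: "lookup (dmono m \<rho> \<gamma>) v = card {i. i < m \<and> (\<rho> i, \<gamma> i) = v}"
proof -
  have "lookup (dmono m \<rho> \<gamma>) v = (\<Sum>i<m. if (\<rho> i, \<gamma> i) = v then 1 else 0)"
    by (simp add: dmono_def lookup_sum lookup_single when_def cong: if_cong)
  also have "\<dots> = card ({..<m} \<inter> {i. (\<rho> i, \<gamma> i) = v})"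
    by (subst sum.If_cases) auto
  also have "{..<m} \<inter> {i. (\<rho> i, \<gamma> i) = v} = {i. i < m \<and> (\<rho> i, \<gamma> i) = v}"
    by auto
  finally show ?thesis .
qed

lemma keys_dmono: "keys (dmono m \<rho> \<gamma>) = (\<lambda>i. (\<rho> i, \<gamma> i)) ` {..<m}"
  by (auto simp: in_keys_iff lookup_dmono)

text \<open>Let \<open>i\<close> be the first index moved by \<open>p\<close>. Smaller indices are
  fixed, so \<open>p i > i\<close>: the permuted monomial lacks the variable at
  \<open>(\<rho> i, \<gamma> i)\<close>, while the larger variables, in earlier rows or further left
  in row \<open>\<rho> i\<close>, have equal exponents.\<close>

lemma dmono_perm_less:
  assumes "incr m \<rho>" "incr m \<gamma>" "p permutes {0..<m}" "p \<noteq> id"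
  shows "dmono m \<rho> (\<gamma> \<circ> p) < dmono m \<rho> \<gamma>"
proof -
  define i where "i = (LEAST i. p i \<noteq> i)"
  have "\<exists>i. p i \<noteq> i"
    using assms(4) by (metis eq_id_iff)
  then have i: "p i \<noteq> i"
    unfolding i_def by (rule LeastI_ex)
  have below: "p j = j" if "j < i" for j
    using that not_less_Least unfolding i_def by blast
  have pm: "p j < m \<longleftrightarrow> j < m" for j
    using permutes_in_image[OF assms(3), of j] by simp
  have im: "i < m"
    using i assms(3) by (metis atLeastLessThan_iff permutes_not_in zero_le)
  have pinj: "p j = p k \<longleftrightarrow> j = k" for j k
    using permutes_inj[OF assms(3)] by (auto simp: inj_def)
  have "p i > i"
    using below i pinj by (metis linorder_neqE_nat)
  have eq: "\<rho> j = \<rho> i \<longleftrightarrow> j = i" if "j < m" for j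
    using assms(1) im that by (simp add: incr_eq_iff)
  have gi: "\<gamma> i < \<gamma> (p i)"
    using assms(2) im pm \<open>p i > i\<close> by (simp add: incr_less_iff)
  show ?thesis
    unfolding monomial_less_iff
  proof (intro exI[of _ "(\<rho> i, \<gamma> i)"] conjI allI impI)
    have "{j. j < m \<and> (\<rho> j, \<gamma> j) = (\<rho> i, \<gamma> i)} = {i}"
      "{j. j < m \<and> (\<rho> j, (\<gamma> \<circ> p) j) = (\<rho> i, \<gamma> i)} = {}"
      using im eq gi by auto
    then show "lookup (dmono m \<rho> (\<gamma> \<circ> p)) (\<rho> i, \<gamma> i) < lookup (dmono m \<rho> \<gamma>) (\<rho> i, \<gamma> i)"
      by (simp only: lookup_dmono) simp
  next
    fix w :: "nat \<times> nat" assume w: "w < (\<rho> i, \<gamma> i)"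
    have "(\<rho> j, (\<gamma> \<circ> p) j) = w \<longleftrightarrow> (\<rho> j, \<gamma> j) = w" if "j < m" for j
    proof (cases j i rule: linorder_cases)
      case less
      then show ?thesis by (simp add: below)
    next
      case equal
      then show ?thesis using w gi by auto
    next
      case greater
      then have "\<rho> i < \<rho> j"
        using assms(1) that by (simp add: incr_def)
      then show ?thesis using w by auto
    qed
    then show "lookup (dmono m \<rho> (\<gamma> \<circ> p)) w = lookup (dmono m \<rho> \<gamma>) w"
      unfolding lookup_dmono by (intro arg_cong[of _ _ card] Collect_cong conj_cong refl)
  qed
qed

lemma keys_gminor_subset: "keys (gminor m \<rho> \<gamma>) \<subseteq> {dmono m \<rho> (\<gamma> \<circ> p) |p. p permutes {0..<m}}"
  unfolding gminor_expand by (rule order_trans[OF keys_sum]) (auto split: if_splits)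

lemma
  assumes "incr m \<rho>" "incr m \<gamma>"
  shows lookup_gminor_diagonal: "lookup (gminor m \<rho> \<gamma> :: 'k::field mpoly) (dmono m \<rho> \<gamma>) = 1"
    and lead_gminor: "lead (gminor m \<rho> \<gamma> :: 'k mpoly) = dmono m \<rho> \<gamma>"
    and gminor_nonzero: "(gminor m \<rho> \<gamma> :: 'k mpoly) \<noteq> 0"
proof -
  have "lookup (gminor m \<rho> \<gamma> :: 'k mpoly) (dmono m \<rho> \<gamma>)
      = (\<Sum>p | p permutes {0..<m}. if p = id then 1 else 0)"
    unfolding gminor_expand lookup_sum
    using less_imp_neq[OF dmono_perm_less[OF assms]]
    by (intro sum.cong) (auto simp: lookup_single when_def)
  also have "\<dots> = 1"
    by (simp add: finite_permutations permutes_id)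
  finally show 1: "lookup (gminor m \<rho> \<gamma> :: 'k mpoly) (dmono m \<rho> \<gamma>) = 1" .
  then show "(gminor m \<rho> \<gamma> :: 'k mpoly) \<noteq> 0"
    by auto
  show "lead (gminor m \<rho> \<gamma> :: 'k mpoly) = dmono m \<rho> \<gamma>"
  proof (rule lead_eqI)
    show "a \<le> dmono m \<rho> \<gamma>" if "a \<in> keys (gminor m \<rho> \<gamma> :: 'k mpoly)" for a
    proof -
      from that keys_gminor_subset obtain p where "a = dmono m \<rho> (\<gamma> \<circ> p)" "p permutes {0..<m}"
        by blast
      then show ?thesis
        using dmono_perm_less[OF assms, of p] by (cases "p = id") auto
    qed
  qed (simp add: 1 in_keys_iff)
qed

lemma keys_gminor_vars:
  assumes "a \<in> keys (gminor m \<rho> \<gamma> :: 'k::field mpoly)"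
    "\<And>i. i < m \<Longrightarrow> \<rho> i < r" "\<And>i. i < m \<Longrightarrow> \<gamma> i < s"
  shows "keys a \<subseteq> {..<r} \<times> {..<s}"
proof -
  from assms(1) keys_gminor_subset obtain p where "a = dmono m \<rho> (\<gamma> \<circ> p)" "p permutes {0..<m}"
    by blast
  then show ?thesis
    using assms(2,3) permutes_in_image[of p "{0..<m}"] by (auto simp: keys_dmono)
qed

lemma gminor_in_carrier:
  assumes "\<And>i. i < m \<Longrightarrow> \<rho> i < r" "\<And>i. i < m \<Longrightarrow> \<gamma> i < s"
  shows "gminor m \<rho> \<gamma> \<in> poly_carrier r s"
  unfolding poly_carrier_def using keys_gminor_vars[of _ m \<rho> \<gamma> r s] assms by blast

section \<open>Weights of monomials\<close>

text \<open>Summing over \<open>keys m \<inter> F\<close> keeps the sum finite for infinite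
  \<open>F\<close>: one notion serves for the total degree (\<open>UNIV\<close>), for row and column
  degrees, and for the degree on a cover.\<close>

definition wt :: "'v set \<Rightarrow> ('v \<Rightarrow>\<^sub>0 nat) \<Rightarrow> nat" where
  "wt F m = (\<Sum>v\<in>keys m \<inter> F. lookup m v)"

lemma wt_superset:
  assumes "finite S" "keys m \<inter> F \<subseteq> S" "S \<subseteq> F"
  shows "wt F m = (\<Sum>v\<in>S. lookup m v)"
  unfolding wt_def by (rule sum.mono_neutral_left) (use assms in \<open>auto simp: in_keys_iff\<close>)

lemma wt_0 [simp]: "wt F 0 = 0"
  by (simp add: wt_def)

lemma wt_add: "wt F (a + b) = wt F a + wt F b"
proof -
  let ?S = "(keys a \<union> keys b \<union> keys (a + b)) \<inter> F"
  have "wt F m = (\<Sum>v\<in>?S. lookup m v)" if "keys m \<subseteq> keys a \<union> keys b \<union> keys (a + b)" for m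
    using that by (intro wt_superset) auto
  then have "wt F a = (\<Sum>v\<in>?S. lookup a v)" "wt F b = (\<Sum>v\<in>?S. lookup b v)"
    "wt F (a + b) = (\<Sum>v\<in>?S. lookup (a + b) v)"
    by blast+
  then show ?thesis
    by (simp only: lookup_add sum.distrib)
qed

lemma wt_single [simp]: "wt F (single v n) = (if v \<in> F then n else 0)"
  by (simp add: wt_def)

lemma wt_sum: "wt F (\<Sum>x\<in>S. g x) = (\<Sum>x\<in>S. wt F (g x))"
  by (induction S rule: infinite_finite_induct) (auto simp: wt_add)

lemma wt_eq_0_iff: "wt F m = 0 \<longleftrightarrow> keys m \<inter> F = {}"
  by (auto simp: wt_def in_keys_iff)

lemma lookup_le_wt: "lookup m v \<le> wt UNIV m"
proof (cases "v \<in> keys m")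
  case True
  then show ?thesis
    unfolding wt_def by (intro member_le_sum) auto
qed (simp add: in_keys_iff)

text \<open>Provides the termination measure for division by minors. Lexicographically there can be
  infinitely many monomials below a given one, hence the degree bound \<open>d\<close>.\<close>

lemma finite_monomials_bounded:
  assumes "finite V"
  shows "finite {m :: 'v \<Rightarrow>\<^sub>0 nat. keys m \<subseteq> V \<and> wt UNIV m \<le> d}"
proof (rule inj_on_finite)
  show "inj_on lookup {m :: 'v \<Rightarrow>\<^sub>0 nat. keys m \<subseteq> V \<and> wt UNIV m \<le> d}"
    by (auto simp: inj_on_def intro: poly_mapping_eqI)
  show "finite {f. \<forall>x. (x \<in> V \<longrightarrow> f x \<in> {..d}) \<and> (x \<notin> V \<longrightarrow> f x = 0)}"
    using assms by (intro finite_set_of_finite_funs) auto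
  show "lookup ` {m. keys m \<subseteq> V \<and> wt UNIV m \<le> d} \<subseteq> {f. \<forall>x. (x \<in> V \<longrightarrow> f x \<in> {..d}) \<and> (x \<notin> V \<longrightarrow> f x = 0)}"
  proof (intro subsetI CollectI allI conjI impI)
    fix f v assume f: "f \<in> lookup ` {m. keys m \<subseteq> V \<and> wt UNIV m \<le> d}"
    show "f v \<in> {..d}"
      using f by (auto intro: order_trans[OF lookup_le_wt])
    show "f v = 0" if "v \<notin> V"
      using f that by (auto simp: in_keys_iff subset_iff)
  qed
qed

section \<open>Diagonal chains\<close>

text \<open>Strict increase in both coordinates is the relation between two entries on the main
  diagonal of a common minor.\<close>

definition slt :: "nat \<times> nat \<Rightarrow> nat \<times> nat \<Rightarrow> bool" where
  "slt v w \<longleftrightarrow> fst v < fst w \<and> snd v < snd w"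

definition diag_chain :: "(nat \<times> nat) set \<Rightarrow> bool" where
  "diag_chain C \<longleftrightarrow> (\<forall>x\<in>C. \<forall>y\<in>C. x \<noteq> y \<longrightarrow> slt x y \<or> slt y x)"

definition cmono :: "(nat \<times> nat) set \<Rightarrow> monomial" where
  "cmono C = (\<Sum>v\<in>C. single v 1)"

lemma slt_irrefl: "\<not> slt v v"
  by (simp add: slt_def)

lemma slt_trans: "slt u v \<Longrightarrow> slt v w \<Longrightarrow> slt u w"
  by (auto simp: slt_def)

lemma diag_chain_subset: "diag_chain C \<Longrightarrow> D \<subseteq> C \<Longrightarrow> diag_chain D"
  unfolding diag_chain_def by blast

lemma lookup_cmono: "finite C \<Longrightarrow> lookup (cmono C) v = (if v \<in> C then 1 else 0)"
  by (simp add: cmono_def lookup_sum lookup_single when_def)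

lemma keys_cmono: "finite C \<Longrightarrow> keys (cmono C) = C"
  by (auto simp: in_keys_iff lookup_cmono split: if_splits)

lemma dmono_eq_cmono:
  assumes "incr m \<rho>"
  shows "dmono m \<rho> \<gamma> = cmono ((\<lambda>i. (\<rho> i, \<gamma> i)) ` {..<m})"
proof -
  have "inj_on (\<lambda>i. (\<rho> i, \<gamma> i)) {..<m}"
    using incr_inj_on[OF assms] by (auto simp: inj_on_def)
  then show ?thesis
    unfolding dmono_def cmono_def by (simp add: sum.reindex)
qed

text \<open>The lexicographic order of pairs extends \<open>slt\<close>, so sorting a chain lists
  both its rows and its columns increasingly. Chains of size \<open>m\<close> are thus the main
  diagonals of \<open>m\<close>-minors.\<close>

lemma diag_chain_enum:
  assumes "finite C" "diag_chain C"
  obtains \<rho> \<gamma> where "incr (card C) \<rho>" "incr (card C) \<gamma>" "C = (\<lambda>i. (\<rho> i, \<gamma> i)) ` {..<card C}"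
    "dmono (card C) \<rho> \<gamma> = cmono C"
proof -
  define xs where "xs = sorted_list_of_set C"
  have xs: "set xs = C" "sorted_wrt (<) xs" "length xs = card C"
    using assms(1) by (auto simp: xs_def)
  have slt: "slt (xs ! i) (xs ! j)" if "i < j" "j < card C" for i j
  proof -
    have less: "xs ! i < xs ! j"
      using that xs sorted_wrt_nth_less[of "(<)" xs i j] by simp
    have "xs ! i \<in> C" "xs ! j \<in> C"
      using that xs by (metis nth_mem order_less_trans)+
    then have "slt (xs ! i) (xs ! j) \<or> slt (xs ! j) (xs ! i)"
      using assms(2) less unfolding diag_chain_def by (metis order_less_irrefl)
    moreover have "\<not> slt (xs ! j) (xs ! i)"
      using less by (auto simp: slt_def less_prod_def')
    ultimately show ?thesis
      by blast
  qed
  have incr: "incr (card C) (\<lambda>i. fst (xs ! i))" "incr (card C) (\<lambda>i. snd (xs ! i))"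
    using slt by (auto simp: incr_def slt_def)
  moreover have C: "C = (\<lambda>i. (fst (xs ! i), snd (xs ! i))) ` {..<card C}"
    using xs by (auto simp: set_conv_nth)
  moreover have "dmono (card C) (\<lambda>i. fst (xs ! i)) (\<lambda>i. snd (xs ! i)) = cmono C"
    using dmono_eq_cmono[OF incr(1), of "\<lambda>i. snd (xs ! i)"] C by simp
  ultimately show ?thesis
    using that by blast
qed

definition has_chain :: "nat \<Rightarrow> (nat \<times> nat) set \<Rightarrow> bool" where
  "has_chain t G \<longleftrightarrow> (\<exists>C\<subseteq>G. finite C \<and> diag_chain C \<and> card C = t)"

lemma has_chain_mono: "has_chain t G \<Longrightarrow> G \<subseteq> H \<Longrightarrow> has_chain t H"
  unfolding has_chain_def by blast

lemma has_chain_le: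
  assumes "C \<subseteq> G" "finite C" "diag_chain C" "t \<le> card C"
  shows "has_chain t G"
proof -
  obtain D where "D \<subseteq> C" "card D = t" "finite D"
    using obtain_subset_with_card_n[OF assms(4)] by blast
  then show ?thesis
    unfolding has_chain_def using assms(1) diag_chain_subset[OF assms(3)] by (intro exI[of _ D]) auto
qed

text \<open>Colouring each element by the length of the longest chain below it.\<close>

lemma antichain_coloring:
  assumes "finite G" "\<not> has_chain t G"
  obtains \<kappa> where "\<And>v. v \<in> G \<Longrightarrow> \<kappa> v < t - 1" "\<And>v w. v \<in> G \<Longrightarrow> w \<in> G \<Longrightarrow> \<kappa> v = \<kappa> w \<Longrightarrow> \<not> slt v w"
proof -
  define below where "below v = {C. C \<subseteq> G \<and> diag_chain C \<and> (\<forall>c\<in>C. slt c v)}" for v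
  define \<kappa> where "\<kappa> v = Max (card ` below v)" for v
  have fin: "finite (below v)" for v
    by (rule finite_subset[of _ "Pow G"]) (use assms in \<open>auto simp: below_def\<close>)
  have ne: "{} \<in> below v" for v
    by (auto simp: below_def diag_chain_def)
  have "\<exists>C\<in>below v. \<kappa> v = card C" for v
  proof -
    have "Max (card ` below v) \<in> card ` below v"
      using fin[of v] ne[of v] by (intro Max_in) auto
    then show ?thesis
      unfolding \<kappa>_def by auto
  qed
  then obtain B where B: "\<And>v. B v \<in> below v" "\<And>v. \<kappa> v = card (B v)"
    by metis
  have ge: "card C \<le> \<kappa> v" if "C \<in> below v" for C v
    unfolding \<kappa>_def using that fin by auto
  \<comment> \<open>Adding \<open>v\<close> to a longest chain below it gives a chain with
    \<open>\<kappa> v + 1\<close> elements. This number is less than \<open>t\<close>, and the chain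
    is a candidate for every \<open>w\<close> above \<open>v\<close>.\<close>
  have ins: "insert v (B v) \<subseteq> G \<and> diag_chain (insert v (B v)) \<and> card (insert v (B v)) = Suc (\<kappa> v)
      \<and> finite (insert v (B v))"
    if "v \<in> G" for v
  proof -
    have "v \<notin> B v" "finite (B v)"
      using B(1)[of v] slt_irrefl[of v] assms(1) by (auto simp: below_def intro: finite_subset)
    then show ?thesis
      using B[of v] that by (auto simp: below_def diag_chain_def)
  qed
  show ?thesis
  proof (rule that)
    show "\<kappa> v < t - 1" if "v \<in> G" for v
    proof (rule ccontr)
      assume "\<not> \<kappa> v < t - 1"
      then have "t \<le> card (insert v (B v))"
        using ins[OF that] by simp
      from has_chain_le[OF _ _ _ this, of G] ins[OF that] assms(2) show False
        by simp
    qed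
    show "\<not> slt v w" if "v \<in> G" "w \<in> G" "\<kappa> v = \<kappa> w" for v w
    proof
      assume vw: "slt v w"
      have "insert v (B v) \<in> below w"
        using ins[OF that(1)] B(1)[of v] vw by (auto simp: below_def intro: slt_trans)
      from ge[OF this] ins[OF that(1)] that(3) show False
        by simp
    qed
  qed
qed

section \<open>Substitution homomorphisms\<close>

definition meval :: "('v \<Rightarrow> 'b::comm_ring_1) \<Rightarrow> ('v \<Rightarrow>\<^sub>0 nat) \<Rightarrow> 'b" where
  "meval g m = (\<Prod>v\<in>keys m. g v ^ lookup m v)"

definition subst_vars ::
    "('v \<Rightarrow> 'm::comm_monoid_add \<Rightarrow>\<^sub>0 'k::comm_ring_1) \<Rightarrow> (('v \<Rightarrow>\<^sub>0 nat) \<Rightarrow>\<^sub>0 'k) \<Rightarrow> 'm \<Rightarrow>\<^sub>0 'k" where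
  "subst_vars g f = (\<Sum>m\<in>keys f. single 0 (lookup f m) * meval g m)"

lemma meval_superset:
  assumes "finite S" "keys m \<subseteq> S"
  shows "meval g m = (\<Prod>v\<in>S. g v ^ lookup m v)"
  unfolding meval_def by (rule prod.mono_neutral_left) (use assms in \<open>auto simp: in_keys_iff\<close>)

lemma meval_add: "meval g (a + b) = meval g a * meval g b"
proof -
  let ?S = "keys a \<union> keys b \<union> keys (a + b)"
  have "meval g a = (\<Prod>v\<in>?S. g v ^ lookup a v)" "meval g b = (\<Prod>v\<in>?S. g v ^ lookup b v)"
    "meval g (a + b) = (\<Prod>v\<in>?S. g v ^ lookup (a + b) v)"
    by (intro meval_superset; auto)+
  then show ?thesis
    by (simp only: lookup_add power_add prod.distrib)
qed

lemma subst_vars_superset: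
  assumes "finite S" "keys f \<subseteq> S"
  shows "subst_vars g f = (\<Sum>m\<in>S. single 0 (lookup f m) * meval g m)"
  unfolding subst_vars_def by (rule sum.mono_neutral_left) (use assms in \<open>auto simp: in_keys_iff\<close>)

lemma subst_vars_add: "subst_vars g (a + b) = subst_vars g a + subst_vars g b"
proof -
  let ?S = "keys a \<union> keys b \<union> keys (a + b)"
  have "subst_vars g a = (\<Sum>m\<in>?S. single 0 (lookup a m) * meval g m)"
    "subst_vars g b = (\<Sum>m\<in>?S. single 0 (lookup b m) * meval g m)"
    "subst_vars g (a + b) = (\<Sum>m\<in>?S. single 0 (lookup (a + b) m) * meval g m)"
    by (intro subst_vars_superset; auto)+
  then show ?thesis
    by (simp only: lookup_add single_add distrib_right sum.distrib)
qed

lemma subst_vars_0 [simp]: "subst_vars g 0 = 0"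
  by (simp add: subst_vars_def)

lemma subst_vars_sum: "subst_vars g (\<Sum>x\<in>S. f x) = (\<Sum>x\<in>S. subst_vars g (f x))"
  by (induction S rule: infinite_finite_induct) (auto simp: subst_vars_add)

lemma subst_vars_single: "subst_vars g (single m c) = single 0 c * meval g m"
  by (cases "c = 0") (auto simp: subst_vars_def)

lemma subst_vars_1 [simp]: "subst_vars g 1 = 1"
  using subst_vars_single[of g 0 1] by (simp add: meval_def)

lemma subst_vars_mult:
  fixes g :: "'v \<Rightarrow> 'm::comm_monoid_add \<Rightarrow>\<^sub>0 'k::comm_ring_1"
  shows "subst_vars g (a * b) = subst_vars g a * subst_vars g b"
proof -
  have "subst_vars g (a * b) = (\<Sum>m\<in>keys a. \<Sum>n\<in>keys b. single 0 (lookup a m * lookup b n) * meval g (m + n))"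
    by (subst mult_sum_single) (simp only: subst_vars_sum subst_vars_single)
  also have "\<dots> = (\<Sum>m\<in>keys a. \<Sum>n\<in>keys b.
      (single 0 (lookup a m) * meval g m) * (single 0 (lookup b n) * meval g n))"
  proof (intro sum.cong refl)
    fix m n
    have "single 0 (lookup a m * lookup b n) = single 0 (lookup a m) * single (0 :: 'm) (lookup b n)"
      by (simp add: mult_single)
    then show "single 0 (lookup a m * lookup b n) * meval g (m + n)
      = (single 0 (lookup a m) * meval g m) * (single 0 (lookup b n) * meval g n)"
      by (simp only: meval_add ac_simps)
  qed
  finally show ?thesis
    by (simp add: subst_vars_def sum_product)
qed

lemma subst_vars_prod: "subst_vars g (\<Prod>x\<in>S. f x) = (\<Prod>x\<in>S. subst_vars g (f x))"
  by (induction S rule: infinite_finite_induct) (auto simp: subst_vars_mult)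

lemma subst_vars_uminus: "subst_vars g (- a) = - subst_vars g a"
  using subst_vars_add[of g a "- a"] by (simp add: eq_neg_iff_add_eq_0 add.commute)

lemma subst_vars_diff: "subst_vars g (a - b) = subst_vars g a - subst_vars g b"
  using subst_vars_add[of g a "- b"] by (simp add: subst_vars_uminus)

lemma subst_vars_signof: "subst_vars g (signof p) = signof p"
  by (simp add: sign_def subst_vars_uminus)

lemma subst_vars_det:
  "subst_vars g (det (mat n n f)) = det (mat n n (\<lambda>ij. subst_vars g (f ij)))"
proof -
  have prod: "(\<Prod>i = 0..<n. mat n n h $$ (i, p i)) = (\<Prod>i = 0..<n. h (i, p i))"
    if "p permutes {0..<n}" for p and h :: "nat \<times> nat \<Rightarrow> 'x::comm_ring_1"
    using permutes_in_image[OF that] by (intro prod.cong) auto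
  have det: "det (mat n n h) = (\<Sum>p | p permutes {0..<n}. signof p * (\<Prod>i = 0..<n. h (i, p i)))"
    for h :: "nat \<times> nat \<Rightarrow> 'x::comm_ring_1"
    unfolding det_def'[OF mat_carrier] by (intro sum.cong refl) (simp only: mem_Collect_eq prod)
  show ?thesis
    unfolding det by (simp only: subst_vars_sum subst_vars_mult subst_vars_prod subst_vars_signof)
qed

section \<open>Ideals, powers and symbolic powers\<close>

locale cring_on =
  fixes A :: "'a::comm_ring_1 set"
  assumes cring: "cring (ring_on A)"
begin

interpretation cring "ring_on A"
  by (fact cring)

abbreviation ipow :: "'a set \<Rightarrow> nat \<Rightarrow> 'a set" where
  "ipow I n \<equiv> I [^]\<^bsub>ideals_set (ring_on A)\<^esub> n"

lemma one_mem: "1 \<in> A"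
  using one_closed by simp

lemma zero_mem: "0 \<in> A"
  using zero_closed by simp

lemma add_mem: "x \<in> A \<Longrightarrow> y \<in> A \<Longrightarrow> x + y \<in> A"
  using add.m_closed[of x y] by simp

lemma mult_mem: "x \<in> A \<Longrightarrow> y \<in> A \<Longrightarrow> x * y \<in> A"
  using m_closed[of x y] by simp

lemma uminus_mem: "x \<in> A \<Longrightarrow> - x \<in> A"
proof -
  assume "x \<in> A"
  then have "x + \<ominus>\<^bsub>ring_on A\<^esub> x = 0" "\<ominus>\<^bsub>ring_on A\<^esub> x \<in> A"
    using r_neg[of x] a_inv_closed[of x] by auto
  then show ?thesis
    by (simp add: add_eq_0_iff)
qed

lemma sum_mem: "(\<And>x. x \<in> S \<Longrightarrow> f x \<in> A) \<Longrightarrow> sum f S \<in> A"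
  by (induction S rule: infinite_finite_induct) (auto simp: zero_mem add_mem)

lemma prod_mem: "(\<And>x. x \<in> S \<Longrightarrow> f x \<in> A) \<Longrightarrow> prod f S \<in> A"
  by (induction S rule: infinite_finite_induct) (auto simp: one_mem mult_mem)

lemma ideal_onI:
  assumes "I \<subseteq> A" "0 \<in> I" "\<And>x y. x \<in> I \<Longrightarrow> y \<in> I \<Longrightarrow> x + y \<in> I"
    "\<And>a x. a \<in> A \<Longrightarrow> x \<in> I \<Longrightarrow> a * x \<in> I"
  shows "ideal I (ring_on A)"
proof (rule idealI)
  show "subgroup I (add_monoid (ring_on A))"
  proof (rule add.subgroupI)
    show "\<ominus>\<^bsub>ring_on A\<^esub> a \<in> I" if "a \<in> I" for a
    proof -
      have "- a \<in> I"
        using assms(4)[OF uminus_mem[OF one_mem] that] by simp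
      moreover have "\<ominus>\<^bsub>ring_on A\<^esub> a = - a"
        using that assms(1) uminus_mem by (intro minus_equality) auto
      ultimately show ?thesis
        by simp
    qed
  qed (use assms in auto)
  show "x \<otimes>\<^bsub>ring_on A\<^esub> a \<in> I" "a \<otimes>\<^bsub>ring_on A\<^esub> x \<in> I" if "a \<in> I" "x \<in> carrier (ring_on A)" for a x
    using assms(4)[of x a] that by (simp_all add: mult.commute)
qed (rule ring_axioms)

lemma
  assumes "ideal I (ring_on A)"
  shows ideal_subset: "I \<subseteq> A" and ideal_zero: "0 \<in> I"
    and ideal_add: "x \<in> I \<Longrightarrow> y \<in> I \<Longrightarrow> x + y \<in> I"
    and ideal_mult: "a \<in> A \<Longrightarrow> x \<in> I \<Longrightarrow> a * x \<in> I"
proof -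
  interpret I: ideal I "ring_on A"
    by fact
  show "I \<subseteq> A" "0 \<in> I"
    using I.a_subset I.zero_closed by auto
  show "x + y \<in> I" if "x \<in> I" "y \<in> I"
    using I.a_closed[OF that] by simp
  show "a * x \<in> I" if "a \<in> A" "x \<in> I"
    using I.I_l_closed[of x a] that by simp
qed

lemma ideal_uminus: "ideal I (ring_on A) \<Longrightarrow> x \<in> I \<Longrightarrow> - x \<in> I"
  using ideal_mult[of I "- 1" x] uminus_mem[OF one_mem] by simp

lemma ideal_diff: "ideal I (ring_on A) \<Longrightarrow> x \<in> I \<Longrightarrow> y \<in> I \<Longrightarrow> x - y \<in> I"
  using ideal_add[of I x "- y"] ideal_uminus by simp

lemma ideal_sum: "ideal I (ring_on A) \<Longrightarrow> (\<And>x. x \<in> S \<Longrightarrow> f x \<in> I) \<Longrightarrow> sum f S \<in> I"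
  by (induction S rule: infinite_finite_induct) (auto simp: ideal_zero ideal_add)

lemma
  assumes "S \<subseteq> A"
  shows genideal_is_ideal: "ideal (Idl\<^bsub>ring_on A\<^esub> S) (ring_on A)"
    and genideal_superset: "S \<subseteq> Idl\<^bsub>ring_on A\<^esub> S"
    and genideal_least: "ideal J (ring_on A) \<Longrightarrow> S \<subseteq> J \<Longrightarrow> Idl\<^bsub>ring_on A\<^esub> S \<subseteq> J"
  using genideal_ideal[of S] genideal_self[of S] genideal_minimal[of J S] assms by auto

lemma ideal_ipow: "ideal I (ring_on A) \<Longrightarrow> ideal (ipow I n) (ring_on A)"
proof -
  assume I: "ideal I (ring_on A)"
  interpret M: comm_monoid "ideals_set (ring_on A)"
    by (rule ideals_set_is_comm_monoid)
  show ?thesis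
    using M.nat_pow_closed[of I n] I by (simp add: ideals_set_def)
qed

lemma ipow_0: "ipow I 0 = A"
  by (simp add: ideals_set_def)

lemma ipow_Suc: "ipow I (Suc n) = ideal_prod (ring_on A) (ipow I n) I"
  by (simp add: ideals_set_def)

lemma ipow_mult:
  assumes "ideal I (ring_on A)" "x \<in> ipow I m" "y \<in> ipow I n"
  shows "x * y \<in> ipow I (m + n)"
proof -
  interpret M: comm_monoid "ideals_set (ring_on A)"
    by (rule ideals_set_is_comm_monoid)
  have "ipow I (m + n) = ideal_prod (ring_on A) (ipow I m) (ipow I n)"
    using M.nat_pow_mult[of I m n] assms(1) by (simp add: ideals_set_def)
  then show ?thesis
    using ideal_prod.prod[of x "ipow I m" y "ipow I n" "ring_on A"] assms by simp
qed

lemma ipow_1: "ideal I (ring_on A) \<Longrightarrow> ipow I 1 = I"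
proof -
  assume I: "ideal I (ring_on A)"
  interpret M: comm_monoid "ideals_set (ring_on A)"
    by (rule ideals_set_is_comm_monoid)
  show ?thesis
    using M.l_one[of I] I by (simp add: ideals_set_def)
qed

lemma ipow_antimono:
  assumes "ideal I (ring_on A)" "m \<le> n"
  shows "ipow I n \<subseteq> ipow I m"
  using assms(2)
proof (induction rule: dec_induct)
  case (step n)
  have "ipow I (Suc n) \<subseteq> ipow I n"
    unfolding ipow_Suc using ideal_prod_inter[OF ideal_ipow[OF assms(1)] assms(1)] by blast
  with step show ?case
    by blast
qed simp

lemma ipow_power: "ideal I (ring_on A) \<Longrightarrow> x \<in> I \<Longrightarrow> x ^ n \<in> ipow I n"
proof (induction n)
  case 0
  then show ?case
    by (simp add: ideals_set_def one_mem)
next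
  case (Suc n)
  then show ?case
    using ipow_mult[of I x 1 "x ^ n" n] ipow_1[of I] by simp
qed

lemma ipow_prod:
  assumes "ideal I (ring_on A)" "\<And>x. x \<in> S \<Longrightarrow> f x \<in> ipow I (k x)"
  shows "prod f S \<in> ipow I (sum k S)"
  using assms(2)
proof (induction S rule: infinite_finite_induct)
  case (insert x S)
  then show ?case
    using ipow_mult[OF assms(1), of "f x" "k x"] by simp
qed (simp_all add: ideals_set_def one_mem)

lemma ipow_Suc_induct [consumes 1, case_names mult add]:
  assumes "x \<in> ipow I (Suc n)" "\<And>a b. a \<in> ipow I n \<Longrightarrow> b \<in> I \<Longrightarrow> P (a * b)"
    "\<And>a b. P a \<Longrightarrow> P b \<Longrightarrow> P (a + b)"
  shows "P x"
  using assms(1) unfolding ipow_Suc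
  by (induction rule: ideal_prod.induct) (use assms(2,3) in auto)

lemma primeideal_on_iff:
  "primeideal P (ring_on A) \<longleftrightarrow>
     ideal P (ring_on A) \<and> 1 \<notin> P \<and> (\<forall>a\<in>A. \<forall>b\<in>A. a * b \<in> P \<longrightarrow> a \<in> P \<or> b \<in> P)"
proof
  assume P: "primeideal P (ring_on A)"
  then interpret primeideal P "ring_on A" .
  have "1 \<notin> P"
    using one_imp_carrier I_notcarr by auto
  then show "ideal P (ring_on A) \<and> 1 \<notin> P \<and> (\<forall>a\<in>A. \<forall>b\<in>A. a * b \<in> P \<longrightarrow> a \<in> P \<or> b \<in> P)"
    using I_prime is_ideal by simp
next
  assume P: "ideal P (ring_on A) \<and> 1 \<notin> P \<and> (\<forall>a\<in>A. \<forall>b\<in>A. a * b \<in> P \<longrightarrow> a \<in> P \<or> b \<in> P)"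
  then show "primeideal P (ring_on A)"
    using one_mem by (intro primeidealI) (auto intro: cring)
qed

end

section \<open>Symbolic powers by clearing denominators\<close>

locale idom_on = cring_on A for A :: "'a::idom set"
begin

lemma symbolic_multiplier_mult:
  assumes "x \<in> A - \<Union> (minimal_primes (ring_on A) I)" "y \<in> A - \<Union> (minimal_primes (ring_on A) I)"
  shows "x * y \<in> A - \<Union> (minimal_primes (ring_on A) I)"
proof -
  have "x * y \<notin> P" if "P \<in> minimal_primes (ring_on A) I" for P
  proof -
    have "primeideal P (ring_on A)" "x \<notin> P" "y \<notin> P"
      using that assms by (auto simp: minimal_primes_def)
    then show ?thesis
      using assms unfolding primeideal_on_iff by blast
  qed
  then show ?thesis
    using assms mult_mem by blast
qed

text \<open>Removes fractions from all that follows. The fractions with numerator in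
  \<open>ipow I n\<close> and denominator in \<open>S\<close> already form the ideal generated by
  \<open>ipow I n\<close>, and equality of \<open>f / 1\<close> and \<open>a / b\<close> means
  \<open>b * f = a\<close>. A minimal prime is required to exist because it contains 0 and so keeps
  0 out of \<open>S\<close>.\<close>

lemma symbolic_power_iff:
  assumes I: "ideal I (ring_on A)" and ne: "minimal_primes (ring_on A) I \<noteq> {}"
  shows "f \<in> symbolic_power A I n \<longleftrightarrow>
    f \<in> A \<and> (\<exists>s\<in>A - \<Union> (minimal_primes (ring_on A) I). s * f \<in> ipow I n)"
proof -
  define S where "S = A - \<Union> (minimal_primes (ring_on A) I)"
  have prime: "primeideal P (ring_on A)" if "P \<in> minimal_primes (ring_on A) I" for P
    using that by (simp add: minimal_primes_def)
  have S: "S \<subseteq> A" "1 \<in> S" "0 \<notin> S"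
    using prime ne one_mem ideal_zero unfolding S_def primeideal_on_iff by auto
  have S_mult: "x * y \<in> S" if "x \<in> S" "y \<in> S" for x y
    using that unfolding S_def by (rule symbolic_multiplier_mult)
  have S0: "b \<noteq> 0" if "b \<in> S" for b
    using that S(3) by auto
  define L where "L = localization A S"
  interpret L: cring_on "{Fract a b |a b. a \<in> A \<and> b \<in> S}"
    using cring_localization[OF cring S S_mult] by (intro cring_on.intro) (simp add: localization_def)
  have L_eq: "L = ring_on {Fract a b |a b. a \<in> A \<and> b \<in> S}"
    by (simp add: L_def localization_def)
  define J where "J = ipow I n"
  have J: "ideal J (ring_on A)"
    unfolding J_def by (rule ideal_ipow[OF I])
  define B where "B = {Fract a b |a b. a \<in> J \<and> b \<in> S}"
  have B: "ideal B L"
    unfolding L_eq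
  proof (rule L.ideal_onI)
    show "B \<subseteq> {Fract a b |a b. a \<in> A \<and> b \<in> S}"
      using ideal_subset[OF J] by (auto simp: B_def)
    show "0 \<in> B"
      using ideal_zero[OF J] S(2) by (auto simp: B_def Zero_fract_def)
    show "x + y \<in> B" if xy: "x \<in> B" "y \<in> B" for x y
    proof -
      from xy obtain a b c d where *: "x = Fract a b" "y = Fract c d" "a \<in> J" "c \<in> J" "b \<in> S" "d \<in> S"
        by (auto simp: B_def)
      then have "x + y = Fract (a * d + c * b) (b * d)"
        by (simp add: S0)
      moreover have "a * d + c * b \<in> J"
        using * S(1) ideal_mult[OF J, of d a] ideal_mult[OF J, of b c] ideal_add[OF J]
        by (auto simp: mult.commute)
      ultimately show ?thesis
        using * S_mult unfolding B_def by blast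
    qed
    show "x * y \<in> B" if x: "x \<in> {Fract a b |a b. a \<in> A \<and> b \<in> S}" and y: "y \<in> B" for x y
    proof -
      from x y obtain a b c d where *: "x = Fract a b" "y = Fract c d" "a \<in> A" "c \<in> J" "b \<in> S" "d \<in> S"
        by (auto simp: B_def)
      then have "x * y = Fract (a * c) (b * d)"
        by simp
      then show ?thesis
        using * S_mult ideal_mult[OF J, of a c] unfolding B_def by blast
    qed
  qed
  have img: "(\<lambda>a. Fract a 1) ` J \<subseteq> {Fract a b |a b. a \<in> A \<and> b \<in> S}"
    using ideal_subset[OF J] S(2) by auto
  have imgB: "(\<lambda>a. Fract a 1) ` J \<subseteq> B"
    using S(2) by (auto simp: B_def)
  have "Idl\<^bsub>L\<^esub> ((\<lambda>a. Fract a 1) ` J) = B"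
  proof
    show "Idl\<^bsub>L\<^esub> ((\<lambda>a. Fract a 1) ` J) \<subseteq> B"
      using L.genideal_least[OF img] B imgB unfolding L_eq by blast
    show "B \<subseteq> Idl\<^bsub>L\<^esub> ((\<lambda>a. Fract a 1) ` J)"
    proof
      fix x assume "x \<in> B"
      then obtain a b where x: "x = Fract a b" "a \<in> J" "b \<in> S"
        by (auto simp: B_def)
      have "Fract 1 b * Fract a 1 \<in> Idl\<^bsub>L\<^esub> ((\<lambda>a. Fract a 1) ` J)"
        unfolding L_eq
      proof (rule L.ideal_mult[OF L.genideal_is_ideal[OF img]])
        show "Fract 1 b \<in> {Fract a b |a b. a \<in> A \<and> b \<in> S}"
          using x(3) one_mem by blast
        show "Fract a 1 \<in> Idl\<^bsub>ring_on {Fract a b |a b. a \<in> A \<and> b \<in> S}\<^esub> ((\<lambda>a. Fract a 1) ` J)"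
          using x(2) L.genideal_superset[OF img] by blast
      qed
      then show "x \<in> Idl\<^bsub>L\<^esub> ((\<lambda>a. Fract a 1) ` J)"
        by (simp add: x)
    qed
  qed
  then have "f \<in> symbolic_power A I n \<longleftrightarrow> f \<in> A \<and> Fract f 1 \<in> B"
    by (simp add: symbolic_power_def Let_def flip: S_def L_def J_def)
  also have "\<dots> \<longleftrightarrow> f \<in> A \<and> (\<exists>s\<in>S. s * f \<in> J)"
  proof (intro conj_cong refl iffI)
    assume "Fract f 1 \<in> B"
    then obtain a b where "Fract f 1 = Fract a b" "a \<in> J" "b \<in> S"
      by (auto simp: B_def)
    then show "\<exists>s\<in>S. s * f \<in> J"
      using S0[of b] by (auto simp: eq_fract mult.commute)
  next
    assume "\<exists>s\<in>S. s * f \<in> J"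
    then obtain s where s: "s \<in> S" "s * f \<in> J"
      by blast
    then have "Fract f 1 = Fract (s * f) s"
      using S0[of s] by (simp add: eq_fract)
    then show "Fract f 1 \<in> B"
      using s unfolding B_def by blast
  qed
  finally show ?thesis
    by (simp add: S_def J_def)
qed

context
  fixes I :: "'a set"
  assumes I: "ideal I (ring_on A)" and ne: "minimal_primes (ring_on A) I \<noteq> {}"
begin

lemma symbolic_power_mult:
  assumes "f \<in> symbolic_power A I m" "g \<in> symbolic_power A I n"
  shows "f * g \<in> symbolic_power A I (m + n)"
proof -
  obtain x y where x: "x \<in> A - \<Union> (minimal_primes (ring_on A) I)" "x * f \<in> ipow I m"
    and y: "y \<in> A - \<Union> (minimal_primes (ring_on A) I)" "y * g \<in> ipow I n"
    using assms unfolding symbolic_power_iff[OF I ne] by blast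
  have "(x * y) * (f * g) \<in> ipow I (m + n)"
    using ipow_mult[OF I x(2) y(2)] by (simp add: ac_simps)
  then show ?thesis
    using symbolic_multiplier_mult[OF x(1) y(1)] mult_mem[of f g] assms unfolding symbolic_power_iff[OF I ne] by blast
qed

lemma symbolic_power_antimono: "m \<le> n \<Longrightarrow> symbolic_power A I n \<subseteq> symbolic_power A I m"
  using ipow_antimono[OF I] unfolding subset_iff symbolic_power_iff[OF I ne] by blast

lemma symbolic_power_0: "symbolic_power A I 0 = A"
proof -
  have "1 \<in> A - \<Union> (minimal_primes (ring_on A) I)"
    using one_mem by (auto simp: minimal_primes_def primeideal_on_iff)
  then show ?thesis
    unfolding set_eq_iff symbolic_power_iff[OF I ne] ipow_0 using mult_mem by auto
qed

lemma symbolic_power_ideal: "ideal (symbolic_power A I n) (ring_on A)"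
proof (rule ideal_onI)
  note iff = symbolic_power_iff[OF I ne]
  note J = ideal_ipow[OF I, of n]
  have one: "1 \<in> A - \<Union> (minimal_primes (ring_on A) I)"
    using one_mem by (auto simp: minimal_primes_def primeideal_on_iff)
  show "symbolic_power A I n \<subseteq> A"
    by (auto simp: iff)
  show "0 \<in> symbolic_power A I n"
    unfolding iff using one ideal_zero[OF J] zero_mem by auto
  show "f + g \<in> symbolic_power A I n" if fg: "f \<in> symbolic_power A I n" "g \<in> symbolic_power A I n" for f g
  proof -
    obtain x y where x: "x \<in> A - \<Union> (minimal_primes (ring_on A) I)" "x * f \<in> ipow I n"
      and y: "y \<in> A - \<Union> (minimal_primes (ring_on A) I)" "y * g \<in> ipow I n"
      using fg unfolding iff by blast
    have "(x * y) * (f + g) = y * (x * f) + x * (y * g)"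
      by (simp add: algebra_simps)
    also have "\<dots> \<in> ipow I n"
      using x(1) y(1) by (intro ideal_add[OF J] ideal_mult[OF J _ x(2)] ideal_mult[OF J _ y(2)]) auto
    finally show ?thesis
      using symbolic_multiplier_mult[OF x(1) y(1)] add_mem[of f g] fg unfolding iff by blast
  qed
  show "a * f \<in> symbolic_power A I n" if af: "a \<in> A" "f \<in> symbolic_power A I n" for a f
  proof -
    obtain x where x: "x \<in> A - \<Union> (minimal_primes (ring_on A) I)" "x * f \<in> ipow I n" "f \<in> A"
      using af(2) unfolding iff by blast
    have "x * (a * f) \<in> ipow I n"
      using ideal_mult[OF J af(1) x(2)] by (simp add: ac_simps)
    then show ?thesis
      using x af(1) mult_mem[of a f] unfolding iff by blast
  qed
qed

lemma symbolic_power_prod: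
  assumes "\<And>x. x \<in> S \<Longrightarrow> f x \<in> symbolic_power A I (k x)"
  shows "prod f S \<in> symbolic_power A I (sum k S)"
  using assms
  by (induction S rule: infinite_finite_induct) (auto simp: symbolic_power_0 one_mem symbolic_power_mult)

end

end

lemma minimal_primes_prime:
  assumes "primeideal I R"
  shows "minimal_primes R I = {I}"
  using assms unfolding minimal_primes_def by auto

section \<open>The generic matrix of bounded rank\<close>

text \<open>The entries of \<open>YZ\<close>, where the variable \<open>y\<^bsub>i,k\<^esub>\<close> has index \<open>(False, k, i)\<close> and \<open>z\<^bsub>k,j\<^esub>\<close> has index \<open>(True, k, j)\<close>.\<close>

definition ymon :: "nat \<Rightarrow> nat \<times> nat \<Rightarrow> bool \<times> nat \<times> nat \<Rightarrow>\<^sub>0 nat" where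
  "ymon k v = single (False, k, fst v) 1 + single (True, k, snd v) 1"

definition rank_var :: "nat \<Rightarrow> nat \<times> nat \<Rightarrow> (bool \<times> nat \<times> nat \<Rightarrow>\<^sub>0 nat) \<Rightarrow>\<^sub>0 'k::field" where
  "rank_var K v = (\<Sum>k<K. single (ymon k v) 1)"

text \<open>Expanding a product of entries of YZ chooses a summand \<open>k\<close> for each factor;
  \<open>\<beta> k\<close> collects the factors with choice \<open>k\<close>. The resulting monomial
  \<open>\<mu>\<close> remembers only the row and column degrees of each
  \<open>\<beta> k\<close>.\<close>

definition margins :: "nat \<Rightarrow> (nat \<Rightarrow> monomial) \<Rightarrow> (bool \<times> nat \<times> nat \<Rightarrow>\<^sub>0 nat) \<Rightarrow> bool" where
  "margins K \<beta> \<mu> \<longleftrightarrow> (\<forall>k<K. \<forall>i. lookup \<mu> (False, k, i) = wt {v. fst v = i} (\<beta> k) \<and>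
     lookup \<mu> (True, k, i) = wt {v. snd v = i} (\<beta> k))"

lemma margins_add: "margins K \<beta> \<mu> \<Longrightarrow> margins K \<beta>' \<mu>' \<Longrightarrow> margins K (\<lambda>k. \<beta> k + \<beta>' k) (\<mu> + \<mu>')"
  by (simp add: margins_def lookup_add wt_add)

lemma margins_0: "margins K (\<lambda>k. 0) 0"
  by (simp add: margins_def)

lemma margins_sum:
  "(\<And>x. x \<in> S \<Longrightarrow> margins K (\<beta> x) (\<mu> x)) \<Longrightarrow> margins K (\<lambda>k. \<Sum>x\<in>S. \<beta> x k) (\<Sum>x\<in>S. \<mu> x)"
  by (simp add: margins_def lookup_sum wt_sum)

lemma margins_ymon: "margins K (\<lambda>l. if l = k then single v 1 else 0) (ymon k v)"
  by (auto simp: margins_def ymon_def lookup_add lookup_single when_def)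

lemma keys_rank_var_power:
  assumes "\<mu> \<in> keys (rank_var K v ^ n :: _ \<Rightarrow>\<^sub>0 'k::field)"
  shows "\<exists>\<beta>. (\<Sum>k<K. \<beta> k) = single v n \<and> margins K \<beta> \<mu>"
  using assms
proof (induction n arbitrary: \<mu>)
  case 0
  then show ?case
    by (intro exI[of _ "\<lambda>k. 0"]) (simp add: margins_0)
next
  case (Suc n)
  then obtain a b where ab: "\<mu> = a + b" "a \<in> keys (rank_var K v :: _ \<Rightarrow>\<^sub>0 'k)" "b \<in> keys (rank_var K v ^ n :: _ \<Rightarrow>\<^sub>0 'k)"
    using keys_mult[of "rank_var K v :: _ \<Rightarrow>\<^sub>0 'k" "rank_var K v ^ n"] by auto
  have "a \<in> (\<Union>k<K. keys (single (ymon k v) (1 :: 'k)))"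
    using ab(2) keys_sum[of "\<lambda>k. single (ymon k v) (1 :: 'k)" "{..<K}"] unfolding rank_var_def by blast
  then obtain k where k: "k < K" "a = ymon k v"
    by auto
  from Suc.IH[OF ab(3)] obtain \<beta> where \<beta>: "(\<Sum>k<K. \<beta> k) = single v n" "margins K \<beta> b"
    by blast
  have "(\<Sum>l<K. (if l = k then single v 1 else 0) + \<beta> l) = single v (Suc n)"
    using k by (simp add: sum.distrib \<beta>(1) flip: single_add)
  then show ?case
    using margins_add[OF margins_ymon[of K k v] \<beta>(2)] k ab(1) by blast
qed

lemma keys_prod_subset:
  assumes "\<mu> \<in> keys (\<Prod>x\<in>S. f x :: 'a::comm_monoid_add \<Rightarrow>\<^sub>0 'b::comm_semiring_1)" "finite S"
  shows "\<exists>\<nu>. (\<forall>x\<in>S. \<nu> x \<in> keys (f x)) \<and> \<mu> = (\<Sum>x\<in>S. \<nu> x)"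
  using assms(2,1)
proof (induction S arbitrary: \<mu> rule: finite_induct)
  case empty
  then show ?case
    by (simp split: if_splits)
next
  case (insert x S)
  then obtain a b where ab: "\<mu> = a + b" "a \<in> keys (f x)" "b \<in> keys (\<Prod>x\<in>S. f x)"
    using keys_mult[of "f x" "\<Prod>x\<in>S. f x"] by auto
  from insert.IH[OF ab(3)] obtain \<nu> where "\<forall>x\<in>S. \<nu> x \<in> keys (f x)" "b = (\<Sum>x\<in>S. \<nu> x)"
    by blast
  moreover from this insert.hyps have "(\<Sum>y\<in>S. if y = x then a else \<nu> y) = b"
    by (auto intro!: sum.cong)
  ultimately show ?case
    using insert.hyps ab by (intro exI[of _ "\<lambda>y. if y = x then a else \<nu> y"]) auto
qed

text \<open>One summand is chosen per factor. This bounds the support from above and says nothing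
  about cancellation; it serves to restrict which monomials \<open>b\<close> can produce
  \<open>\<mu>\<close>.\<close>

lemma keys_meval_rank_var:
  assumes "\<mu> \<in> keys (meval (rank_var K) b :: _ \<Rightarrow>\<^sub>0 'k::field)"
  shows "\<exists>\<beta>. (\<Sum>k<K. \<beta> k) = b \<and> margins K \<beta> \<mu>"
proof -
  obtain \<nu> where \<nu>: "\<forall>v\<in>keys b. \<nu> v \<in> keys (rank_var K v ^ lookup b v :: _ \<Rightarrow>\<^sub>0 'k)" "\<mu> = (\<Sum>v\<in>keys b. \<nu> v)"
    using keys_prod_subset[OF assms[unfolded meval_def] finite_keys] by blast
  then have "\<forall>v\<in>keys b. \<exists>\<beta>. (\<Sum>k<K. \<beta> k) = single v (lookup b v) \<and> margins K \<beta> (\<nu> v)"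
    using keys_rank_var_power by blast
  then obtain \<beta> where \<beta>: "\<And>v. v \<in> keys b \<Longrightarrow> (\<Sum>k<K. \<beta> v k) = single v (lookup b v)"
    "\<And>v. v \<in> keys b \<Longrightarrow> margins K (\<beta> v) (\<nu> v)"
    by metis
  have "(\<Sum>k<K. \<Sum>v\<in>keys b. \<beta> v k) = (\<Sum>v\<in>keys b. \<Sum>k<K. \<beta> v k)"
    by (rule sum.swap)
  also have "\<dots> = b"
    using \<beta>(1) by (subst (2) poly_mapping_sum_single) (intro sum.cong, auto)
  finally show ?thesis
    unfolding \<nu>(2) using margins_sum[of "keys b" K \<beta> \<nu>, OF \<beta>(2)]
    by (intro exI[of _ "\<lambda>k. \<Sum>v\<in>keys b. \<beta> v k"] conjI)
qed

text \<open>In characteristic 0 a sum of natural numbers vanishes only if every summand does, so no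
  term of a product of such polynomials cancels.\<close>

definition nat_coeffs :: "('a \<Rightarrow>\<^sub>0 'b::semiring_1) \<Rightarrow> bool" where
  "nat_coeffs f \<longleftrightarrow> (\<forall>m. lookup f m \<in> \<nat>)"

lemma nat_coeffs_mult:
  fixes f g :: "'a::comm_monoid_add \<Rightarrow>\<^sub>0 'b::{comm_ring_1, ring_char_0, idom}"
  assumes "nat_coeffs f" "nat_coeffs g"
  shows "nat_coeffs (f * g)" "p \<in> keys f \<Longrightarrow> q \<in> keys g \<Longrightarrow> p + q \<in> keys (f * g)"
proof -
  have "\<forall>m. \<exists>n. lookup f m = of_nat n" "\<forall>m. \<exists>n. lookup g m = of_nat n"
    using assms unfolding nat_coeffs_def Nats_def by blast+
  then obtain c d where cd: "\<And>m. lookup f m = of_nat (c m)" "\<And>m. lookup g m = of_nat (d m)"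
    by metis
  have eq: "lookup (f * g) m = of_nat (\<Sum>a\<in>keys f. \<Sum>b\<in>keys g. if a + b = m then c a * d b else 0)" for m
    unfolding lookup_mult_sum of_nat_sum by (intro sum.cong refl) (simp add: cd)
  show "nat_coeffs (f * g)"
    unfolding nat_coeffs_def eq by (intro allI of_nat_in_Nats)
  assume pq: "p \<in> keys f" "q \<in> keys g"
  then have "c p * d q \<noteq> 0"
    by (auto simp: in_keys_iff cd)
  moreover have "c p * d q \<le> (\<Sum>b\<in>keys g. if p + b = p + q then c p * d b else 0)"
    using member_le_sum[of q "keys g" "\<lambda>b. if p + b = p + q then c p * d b else 0"] pq by simp
  moreover have "\<dots> \<le> (\<Sum>a\<in>keys f. \<Sum>b\<in>keys g. if a + b = p + q then c a * d b else 0)"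
    using pq by (intro member_le_sum[of p "keys f" "\<lambda>a. \<Sum>b\<in>keys g. if a + b = p + q then c a * d b else 0"]) auto
  ultimately have "(\<Sum>a\<in>keys f. \<Sum>b\<in>keys g. if a + b = p + q then c a * d b else 0) \<noteq> 0"
    by linarith
  then show "p + q \<in> keys (f * g)"
    unfolding in_keys_iff eq of_nat_eq_0_iff .
qed

lemma nat_coeffs_1: "nat_coeffs 1"
  by (auto simp: nat_coeffs_def lookup_one when_def)

lemma nat_coeffs_prod:
  fixes f :: "'x \<Rightarrow> 'a::comm_monoid_add \<Rightarrow>\<^sub>0 'b::{comm_ring_1, ring_char_0, idom}"
  assumes "\<And>x. x \<in> S \<Longrightarrow> nat_coeffs (f x)" "\<And>x. x \<in> S \<Longrightarrow> \<nu> x \<in> keys (f x)"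
  shows "nat_coeffs (\<Prod>x\<in>S. f x) \<and> (\<Sum>x\<in>S. \<nu> x) \<in> keys (\<Prod>x\<in>S. f x)"
  using assms by (induction S rule: infinite_finite_induct) (auto simp: nat_coeffs_1 nat_coeffs_mult)

lemma nat_coeffs_rank_var: "nat_coeffs (rank_var K v :: _ \<Rightarrow>\<^sub>0 'k::field)"
proof -
  have eq: "lookup (rank_var K v) m = (of_nat (\<Sum>k<K. if ymon k v = m then 1 else 0) :: 'k)" for m
    unfolding rank_var_def lookup_sum of_nat_sum
    by (intro sum.cong refl) (simp add: lookup_single when_def)
  show ?thesis
    unfolding nat_coeffs_def eq by (intro allI of_nat_in_Nats)
qed

lemma ymon_in_keys_rank_var:
  assumes "k < K"
  shows "ymon k v \<in> keys (rank_var K v :: _ \<Rightarrow>\<^sub>0 'k::field)"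
proof -
  have "ymon l v = ymon k v \<longleftrightarrow> l = k" for l
  proof
    assume "ymon l v = ymon k v"
    then have "lookup (ymon l v) (False, k, fst v) = lookup (ymon k v) (False, k, fst v)"
      by simp
    then show "l = k"
      by (simp add: ymon_def lookup_add lookup_single when_def split: if_splits)
  qed simp
  then show ?thesis
    using assms by (simp add: in_keys_iff rank_var_def lookup_sum lookup_single when_def)
qed

text \<open>Exchange argument. Suppose \<open>\<beta> < \<alpha>\<close>. At the first position
  where they differ \<open>\<beta>\<close> is smaller; equal row sums force a position further right
  where \<open>\<beta>\<close> is larger, and equal column sums one further down where
  \<open>\<alpha>\<close> is larger. The first and the last of these positions occur in
  \<open>\<alpha>\<close> and form a chain.\<close>

lemma antichain_le_margins:
  fixes \<alpha> \<beta> :: monomial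
  assumes anti: "\<And>v w. v \<in> keys \<alpha> \<Longrightarrow> w \<in> keys \<alpha> \<Longrightarrow> \<not> slt v w"
    and row: "\<And>i. wt {v. fst v = i} \<alpha> = wt {v. fst v = i} \<beta>"
    and col: "\<And>j. wt {v. snd v = j} \<alpha> = wt {v. snd v = j} \<beta>"
  shows "\<alpha> \<le> \<beta>"
proof (rule ccontr)
  assume "\<not> \<alpha> \<le> \<beta>"
  then have "\<beta> < \<alpha>"
    by simp
  then obtain v where "lookup \<beta> v < lookup \<alpha> v" "\<forall>w<v. lookup \<beta> w = lookup \<alpha> w"
    using iffD1[OF monomial_less_iff] by meson
  then obtain i j where less: "lookup \<beta> (i, j) < lookup \<alpha> (i, j)"
    and below: "\<And>w. w < (i, j) \<Longrightarrow> lookup \<beta> w = lookup \<alpha> w"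
    by (cases v) blast
  have exch: "\<exists>w\<in>F. lookup g w < lookup h w"
    if eq: "wt F g = wt F h" and v: "v \<in> F" "lookup h v < lookup g v" for F v and g h :: monomial
  proof (rule ccontr)
    let ?S = "(keys g \<union> keys h) \<inter> F"
    assume "\<not> ?thesis"
    then have "\<forall>w\<in>?S. lookup h w \<le> lookup g w"
      by auto
    moreover have "\<exists>w\<in>?S. lookup h w < lookup g w"
      using v by (intro bexI[of _ v]) (auto simp: in_keys_iff)
    ultimately have "(\<Sum>w\<in>?S. lookup h w) < (\<Sum>w\<in>?S. lookup g w)"
      by (intro sum_strict_mono_ex1) auto
    moreover have "wt F g = (\<Sum>w\<in>?S. lookup g w)" "wt F h = (\<Sum>w\<in>?S. lookup h w)"
      by (intro wt_superset; auto)+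
    ultimately show False
      using eq by simp
  qed
  obtain j' where j': "lookup \<alpha> (i, j') < lookup \<beta> (i, j')"
    using exch[OF row, of "(i, j)" i] less by auto
  have "j < j'"
    using j' below[of "(i, j')"] less by (cases j j' rule: linorder_cases) auto
  obtain i' where i': "lookup \<beta> (i', j') < lookup \<alpha> (i', j')"
    using exch[OF col[symmetric], of "(i, j')" j'] j' by auto
  have "i < i'"
    using i' below[of "(i', j')"] j' by (cases i i' rule: linorder_cases) auto
  have "(i, j) \<in> keys \<alpha>" "(i', j') \<in> keys \<alpha>"
    using less i' by (auto simp: in_keys_iff)
  from anti[OF this] show False
    using \<open>j < j'\<close> \<open>i < i'\<close> by (simp add: slt_def)
qed

text \<open>The coefficient of the margins of an antichain colouring of the leading monomial survives.\<close>

theorem subst_rank_var_nonzero: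
  fixes f :: "'k::field_char_0 mpoly"
  assumes f: "f \<noteq> 0" and nochain: "\<not> has_chain t (keys (lead f))"
  shows "subst_vars (rank_var (t - 1)) f \<noteq> (0 :: (bool \<times> nat \<times> nat \<Rightarrow>\<^sub>0 nat) \<Rightarrow>\<^sub>0 'k)"
proof -
  define a K where "a = lead f" and "K = t - 1"
  obtain \<kappa> where \<kappa>: "\<And>v. v \<in> keys a \<Longrightarrow> \<kappa> v < K"
    "\<And>v w. v \<in> keys a \<Longrightarrow> w \<in> keys a \<Longrightarrow> \<kappa> v = \<kappa> w \<Longrightarrow> \<not> slt v w"
    using antichain_coloring[OF finite_keys nochain] unfolding a_def K_def by blast
  \<comment> \<open>Each of the \<open>lookup a v\<close> factors belonging to \<open>v\<close>
    picks the summand numbered by the colour of \<open>v\<close>, so \<open>\<alpha> k\<close> is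
    the part of \<open>a\<close> on colour class \<open>k\<close>.\<close>
  define \<nu> where "\<nu> v = (\<Sum>_<lookup a v. ymon (\<kappa> v) v)" for v
  define \<mu> where "\<mu> = (\<Sum>v\<in>keys a. \<nu> v)"
  define \<alpha> where "\<alpha> k = (\<Sum>v\<in>keys a. if k = \<kappa> v then single v (lookup a v) else 0)" for k
  have \<nu>_keys: "nat_coeffs (rank_var K v ^ lookup a v :: _ \<Rightarrow>\<^sub>0 'k) \<and> \<nu> v \<in> keys (rank_var K v ^ lookup a v :: _ \<Rightarrow>\<^sub>0 'k)"
    if "v \<in> keys a" for v
    using nat_coeffs_prod[of "{..<lookup a v}" "\<lambda>_. rank_var K v :: _ \<Rightarrow>\<^sub>0 'k" "\<lambda>_. ymon (\<kappa> v) v", OF nat_coeffs_rank_var ymon_in_keys_rank_var[OF \<kappa>(1)[OF that]]]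
    by (simp add: \<nu>_def)
  have \<mu>_keys: "\<mu> \<in> keys (meval (rank_var K) a :: _ \<Rightarrow>\<^sub>0 'k)"
    unfolding \<mu>_def meval_def using \<nu>_keys by (intro conjunct2[OF nat_coeffs_prod]) auto
  have "margins K (\<lambda>k. \<Sum>v\<in>keys a. \<Sum>_<lookup a v. if k = \<kappa> v then single v 1 else 0) \<mu>"
    unfolding \<mu>_def \<nu>_def by (intro margins_sum margins_ymon)
  moreover have "(\<Sum>_<lookup a v. if k = \<kappa> v then single v 1 else 0) = (if k = \<kappa> v then single v (lookup a v) else 0)" for k v
  proof -
    have "(\<Sum>_<n. single v (1::nat)) = single v n" for n
      by (induction n) (auto simp flip: single_add)
    then show ?thesis
      by simp
  qed
  ultimately have \<mu>: "margins K \<alpha> \<mu>"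
    by (simp add: \<alpha>_def[abs_def])
  have keys_\<alpha>: "keys (\<alpha> k) \<subseteq> {v \<in> keys a. \<kappa> v = k}" for k
    by (auto simp: \<alpha>_def in_keys_iff lookup_sum lookup_single when_def split: if_splits dest!: sum.not_neutral_contains_not_neutral)
  have sum_\<alpha>: "(\<Sum>k<K. \<alpha> k) = a"
  proof -
    have "(\<Sum>k<K. \<alpha> k) = (\<Sum>v\<in>keys a. \<Sum>k<K. if k = \<kappa> v then single v (lookup a v) else 0)"
      unfolding \<alpha>_def by (rule sum.swap)
    also have "\<dots> = (\<Sum>v\<in>keys a. single v (lookup a v))"
      using \<kappa>(1) by (intro sum.cong) auto
    finally show ?thesis
      by (simp flip: poly_mapping_sum_single)
  qed
  \<comment> \<open>Each \<open>\<alpha> k\<close> is least among the monomials with its margins, so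
    every \<open>b\<close> producing \<open>\<mu>\<close> is at least \<open>a\<close>. As
    \<open>a\<close> is the greatest monomial of \<open>f\<close>, it alone contributes to the
    coefficient of \<open>\<mu>\<close>.\<close>
  have ge: "a \<le> b" if b: "\<mu> \<in> keys (meval (rank_var K) b :: _ \<Rightarrow>\<^sub>0 'k)" for b
  proof -
    from keys_meval_rank_var[OF b] obtain \<beta> where \<beta>: "(\<Sum>k<K. \<beta> k) = b" "margins K \<beta> \<mu>"
      by blast
    have "\<alpha> k \<le> \<beta> k" if "k < K" for k
    proof (rule antichain_le_margins)
      show "\<not> slt v w" if "v \<in> keys (\<alpha> k)" "w \<in> keys (\<alpha> k)" for v w
        using that keys_\<alpha>[of k] \<kappa>(2)[of v w] by auto
    qed (use \<mu> \<beta>(2) that in \<open>auto simp: margins_def\<close>)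
    then have "(\<Sum>k<K. \<alpha> k) \<le> (\<Sum>k<K. \<beta> k)"
      by (intro sum_mono) auto
    then show ?thesis
      by (simp add: sum_\<alpha> \<beta>(1))
  qed
  have coeff: "lookup (single 0 c * p) m = c * lookup p m" for c :: 'k and p :: "(bool \<times> nat \<times> nat \<Rightarrow>\<^sub>0 nat) \<Rightarrow>\<^sub>0 'k" and m
    using lookup_single_mult[of 0 c p m] by simp
  have "lookup (subst_vars (rank_var K) f) \<mu> = (\<Sum>b\<in>keys f. lookup f b * lookup (meval (rank_var K) b :: _ \<Rightarrow>\<^sub>0 'k) \<mu>)"
    by (simp add: subst_vars_def lookup_sum coeff)
  also have "\<dots> = (\<Sum>b\<in>{a}. lookup f b * lookup (meval (rank_var K) b) \<mu>)"
  proof (rule sum.mono_neutral_right)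
    show "\<forall>b\<in>keys f - {a}. lookup f b * lookup (meval (rank_var K) b :: _ \<Rightarrow>\<^sub>0 'k) \<mu> = 0"
      using ge lead_ge[of _ f] unfolding a_def by (metis DiffE antisym in_keys_iff mult_zero_right singletonI)
  qed (use lead_in_keys[OF f] in \<open>auto simp: a_def\<close>)
  also have "\<dots> \<noteq> 0"
    using \<mu>_keys lead_in_keys[OF f] by (simp add: in_keys_iff a_def)
  finally show ?thesis
    unfolding K_def by auto
qed

section \<open>Determinantal ideals and their initial ideals\<close>

lemma det_eq_0_if_zero_column:
  fixes B :: "'a::comm_ring_1 mat"
  assumes "B \<in> carrier_mat n n" "k < n" "\<And>i. i < n \<Longrightarrow> B $$ (i, k) = 0"
  shows "det B = 0"
proof -
  have "(\<Prod>i = 0..<n. B $$ (i, p i)) = 0" if p: "p permutes {0..<n}" for p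
  proof (rule prod_zero)
    obtain i where "p i = k" "i < n"
      using permutes_image[OF p] assms(2) by (metis atLeast0LessThan imageE lessThan_iff)
    then show "\<exists>i\<in>{0..<n}. B $$ (i, p i) = 0"
      using assms(3)[of i] by (intro bexI[of _ i]) auto
  qed simp
  then show ?thesis
    unfolding det_def'[OF assms(1)] by (intro sum.neutral) simp
qed

lemma subst_rank_var_gminor:
  assumes "1 \<le> t"
  shows "subst_vars (rank_var (t - 1)) (gminor t \<rho> \<gamma>) = (0 :: _ \<Rightarrow>\<^sub>0 'k::field)"
proof -
  \<comment> \<open>The factors are made square, \<open>Y\<close> by a zero column and
    \<open>Z\<close> by one more row, so that multiplicativity of the determinant applies.\<close>
  define Y :: "((bool \<times> nat \<times> nat \<Rightarrow>\<^sub>0 nat) \<Rightarrow>\<^sub>0 'k) mat" where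
    "Y = mat t t (\<lambda>(i, k). if k < t - 1 then single (single (False, k, \<rho> i) 1) 1 else 0)"
  define Z :: "((bool \<times> nat \<times> nat \<Rightarrow>\<^sub>0 nat) \<Rightarrow>\<^sub>0 'k) mat" where
    "Z = mat t t (\<lambda>(k, j). single (single (True, k, \<gamma> j) 1) 1)"
  have [simp]: "Y \<in> carrier_mat t t" "Z \<in> carrier_mat t t"
    by (auto simp: Y_def Z_def)
  have "mat t t (\<lambda>ij. subst_vars (rank_var (t - 1)) (case ij of (i, j) \<Rightarrow> var (\<rho> i, \<gamma> j))) = Y * Z"
  proof (rule eq_matI)
    fix i j assume "i < dim_row (Y * Z)" "j < dim_col (Y * Z)"
    then have ij: "i < t" "j < t"
      by (auto simp: Y_def Z_def)
    have "(Y * Z) $$ (i, j) = (\<Sum>k = 0..<t. Y $$ (i, k) * Z $$ (k, j))"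
      using ij by (simp add: Y_def Z_def scalar_prod_def)
    also have "\<dots> = (\<Sum>k = 0..<t. if k < t - 1 then single (ymon k (\<rho> i, \<gamma> j)) 1 else 0)"
      using ij by (intro sum.cong) (auto simp: Y_def Z_def mult_single ymon_def)
    also have "\<dots> = rank_var (t - 1) (\<rho> i, \<gamma> j)"
      unfolding rank_var_def by (rule sum.mono_neutral_cong_right) auto
    also have "\<dots> = subst_vars (rank_var (t - 1)) (var (\<rho> i, \<gamma> j))"
      by (simp add: var_def subst_vars_single meval_def)
    finally show "mat t t (\<lambda>ij. subst_vars (rank_var (t - 1)) (case ij of (i, j) \<Rightarrow> var (\<rho> i, \<gamma> j))) $$ (i, j)
        = (Y * Z) $$ (i, j)"
      using ij by simp
  qed (auto simp: Y_def Z_def)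
  then have "subst_vars (rank_var (t - 1)) (gminor t \<rho> \<gamma>) = det Y * det Z"
    unfolding gminor_def subst_vars_det by (simp add: det_mult[of Y t Z])
  moreover have "det Y = 0"
    by (rule det_eq_0_if_zero_column[of _ t "t - 1"]) (use assms in \<open>auto simp: Y_def\<close>)
  ultimately show ?thesis
    by simp
qed

lemma wt_UNIV_dmono: "wt UNIV (dmono m \<rho> \<gamma>) = m"
  by (simp add: dmono_def wt_sum)

lemma poly_carrier_single: "keys m \<subseteq> {..<r} \<times> {..<s} \<Longrightarrow> single m c \<in> poly_carrier r s"
  by (auto simp: poly_carrier_def)

lemma cmono_split:
  assumes "C \<subseteq> keys m"
  obtains e where "m = e + cmono C"
proof -
  have "finite C"
    using assms by (meson finite_keys finite_subset)
  have "m = (m - cmono C) + cmono C"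
  proof (rule poly_mapping_eqI)
    fix v
    have "lookup (cmono C) v \<le> lookup m v"
      using assms \<open>finite C\<close> by (auto simp: lookup_cmono in_keys_iff Suc_le_eq)
    then show "lookup m v = lookup (m - cmono C + cmono C) v"
      by (simp add: lookup_add lookup_minus)
  qed
  then show ?thesis
    using that by blast
qed

lemma keys_add_nat: "keys (a + b :: 'v \<Rightarrow>\<^sub>0 nat) = keys a \<union> keys b"
  by (auto simp: in_keys_iff lookup_add)

lemma keys_diff_subset: "keys (f - g :: 'a \<Rightarrow>\<^sub>0 'b::ab_group_add) \<subseteq> keys f \<union> keys g"
  by (auto simp: in_keys_iff lookup_minus)

text \<open>For \<open>M\<close> closed under multiplication by monomials in the given variables
  this is the monomial ideal spanned by \<open>M\<close>.\<close>

definition polys_over :: "nat \<Rightarrow> nat \<Rightarrow> monomial set \<Rightarrow> 'k::field mpoly set" where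
  "polys_over r s M = {f \<in> poly_carrier r s. keys f \<subseteq> M}"

text \<open>The leading monomials of an ideal are closed under multiplication by monomials, so the
  ideal they generate is their linear span. Comparing initial ideals becomes comparing sets of
  monomials.\<close>

lemma initial_ideal_eq:
  fixes I :: "'k::field mpoly set"
  assumes I: "ideal I (ring_on (poly_carrier r s))"
  shows "initial_ideal r s I = polys_over r s {lead f |f. f \<in> I \<and> f \<noteq> 0}"
    (is "_ = polys_over r s ?L")
proof -
  interpret cring_on "poly_carrier r s :: 'k mpoly set"
    by (intro cring_on.intro cring_poly_carrier)
  let ?G = "{initial_monomial f |f. f \<in> I \<and> f \<noteq> 0}"
  have keysL: "keys (lead f) \<subseteq> {..<r} \<times> {..<s}" if "f \<in> I" "f \<noteq> 0" for f
    using ideal_subset[OF I] that lead_in_keys[of f] by (auto simp: poly_carrier_def)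
  have G: "?G \<subseteq> poly_carrier r s"
    using keysL by (auto simp: initial_monomial_lead intro!: poly_carrier_single)
  have up: "a + lead f \<in> ?L" if "f \<in> I" "f \<noteq> 0" "keys a \<subseteq> {..<r} \<times> {..<s}" for a f
  proof -
    have "single a 1 * f \<in> I"
      using that by (intro ideal_mult[OF I] poly_carrier_single)
    moreover have "single a (1 :: 'k) \<noteq> 0"
      by (metis lookup_single_eq lookup_zero zero_neq_one)
    moreover have "lead (single a (1 :: 'k)) = a"
      by (simp add: lead_def)
    ultimately show ?thesis
      using lead_mult[of "single a 1" f] that(2) by (metis (mono_tags, lifting) mem_Collect_eq mult_eq_0_iff)
  qed
  have "ideal (polys_over r s ?L :: 'k mpoly set) (ring_on (poly_carrier r s))"
  proof (rule ideal_onI)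
    show "f + g \<in> polys_over r s ?L" if "f \<in> polys_over r s ?L" "g \<in> polys_over r s ?L" for f g :: "'k mpoly"
      using that Poly_Mapping.keys_add[of f g] add_mem[of f g] unfolding polys_over_def by blast
    show "a * f \<in> polys_over r s ?L" if a: "a \<in> poly_carrier r s" and f: "f \<in> polys_over r s ?L" for a f :: "'k mpoly"
    proof -
      have "keys (a * f) \<subseteq> ?L"
      proof
        fix m assume "m \<in> keys (a * f)"
        then obtain b c where m: "m = b + c" "b \<in> keys a" "c \<in> keys f"
          using keys_mult[of a f] by blast
        then obtain g where "c = lead g" "g \<in> I" "g \<noteq> 0"
          using f unfolding polys_over_def by blast
        then show "m \<in> ?L"
          using up[of g b] m a unfolding poly_carrier_def by blast
      qed
      then show ?thesis
        using a f mult_mem[of a f] by (simp add: polys_over_def)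
    qed
  qed (auto simp: polys_over_def zero_mem)
  moreover have "?G \<subseteq> polys_over r s ?L"
    using G by (auto simp: polys_over_def initial_monomial_lead)
  ultimately have "initial_ideal r s I \<subseteq> polys_over r s ?L"
    unfolding initial_ideal_def by (intro genideal_least[OF G])
  moreover have "polys_over r s ?L \<subseteq> initial_ideal r s I"
  proof
    fix f :: "'k mpoly" assume f: "f \<in> polys_over r s ?L"
    have "single m (lookup f m) \<in> initial_ideal r s I" if m: "m \<in> keys f" for m
    proof -
      obtain g where "m = lead g" "g \<in> I" "g \<noteq> 0"
        using f m unfolding polys_over_def by blast
      then have "single m 1 \<in> ?G"
        by (auto simp: initial_monomial_lead)
      then have "single 0 (lookup f m) * single m 1 \<in> initial_ideal r s I"
        unfolding initial_ideal_def using genideal_superset[OF G]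
        by (intro ideal_mult[OF genideal_is_ideal[OF G]] poly_carrier_single) auto
      then show ?thesis
        by (simp add: mult_single)
    qed
    then have "(\<Sum>m\<in>keys f. single m (lookup f m)) \<in> initial_ideal r s I"
      unfolding initial_ideal_def by (intro ideal_sum[OF genideal_is_ideal[OF G]])
    then show "f \<in> initial_ideal r s I"
      by (simp flip: poly_mapping_sum_single)
  qed
  ultimately show ?thesis
    by blast
qed

section \<open>The determinantal ideal as a kernel, and its leading monomials\<close>

locale generic_determinants =
  fixes r s t :: nat and ty :: "'k::field_char_0 itself"
  assumes t_pos: "1 \<le> t"
begin

abbreviation V :: "(nat \<times> nat) set" where
  "V \<equiv> {..<r} \<times> {..<s}"

abbreviation A :: "'k mpoly set" where
  "A \<equiv> poly_carrier r s"

abbreviation I :: "'k mpoly set" where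
  "I \<equiv> determinantal_ideal r s t"

abbreviation \<phi> :: "'k mpoly \<Rightarrow> (bool \<times> nat \<times> nat \<Rightarrow>\<^sub>0 nat) \<Rightarrow>\<^sub>0 'k" where
  "\<phi> \<equiv> subst_vars (rank_var (t - 1))"

sublocale idom_on A
  by (intro idom_on.intro cring_on.intro cring_poly_carrier)

lemma minors_subset: "minors t (generic_matrix r s) \<subseteq> A"
proof
  fix f :: "'k mpoly" assume "f \<in> minors t (generic_matrix r s)"
  then show "f \<in> A"
    by (rule minors_eq_gminor) (simp add: gminor_in_carrier)
qed

lemma I_ideal: "ideal I (ring_on A)"
  unfolding determinantal_ideal_def by (rule genideal_is_ideal[OF minors_subset])

lemma minors_subset_I: "minors t (generic_matrix r s) \<subseteq> I"
  unfolding determinantal_ideal_def by (rule genideal_superset[OF minors_subset])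

lemma kernel_ideal: "ideal {f \<in> A. \<phi> f = 0} (ring_on A)"
  by (rule ideal_onI) (auto simp: zero_mem add_mem mult_mem subst_vars_add subst_vars_mult)

lemma I_subset_kernel: "I \<subseteq> {f \<in> A. \<phi> f = 0}"
  unfolding determinantal_ideal_def
proof (rule genideal_least[OF minors_subset kernel_ideal], intro subsetI)
  fix f :: "'k mpoly" assume f: "f \<in> minors t (generic_matrix r s)"
  then obtain \<rho> \<gamma> where "f = gminor t \<rho> \<gamma>"
    using minors_eq_gminor by metis
  then show "f \<in> {f \<in> A. \<phi> f = 0}"
    using f minors_subset subst_rank_var_gminor[OF t_pos] by auto
qed

lemma lead_kernel_has_chain: "\<phi> f = 0 \<Longrightarrow> f \<noteq> 0 \<Longrightarrow> has_chain t (keys (lead f))"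
  using subst_rank_var_nonzero by blast

text \<open>Together with \<open>lead_gminor\<close> this realizes every chain in \<open>V\<close>
  as the leading monomial of a minor.\<close>

lemma chain_gminor:
  assumes "finite C" "diag_chain C" "C \<subseteq> V" "card C = m"
  obtains \<rho> \<gamma> where "incr m \<rho>" "incr m \<gamma>" "\<And>i. i < m \<Longrightarrow> \<rho> i < r" "\<And>i. i < m \<Longrightarrow> \<gamma> i < s"
    "dmono m \<rho> \<gamma> = cmono C"
proof -
  obtain \<rho> \<gamma> where *: "incr m \<rho>" "incr m \<gamma>" "C = (\<lambda>i. (\<rho> i, \<gamma> i)) ` {..<m}" "dmono m \<rho> \<gamma> = cmono C"
    using diag_chain_enum[OF assms(1,2)] assms(4) by metis
  then have "(\<rho> i, \<gamma> i) \<in> V" if "i < m" for i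
    using assms(3) that by blast
  with that * show ?thesis
    by auto
qed

text \<open>All monomials of a minor have the same degree, so division by minors keeps degrees bounded and stops.\<close>

lemma kernel_subset_I:
  assumes "f \<in> A" "\<phi> f = 0"
  shows "f \<in> I"
proof -
  have "f \<in> I" if "f \<in> A" "\<phi> f = 0" "\<And>m. m \<in> keys f \<Longrightarrow> wt UNIV m \<le> d" for d f
    using that
  proof (induction "card {m. keys m \<subseteq> V \<and> wt UNIV m \<le> d \<and> m < lead f}" arbitrary: f rule: less_induct)
    case less
    show ?case
    proof (cases "f = 0")
      case True
      then show ?thesis
        using ideal_zero[OF I_ideal] by simp
    next
      case False
      define a where "a = lead f"
      have a: "a \<in> keys f"
        using lead_in_keys[OF False] by (simp add: a_def)
      then have aV: "keys a \<subseteq> V" and ad: "wt UNIV a \<le> d"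
        using less.prems by (auto simp: poly_carrier_def)
      obtain C where C: "C \<subseteq> keys a" "finite C" "diag_chain C" "card C = t"
        using lead_kernel_has_chain[OF less.prems(2) False] unfolding has_chain_def a_def by blast
      obtain e where e: "a = e + cmono C"
        using cmono_split[OF C(1)] by blast
      obtain \<rho> \<gamma> where g: "incr t \<rho>" "incr t \<gamma>" "\<And>i. i < t \<Longrightarrow> \<rho> i < r" "\<And>i. i < t \<Longrightarrow> \<gamma> i < s"
        "dmono t \<rho> \<gamma> = cmono C"
        using chain_gminor[OF C(2,3) _ C(4)] C(1) aV by blast
      \<comment> \<open>A multiple of the minor with diagonal \<open>C\<close> that has the same
        leading term as \<open>f\<close>.\<close>
      define h :: "'k mpoly" where "h = single e (lookup f a) * gminor t \<rho> \<gamma>"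
      have hI: "h \<in> I"
        unfolding h_def
      proof (rule ideal_mult[OF I_ideal])
        show "single e (lookup f a) \<in> A"
          using aV e by (intro poly_carrier_single) (auto simp: keys_add_nat)
        show "gminor t \<rho> \<gamma> \<in> I"
          using gminor_in_minors[OF g(1-4)] minors_subset_I by blast
      qed
      have h_keys: "m \<le> a \<and> wt UNIV m = wt UNIV a" if "m \<in> keys h" for m
      proof -
        from that obtain b where b: "m = e + b" "b \<in> keys (gminor t \<rho> \<gamma> :: 'k mpoly)"
          using keys_mult[of "single e (lookup f a)" "gminor t \<rho> \<gamma> :: 'k mpoly"] unfolding h_def
          by (auto split: if_splits)
        then obtain p where "b = dmono t \<rho> (\<gamma> \<circ> p)"
          using keys_gminor_subset by blast
        then have "wt UNIV b = wt UNIV (cmono C)"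
          by (simp only: wt_UNIV_dmono flip: g(5))
        moreover have "b \<le> cmono C"
          using lead_ge[OF b(2)] lead_gminor[OF g(1,2), where 'k = 'k] g(5) by simp
        ultimately show ?thesis
          by (simp add: b(1) e wt_add)
      qed
      have h_coeff: "lookup h a = lookup f a"
        unfolding h_def e lookup_single_mult g(5)[symmetric] lookup_gminor_diagonal[OF g(1,2)] by simp
      have "f - h \<in> I"
      proof (cases "f - h = 0")
        case True
        then show ?thesis
          using ideal_zero[OF I_ideal] by simp
      next
        case ne: False
        have sub: "keys (f - h) \<subseteq> keys f \<union> keys h"
          by (rule keys_diff_subset)
        have "lead (f - h) \<in> keys f \<union> keys h"
          using lead_in_keys[OF ne] sub by blast
        then have "lead (f - h) \<le> a" "wt UNIV (lead (f - h)) \<le> d"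
          using h_keys lead_ge[of _ f] less.prems(3) ad by (auto simp: a_def)
        moreover have "lead (f - h) \<noteq> a"
          using lead_in_keys[OF ne] h_coeff by (auto simp: in_keys_iff lookup_minus)
        ultimately have lt: "lead (f - h) < a"
          by simp
        have hA: "f - h \<in> A"
          using less.prems(1) hI ideal_subset[OF I_ideal] add_mem uminus_mem by (metis diff_conv_add_uminus subsetD)
        \<comment> \<open>The new leading monomial belongs to the old set but not to the new one, so
          the measure drops strictly.\<close>
        have "lead (f - h) \<in> {m. keys m \<subseteq> V \<and> wt UNIV m \<le> d \<and> m < a}"
          using lt lead_in_keys[OF ne] hA \<open>wt UNIV (lead (f - h)) \<le> d\<close> by (auto simp: poly_carrier_def)
        then have "{m. keys m \<subseteq> V \<and> wt UNIV m \<le> d \<and> m < lead (f - h)} \<subset> {m. keys m \<subseteq> V \<and> wt UNIV m \<le> d \<and> m < a}"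
          using lt by auto
        moreover have "finite {m. keys m \<subseteq> V \<and> wt UNIV m \<le> d \<and> m < a}"
          by (rule finite_subset[OF _ finite_monomials_bounded[of V d]]) auto
        ultimately have card: "card {m. keys m \<subseteq> V \<and> wt UNIV m \<le> d \<and> m < lead (f - h)}
            < card {m. keys m \<subseteq> V \<and> wt UNIV m \<le> d \<and> m < lead f}"
          unfolding a_def by (intro psubset_card_mono)
        show ?thesis
        proof (rule less.hyps[OF card hA])
          show "\<phi> (f - h) = 0"
            using less.prems(2) hI I_subset_kernel by (auto simp: subst_vars_diff)
          show "wt UNIV m \<le> d" if "m \<in> keys (f - h)" for m
            using that sub h_keys ad less.prems(3) by auto
        qed
      qed
      then have "(f - h) + h \<in> I"
        using hI by (intro ideal_add[OF I_ideal])
      then show ?thesis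
        by simp
    qed
  qed
  from this[OF assms, of "Max (wt UNIV ` keys f)"] show ?thesis
    by simp
qed

lemma I_eq_kernel: "I = {f \<in> A. \<phi> f = 0}"
  using I_subset_kernel kernel_subset_I by blast

lemma I_prime: "primeideal I (ring_on A)"
  unfolding primeideal_on_iff using I_ideal
  by (auto simp: I_eq_kernel subst_vars_mult)

lemma lead_I: "{lead f |f. f \<in> I \<and> f \<noteq> 0} = {m. keys m \<subseteq> V \<and> has_chain t (keys m)}"
proof (intro equalityI subsetI)
  fix m :: monomial assume "m \<in> {lead f |f. f \<in> I \<and> f \<noteq> 0}"
  then show "m \<in> {m. keys m \<subseteq> V \<and> has_chain t (keys m)}"
    using lead_kernel_has_chain lead_in_keys by (auto simp: I_eq_kernel poly_carrier_def)
next
  fix m :: monomial assume "m \<in> {m. keys m \<subseteq> V \<and> has_chain t (keys m)}"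
  then obtain C where mV: "keys m \<subseteq> V" and C: "C \<subseteq> keys m" "finite C" "diag_chain C" "card C = t"
    unfolding has_chain_def by blast
  obtain e where e: "m = e + cmono C"
    using cmono_split[OF C(1)] by blast
  obtain \<rho> \<gamma> where g: "incr t \<rho>" "incr t \<gamma>" "\<And>i. i < t \<Longrightarrow> \<rho> i < r" "\<And>i. i < t \<Longrightarrow> \<gamma> i < s"
    "dmono t \<rho> \<gamma> = cmono C"
    using chain_gminor[OF C(2,3) _ C(4)] C(1) mV by blast
  define f :: "'k mpoly" where "f = single e 1 * gminor t \<rho> \<gamma>"
  have ne: "single e (1 :: 'k) \<noteq> 0"
    by (metis lookup_single_eq lookup_zero zero_neq_one)
  have "f \<in> I"
    unfolding f_def
  proof (rule ideal_mult[OF I_ideal])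
    show "single e 1 \<in> A"
      using mV e by (intro poly_carrier_single) (auto simp: keys_add_nat)
    show "gminor t \<rho> \<gamma> \<in> I"
      using gminor_in_minors[OF g(1-4)] minors_subset_I by blast
  qed
  moreover have "f \<noteq> 0"
    unfolding f_def using ne gminor_nonzero[OF g(1,2)] by simp
  moreover have "lead f = m"
    unfolding f_def using lead_mult[OF ne gminor_nonzero[OF g(1,2)]] lead_gminor[OF g(1,2), where 'k = 'k] e g(5)
    by (simp add: lead_def)
  ultimately show "m \<in> {lead f |f. f \<in> I \<and> f \<noteq> 0}"
    by blast
qed

lemma initial_ideal_I: "initial_ideal r s I = polys_over r s {m. has_chain t (keys m)}"
  unfolding initial_ideal_eq[OF I_ideal] lead_I by (auto simp: polys_over_def poly_carrier_def)

text \<open>The leading monomial has at most \<open>t - 1\<close> variables, too few for a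
  \<open>t\<close>-chain. Powers of such a minor are the multipliers outside \<open>I\<close> that
  put larger minors into symbolic powers.\<close>

lemma gminor_notin_I:
  assumes "incr (t - 1) \<rho>" "incr (t - 1) \<gamma>"
  shows "gminor (t - 1) \<rho> \<gamma> \<notin> I"
proof
  assume "gminor (t - 1) \<rho> \<gamma> \<in> I"
  then have "has_chain t (keys (lead (gminor (t - 1) \<rho> \<gamma> :: 'k mpoly)))"
    using gminor_nonzero[OF assms] by (intro lead_kernel_has_chain) (auto simp: I_eq_kernel)
  then obtain C where "C \<subseteq> keys (dmono (t - 1) \<rho> \<gamma>)" "card C = t"
    unfolding lead_gminor[OF assms] has_chain_def by blast
  then have "t \<le> card ((\<lambda>i. (\<rho> i, \<gamma> i)) ` {..<t - 1})"
    unfolding keys_dmono by (metis card_mono finite_imageI finite_lessThan)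
  also have "\<dots> \<le> t - 1"
    using card_image_le[of "{..<t - 1}"] by simp
  finally show False
    using t_pos by simp
qed

end

section \<open>Weights of polynomials\<close>

text \<open>Weight on \<open>F\<close> is a grading. In the parts of least weight of
  \<open>g\<close> and \<open>f\<close>, of weights 0 and \<open>w\<close>, the greatest monomials
  \<open>a\<close> and \<open>b\<close> have a product that arises in one way only, so
  \<open>w\<close> occurs as a weight in \<open>g * f\<close>. In this way multipliers outside a
  prime generated by variables are cancelled.\<close>

lemma weight_cancel:
  fixes f g :: "'k::field mpoly"
  assumes g: "\<exists>m\<in>keys g. wt F m = 0" and gf: "\<And>m. m \<in> keys (g * f) \<Longrightarrow> n \<le> wt F m" and m: "m \<in> keys f"
  shows "n \<le> wt F m"
proof -
  define w where "w = Min (wt F ` keys f)"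
  define a where "a = Max {m \<in> keys g. wt F m = 0}"
  define b where "b = Max {m \<in> keys f. wt F m = w}"
  have w_le: "w \<le> wt F c" if "c \<in> keys f" for c
    unfolding w_def using that by auto
  have a: "a \<in> {m \<in> keys g. wt F m = 0}"
    unfolding a_def using g by (intro Max_in) auto
  have "w \<in> wt F ` keys f"
    unfolding w_def using m by (intro Min_in) auto
  then have b: "b \<in> {m \<in> keys f. wt F m = w}"
    unfolding b_def by (intro Max_in) auto
  have "lookup (g * f) (a + b) = lookup g a * lookup f b"
  proof (rule lookup_mult_unique)
    fix c d assume cd: "c \<in> keys g" "d \<in> keys f" "c + d = a + b"
    have "wt F c + wt F d = wt F a + wt F b"
      by (simp only: cd(3) flip: wt_add)
    then have "wt F c = 0" "wt F d = w"
      using w_le[OF cd(2)] a b by auto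
    then have "c \<le> a" "d \<le> b"
      using cd by (auto simp: a_def b_def)
    then show "c = a \<and> d = b"
      using add_le_add_eq cd(3) by blast
  qed
  then have "a + b \<in> keys (g * f)"
    using a b by (simp add: in_keys_iff)
  from gf[OF this] have "n \<le> w"
    using a b by (simp add: wt_add)
  then show ?thesis
    using w_le[OF m] by simp
qed

section \<open>Minimal primes and symbolic powers of the initial ideal\<close>

context generic_determinants
begin

abbreviation J :: "'k mpoly set" where
  "J \<equiv> initial_ideal r s I"

text \<open>The vertex covers of the hypergraph on \<open>V\<close> whose edges are the
  \<open>t\<close>-chains.\<close>

definition cover :: "(nat \<times> nat) set \<Rightarrow> bool" where
  "cover F \<longleftrightarrow> F \<subseteq> V \<and> \<not> has_chain t (V - F)"

definition min_cover :: "(nat \<times> nat) set \<Rightarrow> bool" where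
  "min_cover F \<longleftrightarrow> cover F \<and> (\<forall>F'\<subset>F. \<not> cover F')"

text \<open>For \<open>F\<close> inside \<open>V\<close> this is the prime ideal generated by the
  variables in \<open>F\<close>, in a form that makes it the first of the ideals given by a weight
  bound.\<close>

definition var_prime :: "(nat \<times> nat) set \<Rightarrow> 'k mpoly set" where
  "var_prime F = polys_over r s {m. 1 \<le> wt F m}"

lemma V_finite: "finite V"
  by simp

lemma cover_finite: "cover F \<Longrightarrow> finite F"
  unfolding cover_def using V_finite finite_subset by blast

lemma has_min_cover:
  assumes "cover F"
  shows "\<exists>F'\<subseteq>F. min_cover F'"
  using assms
proof (induction "card F" arbitrary: F rule: less_induct)
  case less
  show ?case
  proof (cases "min_cover F")
    case False
    then obtain F' where F': "F' \<subset> F" "cover F'"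
      using less.prems unfolding min_cover_def by blast
    have "card F' < card F"
      using F'(1) cover_finite[OF less.prems] by (intro psubset_card_mono)
    from less.hyps[OF this F'(2)] F'(1) show ?thesis
      by blast
  qed blast
qed

lemma cover_V: "cover V"
  using t_pos by (auto simp: cover_def has_chain_def)

lemma weight_ideal: "ideal (polys_over r s {m. n \<le> wt F m} :: 'k mpoly set) (ring_on A)"
proof (rule ideal_onI)
  show "f + g \<in> polys_over r s {m. n \<le> wt F m}"
    if "f \<in> polys_over r s {m. n \<le> wt F m}" "g \<in> polys_over r s {m. n \<le> wt F m}" for f g :: "'k mpoly"
    using that Poly_Mapping.keys_add[of f g] add_mem[of f g] unfolding polys_over_def by blast
  show "a * f \<in> polys_over r s {m. n \<le> wt F m}" if "a \<in> A" "f \<in> polys_over r s {m. n \<le> wt F m}" for a f :: "'k mpoly"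
  proof -
    have "n \<le> wt F m" if "m \<in> keys (a * f)" for m
    proof -
      from that obtain b c where "m = b + c" "c \<in> keys f"
        using keys_mult[of a f] by blast
      then show ?thesis
        using \<open>f \<in> _\<close> by (auto simp: polys_over_def wt_add trans_le_add2)
    qed
    then show ?thesis
      using that mult_mem[of a f] by (auto simp: polys_over_def)
  qed
qed (auto simp: polys_over_def zero_mem)

lemma weight_cancel_polys:
  assumes "g \<in> A" "g \<notin> var_prime F" "f \<in> A" "g * f \<in> polys_over r s {m. n \<le> wt F m}"
  shows "f \<in> polys_over r s {m. n \<le> wt F m}"
proof -
  have "\<exists>m\<in>keys g. wt F m = 0"
    using assms(1,2) by (auto simp: var_prime_def polys_over_def Suc_le_eq)
  then have "n \<le> wt F m" if "m \<in> keys f" for m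
    using that assms(4) by (intro weight_cancel[of g F f n m]) (auto simp: polys_over_def)
  then show ?thesis
    using assms(3) by (auto simp: polys_over_def)
qed

text \<open>Primality is the case \<open>n = 1\<close> of cancelling a multiplier.\<close>

lemma var_prime_primeideal: "primeideal (var_prime F) (ring_on A)"
  unfolding primeideal_on_iff
proof (intro conjI ballI impI)
  show "ideal (var_prime F) (ring_on A)"
    unfolding var_prime_def by (rule weight_ideal)
  show "1 \<notin> var_prime F"
    by (simp add: var_prime_def polys_over_def)
  show "a \<in> var_prime F \<or> b \<in> var_prime F" if "a \<in> A" "b \<in> A" "a * b \<in> var_prime F" for a b
    using weight_cancel_polys[of a F b 1] that by (auto simp: var_prime_def)
qed

lemma lead_in_V: "f \<in> A \<Longrightarrow> f \<noteq> 0 \<Longrightarrow> keys (lead f) \<subseteq> V"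
  using lead_in_keys[of f] by (auto simp: poly_carrier_def)

lemma J_ideal: "ideal J (ring_on A)"
proof -
  have "{initial_monomial f |f. f \<in> I \<and> f \<noteq> 0} \<subseteq> A"
    using lead_in_V ideal_subset[OF I_ideal] by (auto simp: initial_monomial_lead intro!: poly_carrier_single)
  then show ?thesis
    unfolding initial_ideal_def by (rule genideal_is_ideal)
qed

lemma single_in_J: "keys m \<subseteq> V \<Longrightarrow> has_chain t (keys m) \<Longrightarrow> single m c \<in> J"
  by (auto simp: initial_ideal_I polys_over_def poly_carrier_single)

lemma cover_meets_chain:
  assumes "cover F" "has_chain t G" "G \<subseteq> V"
  shows "G \<inter> F \<noteq> {}"
proof
  assume "G \<inter> F = {}"
  then have "G \<subseteq> V - F"
    using assms(3) by blast
  then show False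
    using assms(1) has_chain_mono[OF assms(2)] by (simp add: cover_def)
qed

lemma J_subset_var_prime: "cover F \<Longrightarrow> J \<subseteq> var_prime F"
proof
  fix f assume F: "cover F" and f: "f \<in> J"
  have "1 \<le> wt F m" if m: "m \<in> keys f" for m
  proof -
    have "has_chain t (keys m)" "keys m \<subseteq> V"
      using f m by (auto simp: initial_ideal_I polys_over_def poly_carrier_def)
    then have "wt F m \<noteq> 0"
      using cover_meets_chain[OF F] by (simp add: wt_eq_0_iff)
    then show ?thesis
      by simp
  qed
  then show "f \<in> var_prime F"
    using f by (auto simp: initial_ideal_I var_prime_def polys_over_def)
qed

lemma single_sum_prod: "single (\<Sum>x\<in>S. g x) (1 :: 'k) = (\<Prod>x\<in>S. single (g x) 1)"
  by (simp add: prod_single_one)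

text \<open>For every \<open>t\<close>-chain, \<open>Q\<close> contains the product of its variables
  and hence, being prime, one of them.\<close>

lemma prime_over_J:
  assumes Q: "primeideal Q (ring_on A)" "J \<subseteq> Q"
  defines "F \<equiv> {v \<in> V. var v \<in> Q}"
  shows "cover F" "var_prime F \<subseteq> Q"
proof -
  have QI: "ideal Q (ring_on A)" and Q1: "1 \<notin> Q"
    and Qp: "\<And>a b. a \<in> A \<Longrightarrow> b \<in> A \<Longrightarrow> a * b \<in> Q \<Longrightarrow> a \<in> Q \<or> b \<in> Q"
    using Q(1) unfolding primeideal_on_iff by blast+
  have prod: "\<exists>x\<in>S. f x \<in> Q" if "finite S" "\<And>x. x \<in> S \<Longrightarrow> f x \<in> A" "prod f S \<in> Q" for S :: "(nat \<times> nat) set" and f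
    using that
  proof (induction S rule: finite_induct)
    case (insert x S)
    then have "f x \<in> Q \<or> prod f S \<in> Q"
      using prod_mem[of S f] by (intro Qp) auto
    with insert show ?case
      by auto
  qed (use Q1 in auto)
  have varA: "var v \<in> A" if "v \<in> V" for v
    unfolding var_def using that by (intro poly_carrier_single) auto
  show "cover F"
    unfolding cover_def
  proof
    show "F \<subseteq> V"
      by (auto simp: F_def)
    show "\<not> has_chain t (V - F)"
    proof
      assume "has_chain t (V - F)"
      then obtain C where C: "C \<subseteq> V - F" "finite C" "diag_chain C" "card C = t"
        unfolding has_chain_def by blast
      have "single (cmono C) 1 \<in> J"
        using C by (intro single_in_J) (auto simp: keys_cmono has_chain_def)
      then have "(\<Prod>v\<in>C. var v) \<in> Q"
        using Q(2) unfolding cmono_def single_sum_prod var_def by blast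
      then obtain v where "v \<in> C" "var v \<in> Q"
        using prod[OF C(2), of var] varA C(1) by blast
      then show False
        using C(1) by (auto simp: F_def)
    qed
  qed
  show "var_prime F \<subseteq> Q"
  proof
    fix f assume f: "f \<in> var_prime F"
    have "single m (lookup f m) \<in> Q" if m: "m \<in> keys f" for m
    proof -
      have "wt F m \<noteq> 0" and mV: "keys m \<subseteq> V"
        using f m by (auto simp: var_prime_def polys_over_def poly_carrier_def)
      then obtain v where v: "v \<in> keys m" "v \<in> F"
        by (auto simp: wt_eq_0_iff)
      obtain e where e: "m = e + cmono {v}"
        using cmono_split[of "{v}" m] v(1) by auto
      have "single m (lookup f m) = single e (lookup f m) * var v"
        by (simp add: e var_def mult_single cmono_def)
      moreover have "single e (lookup f m) \<in> A"
        using mV by (intro poly_carrier_single) (simp add: e keys_add_nat)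
      ultimately show ?thesis
        using ideal_mult[OF QI, of "single e (lookup f m)" "var v"] v(2) by (simp add: F_def)
    qed
    then have "(\<Sum>m\<in>keys f. single m (lookup f m)) \<in> Q"
      by (intro ideal_sum[OF QI])
    then show "f \<in> Q"
      by (simp flip: poly_mapping_sum_single)
  qed
qed

lemma var_in_var_prime_iff: "v \<in> V \<Longrightarrow> var v \<in> var_prime F \<longleftrightarrow> v \<in> F"
  by (auto simp: var_prime_def polys_over_def var_def poly_carrier_single)

text \<open>By \<open>prime_over_J\<close> every prime over \<open>J\<close> contains
  \<open>var_prime F\<close> for some cover \<open>F\<close>, and a subset \<open>F\<close> of
  \<open>V\<close> can be read off from the variables in \<open>var_prime F\<close>. Minimality of
  primes thus becomes minimality of covers.\<close>

lemma minimal_primes_J: "minimal_primes (ring_on A) J = var_prime ` {F. min_cover F}"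
proof (intro equalityI subsetI)
  fix P assume "P \<in> minimal_primes (ring_on A) J"
  then have P: "primeideal P (ring_on A)" "J \<subseteq> P"
    and min: "\<And>Q. primeideal Q (ring_on A) \<Longrightarrow> J \<subseteq> Q \<Longrightarrow> Q \<subseteq> P \<Longrightarrow> Q = P"
    unfolding minimal_primes_def by blast+
  define F where "F = {v \<in> V. var v \<in> P}"
  have F: "cover F" "var_prime F \<subseteq> P"
    using prime_over_J[OF P] by (simp_all add: F_def)
  obtain F' where F': "F' \<subseteq> F" "min_cover F'"
    using has_min_cover[OF F(1)] by blast
  then have c: "cover F'"
    by (simp add: min_cover_def)
  have "wt F' m \<le> wt F m" for m
    unfolding wt_def using F'(1) by (intro sum_mono2) auto
  then have "var_prime F' \<subseteq> var_prime F"
    unfolding var_prime_def polys_over_def using order_trans by blast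
  then have "var_prime F' = P"
    using F(2) by (intro min var_prime_primeideal J_subset_var_prime[OF c]) blast
  then show "P \<in> var_prime ` {F. min_cover F}"
    using F'(2) by blast
next
  fix P assume "P \<in> var_prime ` {F. min_cover F}"
  then obtain F where F: "P = var_prime F" "min_cover F"
    by blast
  then have c: "cover F"
    by (simp add: min_cover_def)
  have "Q = P" if Q: "primeideal Q (ring_on A)" "J \<subseteq> Q" "Q \<subseteq> P" for Q
  proof -
    have F': "cover {v \<in> V. var v \<in> Q}" "var_prime {v \<in> V. var v \<in> Q} \<subseteq> Q"
      using prime_over_J[OF Q(1,2)] by simp_all
    have "{v \<in> V. var v \<in> Q} \<subseteq> F"
      using Q(3) var_in_var_prime_iff unfolding F(1) by blast
    then have "{v \<in> V. var v \<in> Q} = F"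
      using F(2) F'(1) unfolding min_cover_def by blast
    then show ?thesis
      using F'(2) Q(3) F(1) by simp
  qed
  then show "P \<in> minimal_primes (ring_on A) J"
    unfolding minimal_primes_def using F(1) var_prime_primeideal[of F] J_subset_var_prime[OF c] by blast
qed

lemma minimal_primes_J_nonempty: "minimal_primes (ring_on A) J \<noteq> {}"
  unfolding minimal_primes_J using has_min_cover[OF cover_V] by blast

text \<open>Every monomial of an element of \<open>J\<close> contains a \<open>t\<close>-chain and
  so meets \<open>F\<close>; weight is additive over the \<open>n\<close> factors.\<close>

lemma ipow_J_weight:
  assumes "cover F"
  shows "ipow J n \<subseteq> polys_over r s {m. n \<le> wt F m}"
proof (induction n)
  case 0
  show ?case
    unfolding ipow_0 by (auto simp: polys_over_def)
next
  case (Suc n)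
  show ?case
  proof
    fix f assume "f \<in> ipow J (Suc n)"
    then show "f \<in> polys_over r s {m. Suc n \<le> wt F m}"
    proof (induction rule: ipow_Suc_induct)
      case (mult a b)
      then have a: "a \<in> polys_over r s {m. n \<le> wt F m}" and b: "b \<in> polys_over r s {m. 1 \<le> wt F m}"
        using Suc J_subset_var_prime[OF assms] by (auto simp: var_prime_def)
      have "Suc n \<le> wt F m" if "m \<in> keys (a * b)" for m
      proof -
        from that obtain c d where "m = c + d" "c \<in> keys a" "d \<in> keys b"
          using keys_mult[of a b] by blast
        moreover from this have "n \<le> wt F c" "1 \<le> wt F d"
          using a b by (auto simp: polys_over_def)
        ultimately show ?thesis
          by (simp add: wt_add)
      qed
      then show ?case
        using a b mult_mem[of a b] by (auto simp: polys_over_def)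
    next
      case (add a b)
      then show ?case
        by (rule ideal_add[OF weight_ideal])
    qed
  qed
qed

text \<open>Localizing at the prime of a minimal cover \<open>F\<close>: each \<open>v \<in> F\<close> lies on a chain meeting \<open>F\<close> in \<open>v\<close> only.\<close>

lemma min_cover_multiplier:
  assumes F: "min_cover F" and m: "keys m \<subseteq> V" "n \<le> wt F m"
  shows "\<exists>u. keys u \<subseteq> V \<and> wt F u = 0 \<and> single (u + m) 1 \<in> ipow J n"
proof -
  have c: "cover F"
    using F by (simp add: min_cover_def)
  have "\<exists>C. C \<subseteq> V \<and> finite C \<and> diag_chain C \<and> card C = t \<and> C \<inter> F = {v}" if v: "v \<in> F" for v
  proof -
    have "F - {v} \<subset> F"
      using v by blast
    then have "\<not> cover (F - {v})"
      using F unfolding min_cover_def by blast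
    moreover have "F \<subseteq> V"
      using c by (simp add: cover_def)
    ultimately have "has_chain t (V - (F - {v}))"
      unfolding cover_def by blast
    then obtain C where C: "C \<subseteq> V - (F - {v})" "finite C" "diag_chain C" "card C = t"
      unfolding has_chain_def by blast
    have "C \<inter> F \<noteq> {}"
      using C by (intro cover_meets_chain[OF c]) (auto simp: has_chain_def)
    then have "C \<inter> F = {v}"
      using C(1) by blast
    with C show ?thesis
      by blast
  qed
  then obtain C where C: "\<And>v. v \<in> F \<Longrightarrow> C v \<subseteq> V \<and> finite (C v) \<and> diag_chain (C v) \<and> card (C v) = t \<and> C v \<inter> F = {v}"
    by metis
  \<comment> \<open>Each copy of a variable \<open>v\<close> in \<open>F\<close> is completed to the
    monomial of its chain \<open>C v\<close>. The completing variables avoid \<open>F\<close>, so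
    \<open>u\<close> has weight 0, and \<open>u + m\<close> splits off \<open>wt F m\<close> chain
    monomials.\<close>
  define u where "u = (\<Sum>v\<in>F. \<Sum>_<lookup m v. cmono (C v - {v}))"
  have u: "keys u \<subseteq> V - F"
  proof
    fix x assume "x \<in> keys u"
    then have "(\<Sum>v\<in>F. \<Sum>_<lookup m v. lookup (cmono (C v - {v})) x) \<noteq> 0"
      by (simp add: u_def in_keys_iff lookup_sum)
    then obtain v where "v \<in> F" "lookup (cmono (C v - {v})) x \<noteq> 0"
      by (metis (mono_tags, lifting) sum.neutral)
    then show "x \<in> V - F"
      using C[of v] by (auto simp: lookup_cmono split: if_splits)
  qed
  define m' where "m' = (\<Sum>v\<in>keys m - F. single v (lookup m v))"
  have rep: "(\<Sum>_<k. single v (1::nat)) = single v k" for k and v :: "nat \<times> nat"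
    by (induction k) (auto simp flip: single_add)
  have "m = (\<Sum>v\<in>keys m \<union> F. single v (lookup m v))"
    using cover_finite[OF c] by (intro poly_mapping_sum_single_superset) auto
  also have "keys m \<union> F = F \<union> (keys m - F)"
    by blast
  also have "(\<Sum>v\<in>F \<union> (keys m - F). single v (lookup m v)) = (\<Sum>v\<in>F. single v (lookup m v)) + m'"
    unfolding m'_def using cover_finite[OF c] by (intro sum.union_disjoint) auto
  finally have m_eq: "m = (\<Sum>v\<in>F. \<Sum>_<lookup m v. single v 1) + m'"
    by (simp only: rep)
  have "cmono (C v - {v}) + single v 1 = cmono (C v)" if "v \<in> F" for v
    using C[OF that] that unfolding cmono_def by (subst add.commute, intro sum.remove[symmetric]) auto
  then have "(\<Sum>v\<in>F. \<Sum>_<lookup m v. cmono (C v)) = u + (\<Sum>v\<in>F. \<Sum>_<lookup m v. single v 1)"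
    unfolding u_def by (simp flip: sum.distrib)
  then have um: "u + m = m' + (\<Sum>v\<in>F. \<Sum>_<lookup m v. cmono (C v))"
    by (subst m_eq) (simp add: ac_simps)
  have "single (\<Sum>v\<in>F. \<Sum>_<lookup m v. cmono (C v)) 1 = (\<Prod>v\<in>F. single (cmono (C v)) (1 :: 'k) ^ lookup m v)"
    by (simp only: single_sum_prod prod_constant card_lessThan)
  moreover have "\<dots> \<in> ipow J (\<Sum>v\<in>F. lookup m v)"
  proof (intro ipow_prod[OF J_ideal] ipow_power[OF J_ideal] single_in_J)
    fix v assume "v \<in> F"
    then show "keys (cmono (C v)) \<subseteq> V" "has_chain t (keys (cmono (C v)))"
      using C[of v] by (auto simp: keys_cmono has_chain_def)
  qed
  moreover have "(\<Sum>v\<in>F. lookup m v) = wt F m"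
    using cover_finite[OF c] by (intro wt_superset[symmetric]) auto
  ultimately have "single (\<Sum>v\<in>F. \<Sum>_<lookup m v. cmono (C v)) 1 \<in> ipow J n"
    using ipow_antimono[OF J_ideal m(2)] by auto
  moreover have "single m' 1 \<in> A"
  proof (rule poly_carrier_single)
    show "keys m' \<subseteq> V"
      using m(1) arg_cong[OF m_eq, of keys] unfolding keys_add_nat by simp
  qed
  ultimately have "single m' 1 * single (\<Sum>v\<in>F. \<Sum>_<lookup m v. cmono (C v)) 1 \<in> ipow J n"
    by (intro ideal_mult[OF ideal_ipow[OF J_ideal]])
  then have "single (u + m) 1 \<in> ipow J n"
    by (simp add: um mult_single)
  then show ?thesis
    using u by (intro exI[of _ u]) (auto simp: wt_eq_0_iff)
qed

text \<open>The condition on monomials through which the two sides of the theorem are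
  compared.\<close>

definition good :: "nat \<Rightarrow> monomial \<Rightarrow> bool" where
  "good n m \<longleftrightarrow> (\<forall>F. cover F \<longrightarrow> n \<le> wt F m)"

lemma good_iff_min_cover: "good n m \<longleftrightarrow> (\<forall>F. min_cover F \<longrightarrow> n \<le> wt F m)"
proof
  assume *: "\<forall>F. min_cover F \<longrightarrow> n \<le> wt F m"
  show "good n m"
    unfolding good_def
  proof (intro allI impI)
    fix F assume F: "cover F"
    then obtain F' where F': "F' \<subseteq> F" "min_cover F'"
      using has_min_cover by blast
    then have "n \<le> wt F' m"
      using * by blast
    also have "\<dots> \<le> wt F m"
      unfolding wt_def using F'(1) by (intro sum_mono2) auto
    finally show "n \<le> wt F m" .
  qed
qed (simp add: good_def min_cover_def)

text \<open>In one direction the multiplier is cancelled at each minimal cover separately. In the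
  other, each minimal cover comes with its own monomial multiplier, and these must be combined into
  one element outside all minimal primes.\<close>

theorem symbolic_power_J: "symbolic_power A J n = polys_over r s {m. good n m}"
proof (intro equalityI subsetI)
  note iff = symbolic_power_iff[OF J_ideal minimal_primes_J_nonempty]
  fix f assume "f \<in> symbolic_power A J n"
  then obtain g where g: "g \<in> A" "\<And>P. P \<in> minimal_primes (ring_on A) J \<Longrightarrow> g \<notin> P" "g * f \<in> ipow J n" and f: "f \<in> A"
    unfolding iff by blast
  have "n \<le> wt F m" if F: "min_cover F" and m: "m \<in> keys f" for F m
  proof -
    have c: "cover F" and gF: "g \<notin> var_prime F"
      using F g(2) by (auto simp: min_cover_def minimal_primes_J)
    have "g * f \<in> polys_over r s {m. n \<le> wt F m}"
      using ipow_J_weight[OF c] g(3) by (rule subsetD)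
    then have "f \<in> polys_over r s {m. n \<le> wt F m}"
      by (rule weight_cancel_polys[OF g(1) gF f])
    then show ?thesis
      using m by (auto simp: polys_over_def)
  qed
  then show "f \<in> polys_over r s {m. good n m}"
    using f by (auto simp: polys_over_def good_iff_min_cover)
next
  note iff = symbolic_power_iff[OF J_ideal minimal_primes_J_nonempty]
  note ideal = symbolic_power_ideal[OF J_ideal minimal_primes_J_nonempty]
  fix f :: "'k mpoly" assume f: "f \<in> polys_over r s {m. good n m}"
  have "single m (lookup f m) \<in> symbolic_power A J n" if "m \<in> keys f" for m
  proof -
    have m: "keys m \<subseteq> V" "good n m"
      using f that by (auto simp: polys_over_def poly_carrier_def)
    then have "\<forall>F. min_cover F \<longrightarrow> (\<exists>u. keys u \<subseteq> V \<and> wt F u = 0 \<and> single (u + m) 1 \<in> ipow J n)"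
      using min_cover_multiplier by (auto simp: good_iff_min_cover)
    then obtain u where u: "\<And>F. min_cover F \<Longrightarrow> keys (u F) \<subseteq> V"
      "\<And>F. min_cover F \<Longrightarrow> wt F (u F) = 0" "\<And>F. min_cover F \<Longrightarrow> single (u F + m) 1 \<in> ipow J n"
      by metis
    define U where "U = u ` {F. min_cover F}"
    have "{F. min_cover F} \<subseteq> Pow V"
      by (auto simp: min_cover_def cover_def)
    then have finU: "finite U"
      unfolding U_def using V_finite by (meson finite_Pow_iff finite_imageI finite_subset)
    \<comment> \<open>For each minimal cover \<open>F\<close> the monomial \<open>u F\<close> occurs
      in \<open>g\<close> and has weight 0 on \<open>F\<close>, which keeps \<open>g\<close> out of
      \<open>var_prime F\<close>. Summing over the set \<open>U\<close>, where coinciding monomials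
      are merged, makes every coefficient 1.\<close>
    define g :: "'k mpoly" where "g = (\<Sum>a\<in>U. single a 1)"
    have g_lookup: "lookup g a = (if a \<in> U then 1 else 0)" for a
      using finU by (simp add: g_def lookup_sum lookup_single when_def)
    have "g \<in> A"
      unfolding g_def using u(1) by (intro sum_mem poly_carrier_single) (auto simp: U_def)
    moreover have "g \<notin> P" if P: "P \<in> minimal_primes (ring_on A) J" for P
    proof -
      obtain F where F: "P = var_prime F" "min_cover F"
        using P by (auto simp: minimal_primes_J)
      then have "u F \<in> keys g"
        by (auto simp: in_keys_iff g_lookup U_def)
      then show ?thesis
        using u(2)[OF F(2)] F(1) by (auto simp: var_prime_def polys_over_def)
    qed
    moreover have "g * single m (1 :: 'k) \<in> ipow J n"
      unfolding g_def sum_distrib_right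
      using u(3) by (intro ideal_sum[OF ideal_ipow[OF J_ideal]]) (auto simp: U_def mult_single)
    moreover have "single m 1 \<in> A"
      using m(1) by (rule poly_carrier_single)
    ultimately have "single m 1 \<in> symbolic_power A J n"
      unfolding iff by blast
    then have "single 0 (lookup f m) * single m 1 \<in> symbolic_power A J n"
      by (intro ideal_mult[OF ideal] poly_carrier_single) auto
    then show ?thesis
      by (simp add: mult_single)
  qed
  then have "(\<Sum>m\<in>keys f. single m (lookup f m)) \<in> symbolic_power A J n"
    by (intro ideal_sum[OF ideal])
  then show "f \<in> symbolic_power A J n"
    by (simp flip: poly_mapping_sum_single)
qed

end

section \<open>Partial derivatives\<close>

text \<open>If \<open>v\<close> does not occur in \<open>m\<close>, the truncated difference is
  \<open>m\<close> itself, and the factor \<open>lookup m v = 0\<close> removes the term.\<close>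

definition pdiff :: "'v \<Rightarrow> (('v \<Rightarrow>\<^sub>0 nat) \<Rightarrow>\<^sub>0 'k::comm_ring_1) \<Rightarrow> ('v \<Rightarrow>\<^sub>0 nat) \<Rightarrow>\<^sub>0 'k" where
  "pdiff v f = (\<Sum>m\<in>keys f. single (m - single v 1) (of_nat (lookup m v) * lookup f m))"

lemma pdiff_superset:
  assumes "finite S" "keys f \<subseteq> S"
  shows "pdiff v f = (\<Sum>m\<in>S. single (m - single v 1) (of_nat (lookup m v) * lookup f m))"
  unfolding pdiff_def by (rule sum.mono_neutral_left) (use assms in \<open>auto simp: in_keys_iff\<close>)

lemma pdiff_add: "pdiff v (f + g) = pdiff v f + pdiff v g"
proof -
  let ?S = "keys f \<union> keys g \<union> keys (f + g)"
  have "pdiff v f = (\<Sum>m\<in>?S. single (m - single v 1) (of_nat (lookup m v) * lookup f m))"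
    "pdiff v g = (\<Sum>m\<in>?S. single (m - single v 1) (of_nat (lookup m v) * lookup g m))"
    "pdiff v (f + g) = (\<Sum>m\<in>?S. single (m - single v 1) (of_nat (lookup m v) * lookup (f + g) m))"
    by (intro pdiff_superset; auto)+
  then show ?thesis
    by (simp only: lookup_add distrib_left single_add sum.distrib)
qed

lemma pdiff_0 [simp]: "pdiff v 0 = 0"
  by (simp add: pdiff_def)

lemma pdiff_sum: "pdiff v (\<Sum>x\<in>S. f x) = (\<Sum>x\<in>S. pdiff v (f x))"
  by (induction S rule: infinite_finite_induct) (auto simp: pdiff_add)

lemma pdiff_single: "pdiff v (single m c) = single (m - single v 1) (of_nat (lookup m v) * c)"
  by (cases "c = 0") (auto simp: pdiff_def)

lemma add_diff_single:
  fixes a b :: "'v \<Rightarrow>\<^sub>0 nat"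
  assumes "lookup b v > 0"
  shows "a + (b - single v 1) = a + b - single v 1"
proof (rule poly_mapping_eqI)
  show "lookup (a + (b - single v 1)) w = lookup (a + b - single v 1) w" for w
    using assms by (cases "w = v") (auto simp: lookup_add lookup_minus lookup_single)
qed

lemma pdiff_mult_single:
  fixes a b :: "'v \<Rightarrow>\<^sub>0 nat"
  shows "pdiff v (single a c * single b d) = single a c * pdiff v (single b d) + pdiff v (single a c) * single b d"
proof -
  have 1: "single a c * pdiff v (single b d) = single (a + b - single v 1) (of_nat (lookup b v) * (c * d))" for a b c d
  proof (cases "lookup b v = 0")
    case False
    then show ?thesis
      by (simp add: pdiff_single mult_single add_diff_single[unfolded One_nat_def] ac_simps)
  qed (simp add: pdiff_single)
  have "pdiff v (single a c) * single b d = single (a + b - single v 1) (of_nat (lookup a v) * (c * d))"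
    using 1[of b d a c] by (simp add: ac_simps)
  then show ?thesis
    unfolding 1 by (simp add: mult_single pdiff_single lookup_add distrib_right flip: single_add)
       (simp add: ac_simps)
qed

lemma pdiff_mult: "pdiff v (f * g) = f * pdiff v g + pdiff v f * g"
proof -
  let ?f = "\<lambda>a. single a (lookup f a)" and ?g = "\<lambda>b. single b (lookup g b)"
  have f: "f = (\<Sum>a\<in>keys f. ?f a)" and g: "g = (\<Sum>b\<in>keys g. ?g b)"
    by (rule poly_mapping_sum_single)+
  have "pdiff v (f * g) = pdiff v ((\<Sum>a\<in>keys f. ?f a) * (\<Sum>b\<in>keys g. ?g b))"
    by (simp flip: poly_mapping_sum_single)
  also have "\<dots> = (\<Sum>a\<in>keys f. \<Sum>b\<in>keys g. ?f a * pdiff v (?g b) + pdiff v (?f a) * ?g b)"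
    by (simp only: sum_product pdiff_sum pdiff_mult_single)
  also have "\<dots> = (\<Sum>a\<in>keys f. ?f a) * pdiff v (\<Sum>b\<in>keys g. ?g b) + pdiff v (\<Sum>a\<in>keys f. ?f a) * (\<Sum>b\<in>keys g. ?g b)"
    by (simp only: sum_product pdiff_sum sum.distrib)
  also have "\<dots> = f * pdiff v g + pdiff v f * g"
    by (simp flip: poly_mapping_sum_single)
  finally show ?thesis .
qed

lemma lookup_pdiff: "lookup (pdiff v f) m = of_nat (lookup m v + 1) * lookup f (m + single v 1)"
proof -
  have "lookup (single (a - single v 1) (of_nat (lookup a v) * lookup f a)) m
      = (if a = m + single v 1 then of_nat (lookup a v) * lookup f a else 0)" for a
  proof (cases "lookup a v = 0")
    case True
    then have "a \<noteq> m + single v 1"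
      by (auto simp: lookup_add)
    with True show ?thesis
      by simp
  next
    case False
    then have "a - single v 1 = m \<longleftrightarrow> a = m + single v 1"
      using add_diff_single[of a v "single v 1"] by (auto simp: add.commute)
    then show ?thesis
      by (simp add: lookup_single when_def)
  qed
  then have "lookup (pdiff v f) m = (\<Sum>a\<in>keys f. if a = m + single v 1 then of_nat (lookup a v) * lookup f a else 0)"
    by (simp only: pdiff_def lookup_sum)
  also have "\<dots> = of_nat (lookup m v + 1) * lookup f (m + single v 1)"
    by (auto simp: in_keys_iff lookup_add)
  finally show ?thesis .
qed

text \<open>The coefficient of \<open>m\<close> in the derivative is the leading coefficient times
  the exponent of \<open>v\<close>, nonzero in characteristic 0. Adding \<open>single v 1\<close>
  preserves the order, so no greater monomial arises.\<close>

lemma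
  fixes f :: "'k::field_char_0 mpoly"
  assumes "f \<noteq> 0" "lead f = m + single v 1"
  shows pdiff_nonzero: "pdiff v f \<noteq> 0" and lead_pdiff: "lead (pdiff v f) = m"
proof -
  have "lookup (pdiff v f) m \<noteq> 0"
    using lead_in_keys[OF assms(1)] of_nat_neq_0[of "lookup m v", where 'a = 'k]
    unfolding lookup_pdiff by (simp add: assms(2) in_keys_iff)
  then have m: "m \<in> keys (pdiff v f)"
    by (simp add: in_keys_iff)
  then show "pdiff v f \<noteq> 0"
    by auto
  show "lead (pdiff v f) = m"
  proof (rule lead_eqI[OF m])
    fix a assume "a \<in> keys (pdiff v f)"
    then have "a + single v 1 \<in> keys f"
      by (auto simp: in_keys_iff lookup_pdiff)
    then have "\<not> m + single v 1 < a + single v 1"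
      using lead_ge[of _ f] unfolding assms(2) not_less by blast
    then have "\<not> m < a"
      using add_strict_right_mono by blast
    then show "a \<le> m"
      by simp
  qed
qed

lemma pdiff_in_carrier:
  assumes "f \<in> poly_carrier r s"
  shows "pdiff v f \<in> poly_carrier r s"
  unfolding poly_carrier_def
proof (intro CollectI ballI)
  fix m assume "m \<in> keys (pdiff v f)"
  then have "m + single v 1 \<in> keys f"
    by (auto simp: in_keys_iff lookup_pdiff)
  then show "keys m \<subseteq> {..<r} \<times> {..<s}"
    using assms keys_add_nat[of m "single v 1"] unfolding poly_carrier_def by blast
qed

section \<open>Minors in symbolic powers\<close>

text \<open>For a block matrix with blocks \<open>A, B, C, D\<close> this is \<open>det A\<close> times an entry of the Schur complement
  \<open>D - C A\<^sup>-\<^sup>1 B\<close>, with the inverse cleared by the adjugate.\<close>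

definition schur :: "(nat \<Rightarrow> nat \<Rightarrow> 'a::idom) \<Rightarrow> nat \<Rightarrow> nat \<Rightarrow> nat \<Rightarrow> 'a" where
  "schur h p i j = det (mat p p (\<lambda>(i, j). h i j)) * h (p + i) (p + j)
     - (\<Sum>k<p. h (p + i) k * (\<Sum>l<p. adj_mat (mat p p (\<lambda>(i, j). h i j)) $$ (k, l) * h l (p + j)))"

text \<open>Block elimination without division: left multiplication by \<open>N\<close>, which has
  determinant \<open>\<delta> ^ q\<close>, makes the block matrix upper triangular with diagonal
  blocks \<open>A\<close> and the matrix of Schur entries. No factor is cancelled, as
  \<open>\<delta>\<close> may vanish here.\<close>

lemma det_schur:
  fixes h :: "nat \<Rightarrow> nat \<Rightarrow> 'a::idom" and p q :: nat
  defines "\<delta> \<equiv> det (mat p p (\<lambda>(i, j). h i j))"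
  shows "\<delta> ^ q * det (mat (p + q) (p + q) (\<lambda>(i, j). h i j)) = \<delta> * det (mat q q (\<lambda>(i, j). schur h p i j))"
proof -
  define A where "A = mat p p (\<lambda>(i, j). h i j)"
  define B where "B = mat p q (\<lambda>(i, j). h i (p + j))"
  define C where "C = mat q p (\<lambda>(i, j). h (p + i) j)"
  define D where "D = mat q q (\<lambda>(i, j). h (p + i) (p + j))"
  have carr [simp]: "A \<in> carrier_mat p p" "B \<in> carrier_mat p q" "C \<in> carrier_mat q p" "D \<in> carrier_mat q q"
    by (auto simp: A_def B_def C_def D_def)
  note adj = adj_mat[OF carr(1)]
  have M: "mat (p + q) (p + q) (\<lambda>(i, j). h i j) = four_block_mat A B C D"
    by (rule eq_matI) (auto simp: A_def B_def C_def D_def)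
  define N where "N = four_block_mat (1\<^sub>m p) (0\<^sub>m p q) (- (C * adj_mat A)) (\<delta> \<cdot>\<^sub>m 1\<^sub>m q)"
  have CA [simp]: "- (C * adj_mat A) \<in> carrier_mat q p"
    using adj(1) by (auto intro!: uminus_carrier_mat mult_carrier_mat[of _ q p])
  have "N * four_block_mat A B C D = four_block_mat (1\<^sub>m p * A + 0\<^sub>m p q * C) (1\<^sub>m p * B + 0\<^sub>m p q * D)
      (- (C * adj_mat A) * A + (\<delta> \<cdot>\<^sub>m 1\<^sub>m q) * C) (- (C * adj_mat A) * B + (\<delta> \<cdot>\<^sub>m 1\<^sub>m q) * D)"
    unfolding N_def by (rule mult_four_block_mat[OF one_carrier_mat zero_carrier_mat CA _ carr]) simp
  also have "1\<^sub>m p * A + 0\<^sub>m p q * C = A"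
    by (simp only: left_mult_zero_mat[OF carr(3)] left_mult_one_mat[OF carr(1)] right_add_zero_mat[OF carr(1)])
  also have "1\<^sub>m p * B + 0\<^sub>m p q * D = B"
    by (simp only: left_mult_zero_mat[OF carr(4)] left_mult_one_mat[OF carr(2)] right_add_zero_mat[OF carr(2)])
  also have "- (C * adj_mat A) * A + (\<delta> \<cdot>\<^sub>m 1\<^sub>m q) * C = 0\<^sub>m q p"
  proof -
    have "- (C * adj_mat A) * A = - (C * (adj_mat A * A))"
      unfolding assoc_mult_mat[OF carr(3) adj(1) carr(1), symmetric]
      by (rule uminus_mult_left_mat) (simp add: carrier_matD[OF adj(1)] carrier_matD[OF carr(1)])
    also have "C * (adj_mat A * A) = \<delta> \<cdot>\<^sub>m C"
      unfolding adj(3) mult_smult_distrib[OF carr(3) one_carrier_mat] right_mult_one_mat[OF carr(3)]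
      by (simp add: \<delta>_def A_def)
    finally have 1: "- (C * adj_mat A) * A = - (\<delta> \<cdot>\<^sub>m C)" .
    have 2: "(\<delta> \<cdot>\<^sub>m 1\<^sub>m q) * C = \<delta> \<cdot>\<^sub>m C"
      by (simp only: mult_smult_assoc_mat[OF one_carrier_mat carr(3)] left_mult_one_mat[OF carr(3)])
    show ?thesis
      unfolding 1 2 by (rule eq_matI) (auto simp: C_def)
  qed
  also have "- (C * adj_mat A) * B + (\<delta> \<cdot>\<^sub>m 1\<^sub>m q) * D = mat q q (\<lambda>(i, j). schur h p i j)"
  proof -
    have 1: "- (C * adj_mat A) * B = - (C * (adj_mat A * B))"
      unfolding assoc_mult_mat[OF carr(3) adj(1) carr(2), symmetric]
      by (rule uminus_mult_left_mat) (simp add: carrier_matD[OF adj(1)] carrier_matD[OF carr(2)])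
    have 2: "(\<delta> \<cdot>\<^sub>m 1\<^sub>m q) * D = \<delta> \<cdot>\<^sub>m D"
      by (simp only: mult_smult_assoc_mat[OF one_carrier_mat carr(4)] left_mult_one_mat[OF carr(4)])
    have 3: "(C * (adj_mat A * B)) $$ (i, j) = (\<Sum>k<p. h (p + i) k * (\<Sum>l<p. adj_mat A $$ (k, l) * h l (p + j)))"
      if ij: "i < q" "j < q" for i j
    proof -
      have entry: "(X * Y) $$ (i, j) = (\<Sum>k<n. X $$ (i, k) * Y $$ (k, j))"
        if "X \<in> carrier_mat a n" "Y \<in> carrier_mat n b" "i < a" "j < b"
        for X Y :: "'a mat" and a n b i j
        using that by (auto simp: scalar_prod_def atLeast0LessThan)
      have AB: "adj_mat A * B \<in> carrier_mat p q"
        using adj(1) carr(2) by (rule mult_carrier_mat)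
      show ?thesis
        unfolding entry[OF carr(3) AB ij] using ij entry[OF adj(1) carr(2) _ ij(2)]
        by (intro sum.cong refl) (simp add: B_def C_def)
    qed
    have 4: "C * (adj_mat A * B) \<in> carrier_mat q q"
      using adj(1) by (intro mult_carrier_mat[of _ q p] mult_carrier_mat[of _ p p]) auto
    show ?thesis
      unfolding 1 2
    proof (rule eq_matI)
      fix i j assume "i < dim_row (mat q q (\<lambda>(i, j). schur h p i j))" "j < dim_col (mat q q (\<lambda>(i, j). schur h p i j))"
      then have ij: "i < q" "j < q"
        by auto
      have "(- (C * (adj_mat A * B))) $$ (i, j) = - ((C * (adj_mat A * B)) $$ (i, j))"
        by (rule index_uminus_mat) (simp_all only: carrier_matD[OF 4] ij)
      then show "(- (C * (adj_mat A * B)) + \<delta> \<cdot>\<^sub>m D) $$ (i, j) = mat q q (\<lambda>(i, j). schur h p i j) $$ (i, j)"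
        using ij 3[OF ij] by (simp add: schur_def \<delta>_def D_def flip: A_def)
    qed (simp_all add: D_def)
  qed
  finally have "N * four_block_mat A B C D = four_block_mat A B (0\<^sub>m q p) (mat q q (\<lambda>(i, j). schur h p i j))" .
  moreover have "det (N * four_block_mat A B C D) = det N * det (four_block_mat A B C D)"
    unfolding N_def
    by (rule det_mult[OF four_block_carrier_mat[OF one_carrier_mat] four_block_carrier_mat[OF carr(1,4)]]) simp
  moreover have "det N = \<delta> ^ q"
    unfolding N_def det_four_block_mat_upper_right_zero[OF one_carrier_mat refl CA smult_carrier_mat[OF one_carrier_mat]]
    by simp
  moreover have "det (four_block_mat A B (0\<^sub>m q p) (mat q q (\<lambda>(i, j). schur h p i j))) = \<delta> * det (mat q q (\<lambda>(i, j). schur h p i j))"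
    by (subst det_four_block_mat_lower_left_zero[of _ p _ q]) (auto simp: \<delta>_def A_def)
  ultimately show ?thesis
    unfolding M by simp
qed

text \<open>The case \<open>q = 1\<close> of \<open>det_schur\<close> for the bordered matrix, with
  the common nonzero factor cancelled. Inserted into \<open>det_schur\<close> it gives Sylvester's
  identity.\<close>

lemma schur_eq_bordered:
  fixes h :: "nat \<Rightarrow> nat \<Rightarrow> 'a::idom"
  assumes "det (mat p p (\<lambda>(i, j). h i j)) \<noteq> 0"
  shows "schur h p i j = det (mat (Suc p) (Suc p)
    (\<lambda>(a, b). h (if a < p then a else p + i) (if b < p then b else p + j)))"
proof -
  define h' where "h' a b = h (if a < p then a else p + i) (if b < p then b else p + j)" for a b
  have mat: "mat p p (\<lambda>(i, j). h' i j) = mat p p (\<lambda>(i, j). h i j)"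
    by (rule eq_matI) (auto simp: h'_def)
  have "schur h' p 0 0 = schur h p i j"
    unfolding schur_def mat by (simp add: h'_def)
  then show ?thesis
    using det_schur[of p h' 1] assms unfolding mat by (simp add: det_single h'_def)
qed

section \<open>Symbolic powers of the determinantal ideal\<close>

context generic_determinants
begin

lemma minimal_primes_I: "minimal_primes (ring_on A) I = {I}"
  by (rule minimal_primes_prime[OF I_prime])

lemma symbolic_I_iff: "f \<in> symbolic_power A I n \<longleftrightarrow> f \<in> A \<and> (\<exists>g\<in>A - I. g * f \<in> ipow I n)"
  using symbolic_power_iff[OF I_ideal] by (simp add: minimal_primes_I)

text \<open>By the product rule, differentiation destroys at most one of the \<open>n + 1\<close>
  factors from \<open>I\<close>.\<close>

lemma pdiff_ipow: "f \<in> ipow I (Suc n) \<Longrightarrow> pdiff v f \<in> ipow I n"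
proof (induction n arbitrary: f)
  case 0
  then have "f \<in> A"
    using ideal_subset[OF ideal_ipow[OF I_ideal]] by blast
  then show ?case
    unfolding ipow_0 by (rule pdiff_in_carrier)
next
  case (Suc n)
  note ideal = ideal_ipow[OF I_ideal]
  from Suc.prems show ?case
  proof (induction rule: ipow_Suc_induct)
    case (mult a b)
    have "b \<in> A"
      using mult(2) ideal_subset[OF I_ideal] by blast
    then have "a * pdiff v b \<in> ipow I (Suc n)"
      using ideal_mult[OF ideal pdiff_in_carrier mult(1)] by (simp add: mult.commute)
    moreover have "pdiff v a * b \<in> ipow I (Suc n)"
      using ipow_mult[OF I_ideal Suc.IH[OF mult(1)], of b 1] mult(2) ipow_1[OF I_ideal] by simp
    ultimately show ?case
      unfolding pdiff_mult by (rule ideal_add[OF ideal])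
  next
    case (add a b)
    then show ?case
      unfolding pdiff_add by (intro ideal_add[OF ideal])
  qed
qed

lemma pdiff_symbolic_power:
  assumes "f \<in> symbolic_power A I (Suc n)"
  shows "pdiff v f \<in> symbolic_power A I n"
proof -
  note ideal = ideal_ipow[OF I_ideal]
  obtain g where f: "f \<in> A" and g: "g \<in> A" "g \<notin> I" "g * f \<in> ipow I (Suc n)"
    using assms unfolding symbolic_I_iff by blast
  \<comment> \<open>The product rule for \<open>g * f\<close> leaves a term
    \<open>pdiff v g * f\<close>, which a second factor \<open>g\<close> turns into a multiple of
    \<open>g * f\<close>. Since \<open>I\<close> is prime, \<open>g * g\<close> is still a
    multiplier outside \<open>I\<close>.\<close>
  have "(g * g) * pdiff v f = g * pdiff v (g * f) - pdiff v g * (g * f)"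
    by (simp add: pdiff_mult algebra_simps)
  also have "\<dots> \<in> ipow I n"
  proof (rule ideal_diff[OF ideal])
    show "g * pdiff v (g * f) \<in> ipow I n"
      by (rule ideal_mult[OF ideal g(1) pdiff_ipow[OF g(3)]])
    have "g * f \<in> ipow I n"
      using g(3) ipow_antimono[OF I_ideal, of n "Suc n"] by auto
    then show "pdiff v g * (g * f) \<in> ipow I n"
      by (rule ideal_mult[OF ideal pdiff_in_carrier[OF g(1)]])
  qed
  finally have "(g * g) * pdiff v f \<in> ipow I n" .
  moreover have "g * g \<in> A - I"
    using g I_prime mult_mem[of g g] unfolding primeideal_on_iff by blast
  ultimately show ?thesis
    unfolding symbolic_I_iff using pdiff_in_carrier[OF f] by blast
qed

lemma symbolic_I_antimono: "m \<le> n \<Longrightarrow> symbolic_power A I n \<subseteq> symbolic_power A I m"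
  by (rule symbolic_power_antimono[OF I_ideal]) (simp_all add: minimal_primes_I)

lemma symbolic_I_Suc_subset: "symbolic_power A I (Suc n) \<subseteq> I"
proof
  fix f assume "f \<in> symbolic_power A I (Suc n)"
  then have "f \<in> symbolic_power A I 1"
    using symbolic_I_antimono[of 1 "Suc n"] by auto
  then obtain g where "f \<in> A" "g \<in> A" "g \<notin> I" "g * f \<in> I"
    unfolding symbolic_I_iff ipow_1[OF I_ideal] by blast
  then show "f \<in> I"
    using I_prime unfolding primeideal_on_iff by blast
qed

text \<open>For positive exponent \<open>f\<close> lies in \<open>I\<close>, so its leading monomial
  contains a \<open>t\<close>-chain and hence a variable of \<open>F\<close>. Differentiating by
  this variable lowers both the exponent and the weight by one.\<close>

lemma lead_symbolic_power_weight:
  assumes "cover F" "f \<in> symbolic_power A I n" "f \<noteq> 0"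
  shows "n \<le> wt F (lead f)"
  using assms(2,3)
proof (induction n arbitrary: f)
  case (Suc n)
  have "f \<in> I"
    using Suc.prems(1) symbolic_I_Suc_subset by blast
  then have "keys (lead f) \<subseteq> V" "has_chain t (keys (lead f))"
    using lead_I Suc.prems(2) by blast+
  then obtain v where v: "v \<in> keys (lead f)" "v \<in> F"
    using cover_meets_chain[OF assms(1)] by blast
  obtain m where m: "lead f = m + single v 1"
    using cmono_split[of "{v}" "lead f"] v(1) by (auto simp: cmono_def)
  have "n \<le> wt F m"
    using Suc.IH[OF pdiff_symbolic_power[OF Suc.prems(1)] pdiff_nonzero[OF Suc.prems(2) m]]
    by (simp add: lead_pdiff[OF Suc.prems(2) m])
  then show ?case
    using v(2) by (simp add: m wt_add)
qed simp

lemma det_in_ipow: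
  assumes "\<And>i j. i < q \<Longrightarrow> j < q \<Longrightarrow> h i j \<in> I"
  shows "det (mat q q (\<lambda>(i, j). h i j)) \<in> ipow I q"
proof -
  note ideal = ideal_ipow[OF I_ideal]
  have "signof p * (\<Prod>i = 0..<q. mat q q (\<lambda>(i, j). h i j) $$ (i, p i)) \<in> ipow I q" if p: "p permutes {0..<q}" for p
  proof -
    have "(\<Prod>i = 0..<q. mat q q (\<lambda>(i, j). h i j) $$ (i, p i)) \<in> ipow I (\<Sum>i = 0..<q. 1)"
    proof (rule ipow_prod[OF I_ideal])
      fix i assume "i \<in> {0..<q}"
      then show "mat q q (\<lambda>(i, j). h i j) $$ (i, p i) \<in> ipow I 1"
        using permutes_in_image[OF p, of i] assms unfolding ipow_1[OF I_ideal] by simp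
    qed
    then show ?thesis
      using ideal_uminus[OF ideal] by (auto simp: sign_def)
  qed
  then show ?thesis
    unfolding det_def'[OF mat_carrier] by (intro ideal_sum[OF ideal]) simp
qed

text \<open>With \<open>p = t - 1\<close> and \<open>q = m - p\<close>, the corner minor
  \<open>\<delta>\<close> of size \<open>p\<close> is outside the prime \<open>I\<close>, and each
  Schur entry is a \<open>t\<close>-minor bordering it. So \<open>\<delta> ^ q\<close> times the
  \<open>m\<close>-minor is \<open>\<delta>\<close> times a determinant of size \<open>q\<close>
  with entries in \<open>I\<close>.\<close>

lemma gminor_symbolic_power:
  assumes "incr m \<rho>" "incr m \<gamma>" "\<And>i. i < m \<Longrightarrow> \<rho> i < r" "\<And>i. i < m \<Longrightarrow> \<gamma> i < s"
  shows "gminor m \<rho> \<gamma> \<in> symbolic_power A I (m - (t - 1))"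
proof (cases "t - 1 \<le> m")
  \<comment> \<open>The truncated exponent is 0, and the symbolic power is the whole ring.\<close>
  case False
  then show ?thesis
    using gminor_in_carrier[of m \<rho> r \<gamma> s] assms(3,4) symbolic_power_0[OF I_ideal]
    by (simp add: minimal_primes_I)
next
  case True
  define p q where "p = t - 1" and "q = m - (t - 1)"
  have m: "m = p + q" and t: "t = Suc p"
    using True t_pos by (auto simp: p_def q_def)
  define h :: "nat \<Rightarrow> nat \<Rightarrow> 'k mpoly" where "h i j = var (\<rho> i, \<gamma> j)" for i j
  define \<delta> where "\<delta> = det (mat p p (\<lambda>(i, j). h i j))"
  have incr_p: "incr p \<rho>" "incr p \<gamma>"
    using assms(1,2) by (auto simp: incr_def m)
  have \<delta>: "\<delta> = gminor p \<rho> \<gamma>"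
    by (simp add: \<delta>_def gminor_def h_def)
  have \<delta>I: "\<delta> \<notin> I" "\<delta> \<in> A" "\<delta> \<noteq> 0"
    unfolding \<delta> using gminor_notin_I[folded p_def, OF incr_p] gminor_nonzero[OF incr_p]
      gminor_in_carrier[of p \<rho> r \<gamma> s] assms(3,4)
    by (simp_all add: m)
  have "schur h p i j \<in> I" if "i < q" "j < q" for i j
  proof -
    \<comment> \<open>Below \<open>t = p + 1\<close> only the last index \<open>p\<close> is
      redirected, to \<open>p + i\<close>, so the rows stay increasing.\<close>
    define \<rho>' where "\<rho>' a = \<rho> (if a < p then a else p + i)" for a
    define \<gamma>' where "\<gamma>' b = \<gamma> (if b < p then b else p + j)" for b
    have "schur h p i j = gminor t \<rho>' \<gamma>'"
      using schur_eq_bordered[of p h i j] \<delta>I(3)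
      by (simp add: \<delta>_def gminor_def t h_def \<rho>'_def \<gamma>'_def)
    moreover have "incr t \<rho>'" "incr t \<gamma>'"
      using assms(1,2) that by (auto simp: incr_def t m \<rho>'_def \<gamma>'_def)
    moreover have "\<rho>' a < r" "\<gamma>' a < s" for a
      using assms(3,4) that by (auto simp: m \<rho>'_def \<gamma>'_def)
    ultimately show ?thesis
      using gminor_in_minors[of t \<rho>' \<gamma>' r s] minors_subset_I by auto
  qed
  then have "\<delta> * det (mat q q (\<lambda>(i, j). schur h p i j)) \<in> ipow I q"
    by (intro ideal_mult[OF ideal_ipow[OF I_ideal] \<delta>I(2)] det_in_ipow)
  then have "\<delta> ^ q * gminor m \<rho> \<gamma> \<in> ipow I q"
    using det_schur[of p h q] by (simp add: \<delta>_def gminor_def m h_def)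
  moreover have "\<delta> ^ k \<in> A - I" for k
  proof (induction k)
    case 0
    then show ?case
      using one_mem I_prime by (simp add: primeideal_on_iff)
  next
    case (Suc k)
    then show ?case
      using \<delta>I I_prime mult_mem[of \<delta> "\<delta> ^ k"] unfolding primeideal_on_iff by auto
  qed
  moreover have "gminor m \<rho> \<gamma> \<in> A"
    using assms(3,4) by (rule gminor_in_carrier)
  ultimately show ?thesis
    unfolding symbolic_I_iff q_def by blast
qed

text \<open>The witness is \<open>single e 1\<close> times the product of the minors with diagonals
  \<open>D C\<close>; a chain with fewer than \<open>t\<close> elements contributes exponent 0. The
  chains are indexed by \<open>\<C>\<close> instead of being collected in a set because different
  indices may give the same chain.\<close>

lemma chains_symbolic_power:
  assumes "finite \<C>" "\<And>C. C \<in> \<C> \<Longrightarrow> finite (D C) \<and> diag_chain (D C) \<and> D C \<subseteq> V"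
    and m: "m = e + (\<Sum>C\<in>\<C>. cmono (D C))" "keys m \<subseteq> V" and n: "n \<le> (\<Sum>C\<in>\<C>. card (D C) - (t - 1))"
  shows "\<exists>f\<in>symbolic_power A I n. f \<noteq> 0 \<and> lead f = m"
proof -
  note sym_ideal = symbolic_power_ideal[OF I_ideal]
  have "\<exists>g. g \<in> symbolic_power A I (card (D C) - (t - 1)) \<and> g \<noteq> 0 \<and> lead g = cmono (D C)" if C: "C \<in> \<C>" for C
  proof -
    obtain \<rho> \<gamma> where g: "incr (card (D C)) \<rho>" "incr (card (D C)) \<gamma>" "\<And>i. i < card (D C) \<Longrightarrow> \<rho> i < r"
      "\<And>i. i < card (D C) \<Longrightarrow> \<gamma> i < s" "dmono (card (D C)) \<rho> \<gamma> = cmono (D C)"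
      using chain_gminor[of "D C" "card (D C)"] assms(2)[OF C] by metis
    then show ?thesis
      using gminor_symbolic_power[OF g(1-4)] gminor_nonzero[OF g(1,2)] lead_gminor[OF g(1,2), where 'k = 'k]
      by (intro exI[of _ "gminor (card (D C)) \<rho> \<gamma>"]) simp
  qed
  then obtain g where g: "\<And>C. C \<in> \<C> \<Longrightarrow> g C \<in> symbolic_power A I (card (D C) - (t - 1))"
    "\<And>C. C \<in> \<C> \<Longrightarrow> g C \<noteq> 0" "\<And>C. C \<in> \<C> \<Longrightarrow> lead (g C) = cmono (D C)"
    by metis
  have "prod g \<C> \<in> symbolic_power A I (\<Sum>C\<in>\<C>. card (D C) - (t - 1))"
    by (rule symbolic_power_prod[OF I_ideal]) (use g(1) in \<open>simp_all add: minimal_primes_I\<close>)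
  then have "prod g \<C> \<in> symbolic_power A I n"
    using symbolic_I_antimono[OF n] by blast
  moreover have "single e 1 \<in> A"
    using m by (intro poly_carrier_single) (simp add: keys_add_nat)
  ultimately have "single e 1 * prod g \<C> \<in> symbolic_power A I n"
    by (intro ideal_mult[OF sym_ideal]) (simp_all add: minimal_primes_I)
  moreover have e: "single e (1 :: 'k) \<noteq> 0"
    by (metis lookup_single_eq lookup_zero zero_neq_one)
  moreover have p: "prod g \<C> \<noteq> 0"
    using g(2) assms(1) by simp
  moreover have "lead (single e (1 :: 'k)) = e"
    by (simp add: lead_def)
  moreover have "lead (prod g \<C>) = (\<Sum>C\<in>\<C>. cmono (D C))"
    using lead_prod[of \<C> g] g(2,3) by simp
  ultimately show ?thesis
    using lead_mult[OF e p] m(1) by (intro bexI[of _ "single e 1 * prod g \<C>"]) auto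
qed

text \<open>Greene--Kleitman is applied to the multiset of variables of a monomial; copies of a variable are incomparable.\<close>

lemma good_lead_symbolic_power:
  assumes m: "keys m \<subseteq> V" "good n m"
  shows "\<exists>f\<in>symbolic_power A I n. f \<noteq> 0 \<and> lead f = m"
proof -
  define E where "E = Sigma (keys m) (\<lambda>v. {..<lookup m v})"
  define R where "R x y \<longleftrightarrow> slt (fst x) (fst y)" for x y :: "(nat \<times> nat) \<times> nat"
  have finE: "finite E"
    by (simp add: E_def)
  have irr: "\<not> R x x" and tr: "R x y \<Longrightarrow> R y z \<Longrightarrow> R x z" for x y z
    using slt_irrefl slt_trans unfolding R_def by blast+
  show ?thesis
  proof (rule greene_kleitman[of E R "t - 1", OF finE irr tr])
    fix \<C> G
    assume \<C>: "finite \<C>" "\<And>C. C \<in> \<C> \<Longrightarrow> C \<subseteq> E"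
      "\<And>C D. C \<in> \<C> \<Longrightarrow> D \<in> \<C> \<Longrightarrow> C \<noteq> D \<Longrightarrow> C \<inter> D = {}"
      "\<And>C x y. C \<in> \<C> \<Longrightarrow> x \<in> C \<Longrightarrow> y \<in> C \<Longrightarrow> x \<noteq> y \<Longrightarrow> R x y \<or> R y x"
      and G: "G \<subseteq> E" "\<And>C. C \<subseteq> G \<Longrightarrow> (\<And>x y. x \<in> C \<Longrightarrow> y \<in> C \<Longrightarrow> x \<noteq> y \<Longrightarrow> R x y \<or> R y x) \<Longrightarrow> card C \<le> t - 1"
      and bound: "card (E - G) \<le> (\<Sum>C\<in>\<C>. card C - (t - 1))"
    have finC: "finite C" if "C \<in> \<C>" for C
      using \<C>(2)[OF that] finE finite_subset by blast
    have inj: "inj_on fst C" if "C \<in> \<C>" for C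
      using \<C>(4)[OF that] slt_irrefl unfolding R_def inj_on_def by metis

    \<comment> \<open>A \<open>t\<close>-chain in \<open>V\<close> outside \<open>F\<close> would
      lift to \<open>G\<close>, one copy per variable, against the bound \<open>t - 1\<close> for
      chains in \<open>G\<close>. So \<open>F\<close> is a cover and the hypothesis on
      \<open>m\<close> applies to it; all copies of variables in \<open>F\<close> lie in
      \<open>E - G\<close>.\<close>
    define F where "F = V - fst ` G"
    have "cover F"
      unfolding cover_def
    proof
      show "\<not> has_chain t (V - F)"
      proof
        assume "has_chain t (V - F)"
        then obtain C where C: "C \<subseteq> fst ` G" "finite C" "diag_chain C" "card C = t"
          unfolding has_chain_def F_def by blast
        obtain C' where C': "C' \<subseteq> G" "inj_on fst C'" "C = fst ` C'"
          using C(1) by (metis subset_image_inj)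
        have "card C' \<le> t - 1"
        proof (rule G(2)[OF C'(1)])
          fix x y assume xy: "x \<in> C'" "y \<in> C'" "x \<noteq> y"
          then have "fst x \<noteq> fst y"
            using C'(2) by (auto simp: inj_on_def)
          then show "R x y \<or> R y x"
            using C(3) xy C'(3) unfolding diag_chain_def R_def by blast
        qed
        then show False
          using C(4) C'(2,3) t_pos by (simp add: card_image)
      qed
    qed (auto simp: F_def)
    then have "n \<le> wt F m"
      using m(2) by (simp add: good_def)
    also have "wt F m = card (Sigma (keys m \<inter> F) (\<lambda>v. {..<lookup m v}))"
      by (simp add: wt_def)
    also have "\<dots> \<le> card (E - G)"
      using finE by (intro card_mono) (auto simp: E_def F_def intro: rev_image_eqI)
    also have "\<dots> \<le> (\<Sum>C\<in>\<C>. card C - (t - 1))"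
      by (rule bound)
    also have "\<dots> = (\<Sum>C\<in>\<C>. card (fst ` C) - (t - 1))"
      using inj by (intro sum.cong) (auto simp: card_image)
    finally have n: "n \<le> (\<Sum>C\<in>\<C>. card (fst ` C) - (t - 1))" .

    have rep: "(\<Sum>_<k. single v (1::nat)) = single v k" for k and v :: "nat \<times> nat"
      by (induction k) (auto simp flip: single_add)
    have "m = (\<Sum>v\<in>keys m. \<Sum>_<lookup m v. single v 1)"
      unfolding rep by (rule poly_mapping_sum_single)
    also have "\<dots> = (\<Sum>x\<in>E. single (fst x) 1)"
      unfolding E_def by (subst sum.Sigma) (auto simp: case_prod_unfold)
    also have "\<dots> = (\<Sum>x\<in>E - \<Union>\<C>. single (fst x) 1) + (\<Sum>x\<in>\<Union>\<C>. single (fst x) 1)"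
      using finE \<C>(2) by (intro sum.subset_diff) auto
    also have "(\<Sum>x\<in>\<Union>\<C>. single (fst x) 1) = (\<Sum>C\<in>\<C>. \<Sum>x\<in>C. single (fst x) (1::nat))"
      using finC \<C>(3) by (intro sum.Union_disjoint[unfolded comp_def]) auto
    also have "\<dots> = (\<Sum>C\<in>\<C>. cmono (fst ` C))"
      unfolding cmono_def using inj by (intro sum.cong) (auto simp: sum.reindex)
    finally have m_eq: "m = (\<Sum>x\<in>E - \<Union>\<C>. single (fst x) 1) + (\<Sum>C\<in>\<C>. cmono (fst ` C))" .
    show ?thesis
    proof (rule chains_symbolic_power[OF \<C>(1) _ m_eq m(1) n])
      fix C assume C: "C \<in> \<C>"
      have "diag_chain (fst ` C)"
        unfolding diag_chain_def using \<C>(4)[OF C] unfolding R_def by blast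
      moreover have "fst ` C \<subseteq> V"
        using \<C>(2)[OF C] m(1) by (auto simp: E_def)
      ultimately show "finite (fst ` C) \<and> diag_chain (fst ` C) \<and> fst ` C \<subseteq> V"
        using finC[OF C] by simp
    qed
  qed
qed

text \<open>The leading monomials on the left are the monomials satisfying \<open>good n\<close>:
  necessity comes from derivatives, sufficiency from products of minors. By
  \<open>symbolic_power_J\<close> the same monomials span the right-hand side.\<close>

theorem initial_ideal_symbolic_power:
  "initial_ideal r s (symbolic_power A I n) = symbolic_power A J n"
proof -
  have ideal: "ideal (symbolic_power A I n) (ring_on A)"
    by (rule symbolic_power_ideal[OF I_ideal]) (simp add: minimal_primes_I)
  have "{lead f |f. f \<in> symbolic_power A I n \<and> f \<noteq> 0} = {m. keys m \<subseteq> V \<and> good n m}"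
  proof (intro equalityI subsetI)
    fix m :: monomial assume "m \<in> {lead f |f. f \<in> symbolic_power A I n \<and> f \<noteq> 0}"
    then obtain f where f: "m = lead f" "f \<in> symbolic_power A I n" "f \<noteq> 0"
      by blast
    then show "m \<in> {m. keys m \<subseteq> V \<and> good n m}"
      using lead_symbolic_power_weight lead_in_V[of f] ideal_subset[OF ideal] by (auto simp: good_def)
  next
    fix m :: monomial assume "m \<in> {m. keys m \<subseteq> V \<and> good n m}"
    then show "m \<in> {lead f |f. f \<in> symbolic_power A I n \<and> f \<noteq> 0}"
      using good_lead_symbolic_power[of m n] by blast
  qed
  then show ?thesis
    unfolding initial_ideal_eq[OF ideal] symbolic_power_J
    by (auto simp: polys_over_def poly_carrier_def)
qed

end

theorem corollary7p16:
  fixes r s t n :: nat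
  assumes "1 \<le> t" and "t \<le> min r s"
  shows "initial_ideal r s
           (symbolic_power (poly_carrier r s) (determinantal_ideal r s t :: 'k::field_char_0 mpoly set) n)
       = symbolic_power (poly_carrier r s)
           (initial_ideal r s (determinantal_ideal r s t :: 'k mpoly set)) n"
proof -
  interpret generic_determinants r s t "TYPE('k)"
    by unfold_locales (use assms in auto)
  show ?thesis
    by (rule initial_ideal_symbolic_power)
qed

end
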